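(* Let $k$ be a field, let $X$ be a well-ordered alphabet, and let the free algebra $k\langle X\rangle$ be connected graded with each letter homogeneous of positive degree. Let $I$ be an ideal of $k\langle X\rangle$ and $A:=k\langle X\rangle/I$. Assume that there exists a triangular comultiplication $\Delta$ on $k\langle X\rangle$ such that $\Delta(I)\subseteq k\langle X\rangle\otimes I+I\otimes k\langle X\rangle$. (1) For every $I$-reducible Lyndon word $v$, $$[v]\in k\langle X|I\rangle^{<v}_{\deg(v)}+k\langle X|I\rangle_{<\deg(v)}+I.$$ (2) For every pair of $I$-irreducible Lyndon words $u,v\in\mathcal{N}_I$ with $u>_{\mathrm{lex}}v$, $$[u][v]-[v][u]\in k\langle X|I\rangle^{\leq uv}_{\deg(uv)}+k\langle X|I\rangle_{<\deg(uv)}+I.$$ (3) Assume in addition that $k$ is of characteristic $0$ and that $I$ is proper. Then the set $\{[w]+I\mid w\in\mathcal{B}_I\}$ forms a basis of $A$. Consequently, $\mathcal{B}_I$ equals the set of $I$-irreducible words.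
   Context: $\langle X\rangle$ is the set of all words on $X$ (including the empty word $1$); it is a linear basis of the free algebra $k\langle X\rangle$. The lexicographic order on words: $u<_{\mathrm{lex}}v$ iff either $v$ is a proper prefix of $u$, or $u=rxs$, $v=ryt$ with $x,y\in X$, $x<y$, $r,s,t\in\langle X\rangle$. (So a word is smaller than its proper prefixes.) A word $u$ is Lyndon if it is nonempty and $u>_{\mathrm{lex}}wv$ for every factorization $u=vw$ with $v,w$ nonempty; $\mathbb{L}$ is the set of Lyndon words on $X$. Every nonempty word is uniquely a lexicographically nondecreasing product of Lyndon words. For a word $u$ of length $\geq 2$, $u_R$ is the lexicographically largest proper nonempty suffix of $u$ and $u_L$ is defined by $u=u_Lu_R$. The standard bracketing $[-]:\langle X\rangle\to k\langle X\rangle$ is defined by $[1]=1$, $[x]=x$ for $x\in X$, and for $u$ of length $\geq2$ inductively $[u]=[u_L][u_R]-[u_R][u_L]$ if $u$ is Lyndon, and $[u]=[u_L][u_R]$ otherwise. Graded lex order: $u<_{\mathrm{glex}}v$ iff $\deg(u)<\deg(v)$, or $\deg(u)=\deg(v)$ and $u<_{\mathrm{lex}}v$. The leading word of a nonzero polynomial is the $<_{\mathrm{glex}}$-largest word occurring in it. A word is $I$-reducible if it is the leading word of a polynomial in $I$, and $I$-irreducible otherwise. Put $\mathcal{N}_I=\{u\in\mathbb{L}\mid u\text{ is }I\text{-irreducible}\}$ and $\mathcal{B}_I=\{u_1\cdots u_n\mid n\ge 0,\ u_1\leq_{\mathrm{lex}}\cdots\leq_{\mathrm{lex}}u_n,\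 u_1,\ldots,u_n\in\mathcal{N}_I\}$. For a word $w$, $k\langle X\rangle^{<w}$ is the (unital, homogeneous) subalgebra generated by $\{[u]\mid u\in\mathbb{L},\ u<_{\mathrm{lex}}w\}$. The subalgebras $k\langle X|I\rangle$, $k\langle X|I\rangle^{<w}$, $k\langle X|I\rangle^{\leq w}$ of $k\langle X\rangle$ are generated by $\{[u]\mid u\in\mathcal{N}_I\}$, $\{[u]\mid u\in\mathcal{N}_I,\ u<_{\mathrm{lex}}w\}$, $\{[u]\mid u\in\mathcal{N}_I,\ u\leq_{\mathrm{lex}}w\}$ respectively. For a graded space $V$, $V_n$ is the degree-$n$ part and $V_{<n}=\bigoplus_{m<n}V_m$. A comultiplication on $k\langle X\rangle$ is an algebra homomorphism $\Delta:k\langle X\rangle\to k\langle X\rangle\otimes k\langle X\rangle$. It is triangular if for each $x\in X$, $$\Delta(x)\in 1\otimes x+x\otimes 1+\sum_{i,j>0,\ i+j=\deg(x)}k\langle X\rangle_i^{<x}\otimes k\langle X\rangle_j^{<x}+\big(k\langle X\rangle\otimes k\langle X\rangle\big)_{<\deg(x)},$$ where $k\langle X\rangle\otimes k\langle X\rangle$ has the natural grading. *)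

theory Defs
  imports
    "HOL-Library.Poly_Mapping"
    "HOL-Library.Product_Plus"
    "HOL-Library.Set_Algebras"
    "HOL-Algebra.QuotRing"
    "Jordan_Normal_Form.VS_Connect"
begin

section \<open>Free algebras and their tensor squares as monoid algebras\<close>

text \<open>
  The alphabet \<open>X\<close> is the universe of a type \<open>'x\<close> of class \<^class>\<open>wellorder\<close> and \<open>\<langle>X\<rangle>\<close> is \<open>'x list\<close>.
  With concatenation as monoid structure on lists, the monoid algebra \<open>'x list \<Rightarrow>\<^sub>0 'k\<close> is the
  free algebra \<open>k\<langle>X\<rangle>\<close>: its multiplication is the convolution from \<^theory>\<open>HOL-Library.Poly_Mapping\<close>.
\<close>

instantiation list :: (type) monoid_add
begin
definition zero_list_def: "0 = []"
definition plus_list_def: "u + v = u @ v"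
instance by standard (simp_all add: zero_list_def plus_list_def)
end

definition pm_scale :: "'k \<Rightarrow> ('a \<Rightarrow>\<^sub>0 'k) \<Rightarrow> ('a \<Rightarrow>\<^sub>0 'k::field)"
  where "pm_scale c p = Poly_Mapping.map ((*) c) p"

lemma lookup_pm_scale: "Poly_Mapping.lookup (pm_scale c p) a = c * Poly_Mapping.lookup p a"
  by (simp add: pm_scale_def Poly_Mapping.map.rep_eq when_def)

global_interpretation pm: vector_space "pm_scale :: 'k::field \<Rightarrow> ('a \<Rightarrow>\<^sub>0 'k) \<Rightarrow> ('a \<Rightarrow>\<^sub>0 'k)"
proof
  fix a b :: 'k and p q :: "'a \<Rightarrow>\<^sub>0 'k"
  show "pm_scale a (p + q) = pm_scale a p + pm_scale a q"
    by (rule poly_mapping_eqI) (simp add: lookup_pm_scale Poly_Mapping.lookup_add distrib_left)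
  show "pm_scale (a + b) p = pm_scale a p + pm_scale b p"
    by (rule poly_mapping_eqI) (simp add: lookup_pm_scale Poly_Mapping.lookup_add distrib_right)
  show "pm_scale a (pm_scale b p) = pm_scale (a * b) p"
    by (rule poly_mapping_eqI) (simp add: lookup_pm_scale mult.assoc)
  show "pm_scale 1 p = p"
    by (rule poly_mapping_eqI) (simp add: lookup_pm_scale)
qed

text \<open>
  \<open>k\<langle>X\<rangle> \<otimes> k\<langle>X\<rangle>\<close> is the monoid algebra of the product monoid \<open>\<langle>X\<rangle> \<times> \<langle>X\<rangle>\<close>, the pair \<open>(u, v)\<close> standing
  for \<open>u \<otimes> v\<close>; thus \<open>(u \<otimes> v)(u' \<otimes> v') = uu' \<otimes> vv'\<close>.
\<close>

definition tensor :: "('a \<Rightarrow>\<^sub>0 'k) \<Rightarrow> ('b \<Rightarrow>\<^sub>0 'k) \<Rightarrow> ('a \<times> 'b \<Rightarrow>\<^sub>0 'k::field)"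
  where "tensor p q =
    (\<Sum>u\<in>Poly_Mapping.keys p. \<Sum>v\<in>Poly_Mapping.keys q. Poly_Mapping.single (u, v) (Poly_Mapping.lookup p u * Poly_Mapping.lookup q v))"

text \<open>The image of \<open>V \<otimes> W\<close> in the tensor product, for subspaces \<open>V\<close> and \<open>W\<close>.\<close>

definition tensor_space :: "('a \<Rightarrow>\<^sub>0 'k) set \<Rightarrow> ('b \<Rightarrow>\<^sub>0 'k) set \<Rightarrow> ('a \<times> 'b \<Rightarrow>\<^sub>0 'k::field) set"
  where "tensor_space V W = pm.span {tensor p q | p q. p \<in> V \<and> q \<in> W}"

inductive_set subalgebra_gen :: "('a::monoid_add \<Rightarrow>\<^sub>0 'k::field) set \<Rightarrow> ('a \<Rightarrow>\<^sub>0 'k) set"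
  for S where
  one: "1 \<in> subalgebra_gen S"
| gen: "p \<in> S \<Longrightarrow> p \<in> subalgebra_gen S"
| add: "p \<in> subalgebra_gen S \<Longrightarrow> q \<in> subalgebra_gen S \<Longrightarrow> p + q \<in> subalgebra_gen S"
| mult: "p \<in> subalgebra_gen S \<Longrightarrow> q \<in> subalgebra_gen S \<Longrightarrow> p * q \<in> subalgebra_gen S"
| scale: "p \<in> subalgebra_gen S \<Longrightarrow> pm_scale c p \<in> subalgebra_gen S"


section \<open>Gradings\<close>

text \<open>
  A grading is given by a degree function \<open>\<delta>\<close> on basis elements. The second definition is \<open>V\<^bsub><n\<^esub>\<close> for
  a graded subspace \<open>V\<close>, as an elementwise sum of sets; the sum is direct because the summands
  live in different degrees.
\<close>

definition hom_part :: "('a \<Rightarrow> nat) \<Rightarrow> ('a \<Rightarrow>\<^sub>0 'k::field) set \<Rightarrow> nat \<Rightarrow> ('a \<Rightarrow>\<^sub>0 'k) set"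
  where "hom_part \<delta> V n = {p \<in> V. \<forall>u\<in>Poly_Mapping.keys p. \<delta> u = n}"

definition lower_part :: "('a \<Rightarrow> nat) \<Rightarrow> ('a \<Rightarrow>\<^sub>0 'k::field) set \<Rightarrow> nat \<Rightarrow> ('a \<Rightarrow>\<^sub>0 'k) set"
  where "lower_part \<delta> V n = (\<Sum>m<n. hom_part \<delta> V m)"

definition word_deg :: "('x \<Rightarrow> nat) \<Rightarrow> 'x list \<Rightarrow> nat"
  where "word_deg d u = sum_list (map d u)"

definition tensor_deg :: "('x \<Rightarrow> nat) \<Rightarrow> 'x list \<times> 'x list \<Rightarrow> nat"
  where "tensor_deg d = (\<lambda>(u, v). word_deg d u + word_deg d v)"


section \<open>Lyndon words and standard bracketing\<close>

text \<open>A word is smaller than its proper prefixes, unlike in \<^const>\<open>lexordp\<close>.\<close>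

definition lex_less :: "'x::linorder list \<Rightarrow> 'x list \<Rightarrow> bool"
  where "lex_less u v \<longleftrightarrow>
    (\<exists>s. s \<noteq> [] \<and> u = v @ s) \<or>
    (\<exists>r x s y t. u = r @ x # s \<and> v = r @ y # t \<and> x < y)"

definition lex_le :: "'x::linorder list \<Rightarrow> 'x list \<Rightarrow> bool"
  where "lex_le u v \<longleftrightarrow> lex_less u v \<or> u = v"

definition lyndon :: "'x::linorder list \<Rightarrow> bool"
  where "lyndon u \<longleftrightarrow>
    u \<noteq> [] \<and> (\<forall>v w. v \<noteq> [] \<and> w \<noteq> [] \<and> u = v @ w \<longrightarrow> lex_less (w @ v) u)"

definition proper_suffixes :: "'x list \<Rightarrow> 'x list set"
  where "proper_suffixes u = {s. s \<noteq> [] \<and> (\<exists>r. r \<noteq> [] \<and> u = r @ s)}"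

definition right_factor :: "'x::linorder list \<Rightarrow> 'x list"
  where "right_factor u =
    (THE s. s \<in> proper_suffixes u \<and> (\<forall>t\<in>proper_suffixes u. lex_le t s))"

definition left_factor :: "'x::linorder list \<Rightarrow> 'x list"
  where "left_factor u = (THE r. u = r @ right_factor u)"

lemma lex_less_simps [simp]:
  "\<not> lex_less [] v"
  "lex_less (x # u) []"
  "lex_less (x # u) (y # v) \<longleftrightarrow> x < y \<or> x = y \<and> lex_less u v"
proof -
  show "\<not> lex_less [] v" "lex_less (x # u) []"
    by (auto simp: lex_less_def)
  show "lex_less (x # u) (y # v) \<longleftrightarrow> x < y \<or> x = y \<and> lex_less u v"
  proof
    assume "lex_less (x # u) (y # v)"
    then consider s where "s \<noteq> []" "x # u = (y # v) @ s"
      | r a s b t where "x # u = r @ a # s" "y # v = r @ b # t" "a < b"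
      unfolding lex_less_def by blast
    then show "x < y \<or> x = y \<and> lex_less u v"
    proof cases
      case 1
      then show ?thesis by (auto simp: lex_less_def)
    next
      case 2
      show ?thesis
      proof (cases r)
        case Nil
        with 2 show ?thesis by simp
      next
        case (Cons z r')
        with 2 have "x = y" "u = r' @ a # s" "v = r' @ b # t" by auto
        with 2(3) show ?thesis unfolding lex_less_def by blast
      qed
    qed
  next
    assume "x < y \<or> x = y \<and> lex_less u v"
    then show "lex_less (x # u) (y # v)"
    proof
      assume "x < y"
      then have "x # u = [] @ x # u \<and> y # v = [] @ y # v \<and> x < y" by simp
      then show ?thesis unfolding lex_less_def by blast
    next
      assume *: "x = y \<and> lex_less u v"
      then consider s where "s \<noteq> []" "u = v @ s"
        | r a s b t where "u = r @ a # s" "v = r @ b # t" "a < b"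
        unfolding lex_less_def by blast
      then show ?thesis
      proof cases
        case 1
        with * show ?thesis by (auto simp: lex_less_def)
      next
        case 2
        with * have "x # u = (x # r) @ a # s \<and> y # v = (x # r) @ b # t \<and> a < b" by simp
        then show ?thesis unfolding lex_less_def by blast
      qed
    qed
  qed
qed

lemma lex_less_irrefl [simp]: "\<not> lex_less u u"
  by (induction u) auto

lemma lex_less_trans: "lex_less u v \<Longrightarrow> lex_less v w \<Longrightarrow> lex_less u w"
proof (induction v arbitrary: u w)
  case Nil
  then show ?case by simp
next
  case (Cons y v)
  from Cons.prems obtain x u' where u: "u = x # u'" by (cases u) simp_all
  show ?case
  proof (cases w)
    case (Cons z w')
    with u Cons.prems Cons.IH[of u' w'] show ?thesis by (metis lex_less_simps(3) less_trans)
  qed (simp add: u)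
qed

lemma lex_less_total: "lex_less u v \<or> u = v \<or> lex_less v u"
proof (induction u arbitrary: v)
  case Nil
  then show ?case by (cases v) auto
next
  case (Cons x u)
  then show ?case by (cases v) auto
qed

lemma lex_le_antisym: "lex_le u v \<Longrightarrow> lex_le v u \<Longrightarrow> u = v"
  unfolding lex_le_def using lex_less_trans lex_less_irrefl by blast

lemma lex_max_exists:
  "finite S \<Longrightarrow> S \<noteq> {} \<Longrightarrow> \<exists>s\<in>S. \<forall>t\<in>S. lex_le t s"
proof (induction S rule: finite_ne_induct)
  case (singleton u)
  then show ?case by (simp add: lex_le_def)
next
  case (insert u S)
  then obtain s where s: "s \<in> S" "\<forall>t\<in>S. lex_le t s" by blast
  show ?case
  proof (cases "lex_less s u")
    case True
    then have "\<forall>t\<in>S. lex_le t u" using s(2) lex_less_trans unfolding lex_le_def by blast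
    then show ?thesis by (auto simp: lex_le_def)
  next
    case False
    then have "lex_le u s" using lex_less_total[of s u] by (auto simp: lex_le_def)
    with s show ?thesis by blast
  qed
qed

lemma right_factor_props:
  assumes "length u \<ge> 2"
  shows "right_factor u \<in> proper_suffixes u"
    and "t \<in> proper_suffixes u \<Longrightarrow> lex_le t (right_factor u)"
proof -
  have "proper_suffixes u \<subseteq> (\<lambda>n. drop n u) ` {..length u}"
  proof
    fix s assume "s \<in> proper_suffixes u"
    then obtain r where "u = r @ s" by (auto simp: proper_suffixes_def)
    then have "s = drop (length r) u" "length r \<le> length u" by simp_all
    then show "s \<in> (\<lambda>n. drop n u) ` {..length u}" by blast
  qed
  then have fin: "finite (proper_suffixes u)" by (rule finite_subset) simp
  have "u = take 1 u @ drop 1 u" "take 1 u \<noteq> []" "drop 1 u \<noteq> []"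
    using assms by (auto simp: not_le)
  then have "drop 1 u \<in> proper_suffixes u"
    unfolding proper_suffixes_def by blast
  then have "\<exists>s\<in>proper_suffixes u. \<forall>t\<in>proper_suffixes u. lex_le t s"
    using lex_max_exists[OF fin] by blast
  then have "\<exists>!s. s \<in> proper_suffixes u \<and> (\<forall>t\<in>proper_suffixes u. lex_le t s)"
    using lex_le_antisym by blast
  from theI'[OF this]
  show "right_factor u \<in> proper_suffixes u"
    and "t \<in> proper_suffixes u \<Longrightarrow> lex_le t (right_factor u)"
    unfolding right_factor_def by blast+
qed

lemma left_right_factor:
  assumes "length u \<ge> 2"
  shows "left_factor u @ right_factor u = u"
    and "left_factor u \<noteq> []" and "right_factor u \<noteq> []"
proof -
  from right_factor_props(1)[OF assms] obtain r
    where r: "r \<noteq> []" "u = r @ right_factor u" "right_factor u \<noteq> []"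
    unfolding proper_suffixes_def by blast
  have "left_factor u = r"
    unfolding left_factor_def
  proof (rule the_equality)
    show "u = r @ right_factor u" by (fact r(2))
    show "r' = r" if "u = r' @ right_factor u" for r'
      using that r(2) append_same_eq[of r' "right_factor u" r] by argo
  qed
  with r(1,3) r(2)[symmetric]
  show "left_factor u @ right_factor u = u" "left_factor u \<noteq> []" "right_factor u \<noteq> []"
    by simp_all
qed

function bracket :: "'x::linorder list \<Rightarrow> ('x list \<Rightarrow>\<^sub>0 'k::field)" where
  "bracket u =
    (if u = [] then 1
     else if length u = 1 then Poly_Mapping.single u 1
     else if lyndon u
       then bracket (left_factor u) * bracket (right_factor u)
          - bracket (right_factor u) * bracket (left_factor u)
     else bracket (left_factor u) * bracket (right_factor u))"
  by auto

lemma factor_length: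
  assumes "u \<noteq> []" "length u \<noteq> 1"
  shows "length (left_factor u) < length u" "length (right_factor u) < length u"
proof -
  have "length u \<ge> 2" using assms by (cases u) (auto simp: Suc_le_eq)
  note lr = left_right_factor[OF this]
  have "length u = length (left_factor u) + length (right_factor u)"
    using lr(1) by (metis length_append)
  with lr(2,3) show "length (left_factor u) < length u" "length (right_factor u) < length u"
    by (simp_all add: length_greater_0_conv[symmetric] del: length_greater_0_conv)
qed

termination
  by (relation "measure length") (auto simp del: One_nat_def intro: factor_length)

declare bracket.simps [simp del]


section \<open>Leading words and irreducible Lyndon words\<close>

definition glex_less :: "('x::linorder \<Rightarrow> nat) \<Rightarrow> 'x list \<Rightarrow> 'x list \<Rightarrow> bool"
  where "glex_less d u v \<longleftrightarrow>
    word_deg d u < word_deg d v \<or> word_deg d u = word_deg d v \<and> lex_less u v"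

definition is_leading_word ::
    "('x::linorder \<Rightarrow> nat) \<Rightarrow> ('x list \<Rightarrow>\<^sub>0 'k::field) \<Rightarrow> 'x list \<Rightarrow> bool"
  where "is_leading_word d p w \<longleftrightarrow> w \<in> Poly_Mapping.keys p \<and> (\<forall>u\<in>Poly_Mapping.keys p. u \<noteq> w \<longrightarrow> glex_less d u w)"

definition reducible ::
    "('x::linorder \<Rightarrow> nat) \<Rightarrow> ('x list \<Rightarrow>\<^sub>0 'k::field) set \<Rightarrow> 'x list \<Rightarrow> bool"
  where "reducible d I w \<longleftrightarrow> (\<exists>p\<in>I. is_leading_word d p w)"

definition irred_lyndon ::
    "('x::linorder \<Rightarrow> nat) \<Rightarrow> ('x list \<Rightarrow>\<^sub>0 'k::field) set \<Rightarrow> 'x list set"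
  where "irred_lyndon d I = {u. lyndon u \<and> \<not> reducible d I u}"

definition nondecreasing_products ::
    "('x::linorder \<Rightarrow> nat) \<Rightarrow> ('x list \<Rightarrow>\<^sub>0 'k::field) set \<Rightarrow> 'x list set"
  where "nondecreasing_products d I =
    {concat us | us. sorted_wrt lex_le us \<and> set us \<subseteq> irred_lyndon d I}"

text \<open>\<open>k\<langle>X\<rangle>\<^bsup><w\<^esup>\<close>, \<open>k\<langle>X|I\<rangle>\<close>, \<open>k\<langle>X|I\<rangle>\<^bsup><w\<^esup>\<close> and \<open>k\<langle>X|I\<rangle>\<^bsup>\<le>w\<^esup>\<close>, in this order.\<close>

definition free_lt :: "'x::linorder list \<Rightarrow> ('x list \<Rightarrow>\<^sub>0 'k::field) set"
  where "free_lt w = subalgebra_gen (bracket ` {u. lyndon u \<and> lex_less u w})"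

definition irred_alg ::
    "('x::linorder \<Rightarrow> nat) \<Rightarrow> ('x list \<Rightarrow>\<^sub>0 'k::field) set \<Rightarrow> ('x list \<Rightarrow>\<^sub>0 'k) set"
  where "irred_alg d I = subalgebra_gen (bracket ` irred_lyndon d I)"

definition irred_alg_lt ::
    "('x::linorder \<Rightarrow> nat) \<Rightarrow> ('x list \<Rightarrow>\<^sub>0 'k::field) set \<Rightarrow> 'x list \<Rightarrow> ('x list \<Rightarrow>\<^sub>0 'k) set"
  where "irred_alg_lt d I w = subalgebra_gen (bracket ` {u \<in> irred_lyndon d I. lex_less u w})"

definition irred_alg_le ::
    "('x::linorder \<Rightarrow> nat) \<Rightarrow> ('x list \<Rightarrow>\<^sub>0 'k::field) set \<Rightarrow> 'x list \<Rightarrow> ('x list \<Rightarrow>\<^sub>0 'k) set"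
  where "irred_alg_le d I w = subalgebra_gen (bracket ` {u \<in> irred_lyndon d I. lex_le u w})"


section \<open>Comultiplications and the quotient algebra\<close>

definition comultiplication ::
    "(('x list \<Rightarrow>\<^sub>0 'k::field) \<Rightarrow> ('x list \<times> 'x list \<Rightarrow>\<^sub>0 'k)) \<Rightarrow> bool"
  where "comultiplication \<Delta> \<longleftrightarrow>
    Vector_Spaces.linear pm_scale pm_scale \<Delta> \<and> \<Delta> 1 = 1 \<and> (\<forall>p q. \<Delta> (p * q) = \<Delta> p * \<Delta> q)"

text \<open>\<open>+\<close> and \<open>\<Sum>\<close> between sets and \<open>+o\<close> are those of \<^theory>\<open>HOL-Library.Set_Algebras\<close>.\<close>

definition triangular ::
    "('x::linorder \<Rightarrow> nat) \<Rightarrow> (('x list \<Rightarrow>\<^sub>0 'k::field) \<Rightarrow> ('x list \<times> 'x list \<Rightarrow>\<^sub>0 'k)) \<Rightarrow> bool"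
  where "triangular d \<Delta> \<longleftrightarrow>
    (\<forall>x. let X = Poly_Mapping.single [x] 1 in
      \<Delta> X \<in> (tensor 1 X + tensor X 1) +o
        ((\<Sum>(i, j)\<in>{(i, j). 0 < i \<and> 0 < j \<and> i + j = d x}.
            tensor_space (hom_part (word_deg d) (free_lt [x]) i)
                         (hom_part (word_deg d) (free_lt [x]) j))
         + lower_part (tensor_deg d) UNIV (d x)))"

text \<open>
  \<open>class_ring\<close> is the type-class ring regarded as a record with carrier \<open>UNIV\<close>. The quotient
  \<open>k\<langle>X\<rangle>/I\<close> is the library's quotient ring with the induced scalar multiplication.
\<close>

definition quotient_algebra ::
    "('a::monoid_add \<Rightarrow>\<^sub>0 'k::field) set \<Rightarrow> ('k, ('a \<Rightarrow>\<^sub>0 'k) set) module"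
  where "quotient_algebra I =
    \<lparr>carrier = carrier (class_ring Quot I),
     mult = mult (class_ring Quot I),
     one = one (class_ring Quot I),
     zero = zero (class_ring Quot I),
     add = add (class_ring Quot I),
     smult = (\<lambda>c P. \<Union>p\<in>P. I +>\<^bsub>class_ring\<^esub> pm_scale c p)\<rparr>"

lemma pm_scale_eq_mult: "pm_scale c p = Poly_Mapping.single 0 c * p"
proof (rule poly_mapping_eqI)
  fix a
  have "Poly_Mapping.lookup (Poly_Mapping.single 0 c * p) a = c * Poly_Mapping.lookup p a"
    by transfer (simp add: prod_fun_def when_mult)
  then show "Poly_Mapping.lookup (pm_scale c p) a =
      Poly_Mapping.lookup (Poly_Mapping.single 0 c * p) a"
    by (simp add: lookup_pm_scale)
qed

lemma vectorspace_quotient_algebra: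
  fixes I :: "('a::monoid_add \<Rightarrow>\<^sub>0 'k::field) set"
  assumes "ideal I class_ring"
  shows "vectorspace class_ring (quotient_algebra I)"
proof -
  let ?R = "class_ring :: ('a \<Rightarrow>\<^sub>0 'k) ring"
  let ?A = "quotient_algebra I"
  let ?c = "\<lambda>p. I +>\<^bsub>?R\<^esub> p"
  interpret J: ideal I ?R by (fact assms)
  interpret Q: ring "?R Quot I" by (rule J.quotient_is_ring)
  have carr: "carrier ?A = range ?c"
    by (auto simp: quotient_algebra_def FactRing_def A_RCOSETS_def' )
  have coset: "?c p = {i + p | i. i \<in> I}" for p
    by (auto simp: a_r_coset_def' )
  have self: "p \<in> ?c p" for p
    using J.a_rcos_self[of p] by simp
  have eqc: "?c q = ?c p" if "q \<in> ?c p" for p q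
    using abelian_group.a_repr_independence[OF class_ring.abelian_group_axioms that _ J.a_subgroup] by simp
  have add: "?c p \<oplus>\<^bsub>?A\<^esub> ?c q = ?c (p + q)" for p q
    using J.a_rcos_sum[of p q] by (simp add: quotient_algebra_def FactRing_def)
  have smult: "a \<odot>\<^bsub>?A\<^esub> ?c p = ?c (pm_scale a p)" for a p
  proof -
    have "?c (pm_scale a q) = ?c (pm_scale a p)" if "q \<in> ?c p" for q
    proof (rule eqc)
      from that obtain i where i: "i \<in> I" "q = i + p" by (auto simp: coset)
      have "pm_scale a i \<in> I"
        using J.I_l_closed[OF i(1), of "Poly_Mapping.single 0 a"] by (simp add: pm_scale_eq_mult)
      then show "pm_scale a q \<in> ?c (pm_scale a p)"
        by (auto simp: coset i(2) pm.scale_right_distrib)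
    qed
    then have "(\<Union>q\<in>?c p. ?c (pm_scale a q)) = ?c (pm_scale a p)"
      using self[of p] by blast
    then show ?thesis by (simp add: quotient_algebra_def)
  qed
  have ab: "abelian_group ?A"
  proof (rule abelian_groupI)
    show "\<zero>\<^bsub>?A\<^esub> \<in> carrier ?A" using Q.zero_closed by (simp add: quotient_algebra_def)
  qed (use Q.a_closed Q.a_assoc Q.a_comm Q.l_zero Q.l_neg Q.a_inv_closed in
        \<open>auto simp: quotient_algebra_def\<close>)
  have "module class_ring ?A"
  proof (rule moduleI)
    show "cring (class_ring :: 'k ring)" by (rule class_cring.cring_axioms)
  qed (auto simp: ab carr smult add pm.scale_right_distrib pm.scale_left_distrib)
  moreover have "Ring.field (class_ring :: 'k ring)" by (rule class_field.field_axioms)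
  ultimately show ?thesis by (rule vectorspace.intro)
qed

end

theory Submission
  imports Defs "HOL-Library.Sublist"
begin

text \<open>
Write \<open>F\<close> for the free algebra. Everything rests on linear maps \<open>\<theta>: F \<rightarrow> F\<close> that preserve \<open>I\<close> and act, up to
terms of lower degree, as divided powers of a derivative with respect to a Lyndon bracket.

Let \<open>u\<close> be a Lyndon word whose power \<open>u\<^sup>s\<close> is \<open>I\<close>-irreducible. Irreducibility of \<open>u\<^sup>s\<close> says exactly that
some linear functional on \<open>F\<close> kills \<open>I\<close> and all words below \<open>u\<^sup>s\<close> and takes the value \<open>1\<close> at \<open>u\<^sup>s\<close>.
Applying \<open>\<Delta>\<close> and then this functional to the second tensor factor gives \<open>\<theta>\<close>, and
\<open>\<Delta>(I) \<subseteq> F \<otimes> I + I \<otimes> F\<close> gives \<open>\<theta>(I) \<subseteq> I\<close>. If \<open>p\<close> is a product of brackets of Lyndon words below \<open>u\<close>, then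
\<open>\<theta>(p [u]\<^sup>r) = (r choose s) p [u]\<^sup>r\<^sup>-\<^sup>s\<close> up to lower degree (\<open>divided_derivative_exists\<close>). Two facts make this
work. First, \<open>\<Delta>[u]\<close> is \<open>1 \<otimes> [u] + [u] \<otimes> 1\<close> plus terms whose second factors are products of brackets of
smaller Lyndon words (\<open>comult_lyndon\<close>); this passes from letters to Lyndon words because the
commutator of the brackets of Lyndon words \<open>a > b\<close> is a combination of brackets of Lyndon words
\<open>\<le> ab\<close> (\<open>commutator_bracket_lyndon\<close>). Second, a product of Lyndon words \<open>\<le> u\<close> that has the degree of
\<open>u\<^sup>s\<close> is below \<open>u\<^sup>s\<close> unless all its factors are \<open>u\<close> (\<open>suffixes_le_imp_le_power\<close>, \<open>concat_lyndon_eq_power\<close>),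
so the functional picks out the powers of \<open>[u]\<close>.

Applied to a relation, that is, to an element of \<open>I\<close> written in standard brackets, \<open>\<theta>\<close> strips \<open>s\<close>
copies of the largest Lyndon factor \<open>u\<close> off its words of top degree; since the stripped words are
distinct, one of them is the leading word of an element of \<open>I\<close> (\<open>divided_derivative_reducible\<close>).

For the first two parts, write \<open>[v]\<close> or \<open>[u][v] - [v][u]\<close> modulo \<open>I\<close> as a combination of brackets of
irreducible words. If some word of top degree had a factor above the claimed bound, take the largest
such factor and strip it to its highest multiplicity: a prefix of an irreducible word would be
reducible, which is impossible (\<open>normal_form_bounded\<close>).

For the third part, induction on the degree shows that all words in \<open>\<B>\<^sub>I\<close> are irreducible
(\<open>nondecreasing_products_irreducible\<close>). A reducible one gives a relation between brackets of words
in \<open>\<B>\<^sub>I\<close>; let \<open>u\<close> be the largest factor in top degree and \<open>s\<close> its highest multiplicity. If \<open>u\<^sup>s\<close> has smaller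
degree than the relation, it is irreducible by induction and stripping it contradicts the induction
hypothesis. Otherwise \<open>u\<^sup>s\<close> itself occurs in the relation. If \<open>s > 1\<close>, stripping \<open>s - 1\<close> copies leaves
\<open>s [u]\<close>, which does not vanish in characteristic \<open>0\<close>, and the same contradiction arises. If \<open>s = 1\<close>, then
\<open>u\<close> is the leading word of the relation although \<open>u\<close> is irreducible. Since irreducible words always form
a basis of the quotient via their brackets, the third part follows.
\<close>

section \<open>The lexicographic order and Lyndon words\<close>

interpretation lex: linorder "lex_le :: 'x::linorder list \<Rightarrow> 'x list \<Rightarrow> bool" lex_less
proof
  fix u v w :: "'x list"
  show "lex_less u v \<longleftrightarrow> lex_le u v \<and> \<not> lex_le v u"
    using lex_less_irrefl lex_less_trans unfolding lex_le_def by blast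
  show "lex_le u u" by (simp add: lex_le_def)
  show "lex_le u v \<Longrightarrow> lex_le v w \<Longrightarrow> lex_le u w"
    using lex_less_trans unfolding lex_le_def by blast
  show "lex_le u v \<Longrightarrow> lex_le v u \<Longrightarrow> u = v" by (rule lex_le_antisym)
  show "lex_le u v \<or> lex_le v u" using lex_less_total unfolding lex_le_def by blast
qed

lemma lex_less_append_left [simp]: "lex_less (a @ u) (a @ v) \<longleftrightarrow> lex_less u v"
  by (induction a) auto

lemma lex_less_prefix: "s \<noteq> [] \<Longrightarrow> lex_less (u @ s) u"
  unfolding lex_less_def by blast

lemma lex_le_prefix: "lex_le (u @ s) u"
  by (cases "s = []") (auto simp: lex_less_prefix lex.less_imp_le)

text \<open>
The order is not compatible with appending words on the right in general; the only obstruction is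
that one word is a prefix of the other.
\<close>

lemma lex_less_dichotomy:
  assumes "lex_less u v"
  shows "(\<exists>s. s \<noteq> [] \<and> u = v @ s) \<or> (\<forall>s t. lex_less (u @ s) (v @ t))"
  using assms
proof (induction u arbitrary: v)
  case Nil
  then show ?case by simp
next
  case (Cons x u)
  then show ?case by (cases v) auto
qed

lemma lex_less_extend:
  assumes "lex_less u v" "length u \<le> length v"
  shows "lex_less (u @ s) (v @ t)"
proof -
  have "\<not> (\<exists>s. s \<noteq> [] \<and> u = v @ s)" using assms(2) by auto
  then show ?thesis using lex_less_dichotomy[OF assms(1)] by blast
qed

text \<open>
The order has infinite descending chains such as \<open>x > xx > xxx > \<dots>\<close>; bounding the length removes them,
and this makes the graded order a well-order.
\<close>

lemma lex_bounded_length_min: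
  fixes Q :: "'x::wellorder list set"
  assumes "Q \<noteq> {}" "\<forall>w\<in>Q. length w \<le> n"
  shows "\<exists>m\<in>Q. \<forall>w\<in>Q. lex_le m w"
  using assms
proof (induction n arbitrary: Q)
  case 0
  then have "Q = {[]}" by fastforce
  then show ?case by simp
next
  case (Suc n)
  show ?case
  proof (cases "\<exists>x u. x # u \<in> Q")
    case False
    then have "Q = {[]}" using Suc.prems(1) by (metis list.exhaust subsetI subset_singletonD singletonI)
    then show ?thesis by simp
  next
    case True
    define x where "x = (LEAST x. \<exists>u. x # u \<in> Q)"
    have x: "\<exists>u. x # u \<in> Q" unfolding x_def by (rule LeastI_ex) (use True in blast)
    have x_le: "x \<le> y" if "y # u \<in> Q" for y u unfolding x_def by (rule Least_le) (use that in blast)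
    have "\<exists>m\<in>{u. x # u \<in> Q}. \<forall>w\<in>{u. x # u \<in> Q}. lex_le m w"
      by (rule Suc.IH) (use x Suc.prems(2) in fastforce)+
    then obtain m where m: "x # m \<in> Q" "\<And>w. x # w \<in> Q \<Longrightarrow> lex_le m w" by blast
    have "lex_le (x # m) w" if w: "w \<in> Q" for w
    proof (cases w)
      case Nil
      then show ?thesis by (simp add: lex_le_def)
    next
      case (Cons y v)
      then have "x \<le> y" "x = y \<Longrightarrow> lex_le m v" using w x_le m(2) by blast+
      then show ?thesis using Cons by (auto simp: lex_le_def)
    qed
    then show ?thesis using m(1) by blast
  qed
qed

lemma lyndon_nonempty: "lyndon u \<Longrightarrow> u \<noteq> []"
  by (simp add: lyndon_def)

text \<open>
Lyndon words are defined by comparison with rotations, but all arguments below compare with proper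
suffixes. If a proper suffix \<open>w\<close> of \<open>u = vw\<close> were larger than \<open>u\<close>, then either the rotation \<open>wv\<close> is larger
than \<open>u\<close>, or \<open>w\<close> is also a prefix, \<open>u = wz\<close>; then comparing \<open>u\<close> with the rotations \<open>wv\<close> and \<open>zw\<close> gives
both \<open>v < z\<close> and \<open>z < v\<close>.
\<close>

lemma lyndon_suffix_less:
  assumes "lyndon u" "u = v @ w" "v \<noteq> []" "w \<noteq> []"
  shows "lex_less w u"
proof (rule ccontr)
  assume "\<not> lex_less w u"
  then have "lex_less u w"
    using lex_less_total[of u w] assms by auto
  then consider z where "z \<noteq> []" "u = w @ z" | "lex_less (u @ []) (w @ v)"
    using lex_less_dichotomy by blast
  then show False
  proof cases
    case 1
    have "lex_less (w @ v) (w @ z)"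
      using assms 1 unfolding lyndon_def by metis
    then have vz: "lex_less v z" by simp
    have len: "length z = length v" using assms(2) 1(2) by (metis add.commute add_left_cancel length_append)
    have "lex_less (z @ w) (v @ w)"
      using assms 1 unfolding lyndon_def by metis
    moreover have "lex_less (v @ w) (z @ w)"
      using lex_less_extend[OF vz] len by simp
    ultimately show False using lex.less_asym by blast
  next
    case 2
    then show False using assms unfolding lyndon_def by (metis append_Nil2 lex.less_asym)
  qed
qed

lemma lyndonI:
  assumes "u \<noteq> []" "\<And>v w. u = v @ w \<Longrightarrow> v \<noteq> [] \<Longrightarrow> w \<noteq> [] \<Longrightarrow> lex_less w u"
  shows "lyndon u"
  unfolding lyndon_def using assms lex_le_prefix lex.le_less_trans by blast

lemma lyndon_suffix_le:
  assumes "lyndon u" "u = v @ w" "w \<noteq> []"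
  shows "lex_le w u"
  using lyndon_suffix_less[OF assms(1,2)] assms(2,3) by (cases "v = []") (auto intro: lex.less_imp_le)

lemma lyndon_letter [simp]: "lyndon [x]"
  by (rule lyndonI) (auto simp: Cons_eq_append_conv)

lemma lyndon_append:
  assumes u: "lyndon u" and v: "lyndon v" and vu: "lex_less v u"
  shows "lyndon (u @ v)"
proof (rule lyndonI)
  show "u @ v \<noteq> []" using u by (simp add: lyndon_def)
  fix s t assume st: "u @ v = s @ t" "s \<noteq> []" "t \<noteq> []"
  have v_less: "lex_less v (u @ v)"
  proof -
    consider z where "z \<noteq> []" "v = u @ z" | "lex_less (v @ []) (u @ v)"
      using lex_less_dichotomy[OF vu] by blast
    then show ?thesis
    proof cases
      case 1
      then have "lex_less z v"
        using lyndon_suffix_less[OF v] lyndon_nonempty[OF u] by blast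
      then show ?thesis using 1(2) by (metis lex_less_append_left)
    qed simp
  qed
  from st(1) consider a where "u = s @ a" "t = a @ v" "a \<noteq> []" | a where "s = u @ a" "v = a @ t"
    by (metis append_eq_append_conv2 append_Nil append_Nil2)
  then show "lex_less t (u @ v)"
  proof cases
    case 1
    then have "lex_less a u" "length a \<le> length u" using lyndon_suffix_less[OF u] st(2) by auto
    then show ?thesis using lex_less_extend 1(2) by blast
  next
    case 2
    then show ?thesis
      using lyndon_suffix_le[OF v 2(2) st(3)] v_less lex.le_less_trans by blast
  qed
qed

lemma right_factor_eqI:
  assumes "u = r @ s" "r \<noteq> []" "s \<noteq> []"
    and "\<And>t. t \<in> proper_suffixes u \<Longrightarrow> lex_le t s"
  shows "right_factor u = s" "left_factor u = r"
proof -
  have len: "length u \<ge> 2" using assms(1-3) by (cases r; cases s) auto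
  have "s \<in> proper_suffixes u" unfolding proper_suffixes_def using assms by blast
  then show eq: "right_factor u = s"
    using right_factor_props[OF len] assms(4) lex_le_antisym by blast
  show "left_factor u = r" using left_right_factor(1)[OF len] assms(1) eq by simp
qed

lemma lyndon_left_right_factor:
  assumes u: "lyndon u" and len: "length u \<ge> 2"
  shows "lyndon (left_factor u)" "lyndon (right_factor u)"
    "lex_less u (left_factor u)" "lex_less (right_factor u) u"
proof -
  define v w where "v = left_factor u" and "w = right_factor u"
  note lr = left_right_factor[OF len, folded v_def w_def]
  have max: "lex_le t w" if "u = r @ t" "r \<noteq> []" "t \<noteq> []" for r t
    using right_factor_props(2)[OF len, of t] that unfolding proper_suffixes_def w_def by blast
  show "lyndon (right_factor u)" unfolding w_def[symmetric]
  proof (rule lyndonI)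
    fix a b assume ab: "w = a @ b" "a \<noteq> []" "b \<noteq> []"
    have "lex_le b w" using max[of "v @ a" b] ab lr by simp
    then show "lex_less b w" using ab by (auto simp: lex_le_def)
  qed (use lr in simp)
  show "lyndon (left_factor u)" unfolding v_def[symmetric]
  proof (rule lyndonI)
    fix a b assume ab: "v = a @ b" "a \<noteq> []" "b \<noteq> []"
    show "lex_less b v"
    proof (rule ccontr)
      assume "\<not> lex_less b v"
      then have "lex_less v b" using ab lex_less_total[of b v] by auto
      then consider z where "z \<noteq> []" "v = b @ z" | "lex_less (v @ w) (b @ w)"
        using lex_less_dichotomy by blast
      then show False
      proof cases
        case 1
        \<comment> \<open>The suffix \<open>z @ w\<close> is longer than \<open>w\<close> and would exceed it, but \<open>w\<close> is the largest suffix.\<close>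
        have "u = b @ z @ w" using lr(1) 1(2) by simp
        moreover have "lex_less (b @ w) u"
          using lyndon_suffix_less[OF u, of a "b @ w"] ab lr by simp
        ultimately have "lex_less (b @ w) (b @ z @ w)" by metis
        then have "lex_less w (z @ w)" by simp
        moreover have "lex_le (z @ w) w" using max[of b "z @ w"] 1 lr ab by simp
        ultimately show False by auto
      next
        case 2
        have "lex_less (b @ w) (v @ w)"
          using lyndon_suffix_less[OF u, of a "b @ w"] ab lr by simp
        with 2 show False using lex.less_asym by blast
      qed
    qed
  qed (use lr in simp)
  show "lex_less u (left_factor u)" "lex_less (right_factor u) u"
    using lyndon_suffix_less[OF u] lex_less_prefix lr unfolding v_def w_def by metis+
qed

text \<open>
This decides when \<open>[u][v] - [v][u]\<close> is itself a standard bracket; the remaining case is what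
the Jacobi identity is used for.
\<close>

lemma standard_factorization_append:
  assumes u: "lyndon u" and v: "lyndon v"
    and le: "length u = 1 \<or> lex_le (right_factor u) v"
  shows "right_factor (u @ v) = v" "left_factor (u @ v) = u"
proof -
  have *: "lex_le t v" if t: "t \<in> proper_suffixes (u @ v)" for t
  proof -
    from t obtain s where st: "u @ v = s @ t" "s \<noteq> []" "t \<noteq> []"
      unfolding proper_suffixes_def by blast
    from st(1) consider a where "u = s @ a" "t = a @ v" "a \<noteq> []" | a where "s = u @ a" "v = a @ t"
      by (metis append_eq_append_conv2 append_Nil append_Nil2)
    then show ?thesis
    proof cases
      case 1
      then have a: "a \<in> proper_suffixes u" "length u \<ge> 2"
        using st by (auto simp: proper_suffixes_def) (cases s; cases a; auto)
      have "lex_le a (right_factor u)" using right_factor_props(2)[OF a(2,1)] .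
      with le a have "lex_le a v" by auto
      then show ?thesis using 1(2) lex_le_prefix lex.order_trans by blast
    next
      case 2
      then show ?thesis using lyndon_suffix_le[OF v 2(2) st(3)] by blast
    qed
  qed
  show "right_factor (u @ v) = v" "left_factor (u @ v) = u"
    using right_factor_eqI[OF refl _ _ *, of u] lyndon_nonempty[OF u] lyndon_nonempty[OF v] by auto
qed

section \<open>Factorizations into Lyndon words\<close>

lemma sorted_lex_le_last:
  assumes "sorted_wrt lex_le us" "us \<noteq> []" "u \<in> set us"
  shows "lex_le u (last us)"
  using assms by (induction us) (auto simp: lex.order_refl)

text \<open>
A suffix of the product starts inside one factor, and the part of that factor which it contains is a
suffix of a Lyndon word \<open>\<le> u\<close>; appending further letters only makes a word smaller.
\<close>

lemma concat_lyndon_suffix_le: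
  assumes "\<forall>b\<in>set bs. lyndon b \<and> lex_le b u" "concat bs = s @ t" "t \<noteq> []"
  shows "lex_le t u"
  using assms
proof (induction bs arbitrary: s)
  case Nil
  then show ?case by simp
next
  case (Cons b bs)
  then have "b @ concat bs = s @ t" by simp
  then consider a where "b = s @ a" "t = a @ concat bs" "a \<noteq> []" | a where "s = b @ a" "concat bs = a @ t"
    by (metis append_eq_append_conv2 append_Nil append_Nil2)
  then show ?case
  proof cases
    case 1
    then have "lex_le a b" using lyndon_suffix_le[of b s a] Cons.prems(1) by simp
    then show ?thesis
      using 1(2) lex_le_prefix lex.order_trans Cons.prems(1)
      by (metis list.set_intros(1))
  next
    case 2
    then show ?thesis using Cons.IH Cons.prems by auto
  qed
qed

text \<open>
The standard factorization of a nondecreasing product of Lyndon words splits off the last factor,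
because every proper suffix is bounded by that factor.
\<close>

lemma right_factor_concat:
  assumes sorted: "sorted_wrt lex_le (us @ [v])" and lyn: "\<forall>u\<in>set (us @ [v]). lyndon u"
    and ne: "us \<noteq> []"
  shows "right_factor (concat (us @ [v])) = v" "left_factor (concat (us @ [v])) = concat us"
    "\<not> lyndon (concat (us @ [v]))"
proof -
  have v: "v \<noteq> []" using lyn by (simp add: lyndon_def)
  obtain b bs where b: "us = b # bs" "b \<noteq> []" using ne lyn by (cases us) (auto simp: lyndon_def)
  have le: "lex_le u v" if "u \<in> set (us @ [v])" for u
    using sorted_lex_le_last[OF sorted _ that] by simp
  have *: "lex_le t v" if t: "t \<in> proper_suffixes (concat (us @ [v]))" for t
    using t concat_lyndon_suffix_le[of "us @ [v]" v _ t] lyn le unfolding proper_suffixes_def by blast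
  show "right_factor (concat (us @ [v])) = v" "left_factor (concat (us @ [v])) = concat us"
    using right_factor_eqI[of "concat (us @ [v])" "concat us" v, OF _ _ v *] b by simp_all
  show "\<not> lyndon (concat (us @ [v]))"
  proof
    assume lc: "lyndon (concat (us @ [v]))"
    then have "lex_less v (concat (us @ [v]))"
      using lyndon_suffix_less[OF lc, of "concat us" v] b v by simp
    moreover have "lex_le (concat (us @ [v])) b" using lex_le_prefix[of b] b by simp
    moreover have "lex_le b v" using le b by simp
    ultimately show False by auto
  qed
qed

text \<open>
In a factorization with the fewest Lyndon factors no factor exceeds the next one, since the two
could be merged into a single Lyndon word.
\<close>

lemma lyndon_factorization_exists:
  "\<exists>us. sorted_wrt lex_le us \<and> (\<forall>u\<in>set us. lyndon u) \<and> concat us = w"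
proof -
  define fs where "fs = {us. (\<forall>u\<in>set us. lyndon u) \<and> concat us = w}"
  have "map (\<lambda>x. [x]) w \<in> fs" by (auto simp: fs_def)
  then obtain us where us: "us \<in> fs" "\<And>vs. vs \<in> fs \<Longrightarrow> length us \<le> length vs"
    using ex_has_least_nat[of "\<lambda>us. us \<in> fs" _ length] by metis
  have "sorted_wrt lex_le us"
    unfolding sorted_wrt_iff_nth_Suc_transp[OF lex.transp_on_le]
  proof (intro allI impI)
    fix i assume i: "Suc i < length us"
    show "lex_le (us ! i) (us ! Suc i)"
    proof (rule ccontr)
      assume "\<not> lex_le (us ! i) (us ! Suc i)"
      then have lt: "lex_less (us ! Suc i) (us ! i)" by simp
      have dec: "us = take i us @ us ! i # us ! Suc i # drop (Suc (Suc i)) us"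
        using i by (metis Cons_nth_drop_Suc Suc_lessD append_take_drop_id)
      \<comment> \<open>Merge the two factors.\<close>
      define vs where "vs = take i us @ (us ! i @ us ! Suc i) # drop (Suc (Suc i)) us"
      have "concat vs = concat us" by (subst dec) (simp add: vs_def)
      moreover have "lyndon u" if "u \<in> set vs" for u
      proof -
        have "lyndon (us ! i)" "lyndon (us ! Suc i)" using us(1) i by (auto simp: fs_def)
        with that lt us(1) show ?thesis
          by (auto simp: vs_def fs_def lyndon_append dest: in_set_takeD in_set_dropD)
      qed
      ultimately have "vs \<in> fs" using us(1) by (auto simp: fs_def)
      moreover have "length vs < length us" using i by (simp add: vs_def)
      ultimately show False using us(2) by fastforce
    qed
  qed
  then show ?thesis using us(1) by (auto simp: fs_def)
qed

lemma sorted_split_max: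
  assumes "sorted_wrt lex_le bs" "\<forall>c\<in>set bs. lex_le c u"
  shows "bs = filter (\<lambda>c. c \<noteq> u) bs @ replicate (count_list bs u) u"
  using assms
proof (induction bs rule: rev_induct)
  case Nil
  then show ?case by simp
next
  case (snoc c bs)
  then have IH: "bs = filter (\<lambda>c. c \<noteq> u) bs @ replicate (count_list bs u) u"
    by (simp add: sorted_wrt_append)
  show ?case
  proof (cases "c = u")
    case True
    then show ?thesis using IH by (simp add: replicate_append_same[symmetric])
  next
    case False
    have "u \<notin> set bs"
    proof
      assume "u \<in> set bs"
      then have "lex_le u c" "lex_le c u" using snoc.prems by (auto simp: sorted_wrt_append)
      then show False using False lex_le_antisym by blast
    qed
    then have "filter (\<lambda>c. c \<noteq> u) bs = bs" by (auto simp: filter_id_conv)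
    then show ?thesis using False \<open>u \<notin> set bs\<close> by (simp add: count_notin)
  qed
qed

text \<open>
Compare \<open>c\<close> with one copy of \<open>u\<close> after the other: as \<open>c\<close> itself is \<open>\<le> u\<close>, either it is decided at a letter, or
\<open>c\<close> starts with \<open>u\<close> and the rest of \<open>c\<close> satisfies the same hypothesis. The second hypothesis excludes that \<open>c\<close>
is a proper prefix of the power; it holds whenever both have the same degree.
\<close>

lemma suffixes_le_imp_le_power:
  assumes "\<And>s t. c = s @ t \<Longrightarrow> t \<noteq> [] \<Longrightarrow> lex_le t u"
    and "\<And>z. concat (replicate r u) = c @ z \<Longrightarrow> z = []"
  shows "lex_le c (concat (replicate r u))"
  using assms
proof (induction r arbitrary: c)
  case 0
  show ?case using lex_le_prefix[of "[]" c] by simp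
next
  case (Suc r)
  show ?case
  proof (cases "c = []")
    case True
    with Suc.prems(2) have "concat (replicate (Suc r) u) = []" by simp
    then show ?thesis using True by (auto simp: lex_le_def)
  next
    case False
    then have "lex_le c u" using Suc.prems(1)[of "[]" c] by simp
    then consider s where "c = u @ s" | "lex_less (c @ []) (u @ concat (replicate r u))"
      using lex_less_dichotomy[of c u] unfolding lex_le_def by fastforce
    then show ?thesis
    proof cases
      case 1
      have "lex_le s (concat (replicate r u))"
      proof (rule Suc.IH)
        show "lex_le t u" if "s = s' @ t" "t \<noteq> []" for s' t
          using Suc.prems(1)[of "u @ s'" t] that 1 by simp
        show "z = []" if "concat (replicate r u) = s @ z" for z
          using Suc.prems(2)[of z] that 1 by simp
      qed
      then show ?thesis using 1 by (auto simp: lex_le_def)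
    next
      case 2
      then show ?thesis by (auto simp: lex_le_def)
    qed
  qed
qed

text \<open>
A first factor \<open>b \<noteq> u\<close> of a power of \<open>u\<close> would have the form \<open>b = us\<close>. Then \<open>s\<close> is both a prefix of \<open>b\<close>, hence
larger than \<open>b\<close>, and a proper suffix of the Lyndon word \<open>b\<close>, hence smaller.
\<close>

lemma concat_lyndon_eq_power:
  assumes bs: "\<forall>b\<in>set bs. lyndon b \<and> lex_le b u" and u: "lyndon u"
    and eq: "concat bs = concat (replicate r u)"
  shows "bs = replicate r u"
  using bs eq
proof (induction bs arbitrary: r)
  case Nil
  then show ?case using lyndon_nonempty[OF u] by (cases r) auto
next
  case (Cons b bs)
  have b: "lyndon b" "b \<noteq> []" "lex_le b u" using Cons.prems(1) lyndon_nonempty by auto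
  from Cons.prems(2) b(2) obtain r' where r: "r = Suc r'" by (cases r) auto
  have eq: "b @ concat bs = u @ concat (replicate r' u)" using Cons.prems(2) r by simp
  have "b = u"
  proof (rule ccontr)
    assume ne: "b \<noteq> u"
    then have "lex_less b u" using b by (simp add: lex_le_def)
    moreover have "\<not> lex_less (b @ concat bs) (u @ concat (replicate r' u))" using eq by simp
    ultimately obtain s where s: "s \<noteq> []" "b = u @ s" using lex_less_dichotomy by blast
    \<comment> \<open>The word \<open>b\<close> and its suffix \<open>s\<close> are both prefixes of the power \<open>u\<^sup>r\<close>.\<close>
    have pb: "prefix b (concat (replicate r u))"
      unfolding prefix_def using eq r by (metis concat.simps(2) replicate_Suc)
    have "prefix s (concat (replicate r' u))"
      using eq s unfolding prefix_def by (metis append.assoc same_append_eq)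
    moreover have "concat (replicate r u) = concat (replicate r' u) @ u"
      using r by (simp add: replicate_append_same[symmetric])
    ultimately have ps: "prefix s (concat (replicate r u))" by (auto simp: prefix_def)
    have "length s < length b" using s lyndon_nonempty[OF u] by simp
    then have "strict_prefix s b"
      using pb ps prefix_same_cases by (metis linorder_not_le prefix_length_le prefix_order.le_less)
    then have "lex_less b s" by (metis lex_less_prefix strict_prefix_def prefix_def append_Nil2)
    moreover have "lex_less s b"
      using lyndon_suffix_less[OF b(1) s(2)] s(1) lyndon_nonempty[OF u] by blast
    ultimately show False using lex.less_asym by blast
  qed
  then show ?case using Cons.IH[of r'] Cons.prems eq r by auto
qed

section \<open>Linear algebra in monoid algebras\<close>

abbreviation lookup where "lookup \<equiv> Poly_Mapping.lookup"
abbreviation keys where "keys \<equiv> Poly_Mapping.keys"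
abbreviation single where "single \<equiv> Poly_Mapping.single"

lemma keys_diff: "keys (p - q) \<subseteq> keys p \<union> keys (q :: 'a \<Rightarrow>\<^sub>0 'k::field)"
  by (auto simp: in_keys_iff lookup_minus)

lemma pm_expansion: "p = (\<Sum>a\<in>keys p. pm_scale (lookup p a) (single a 1))"
  by (rule poly_mapping_eqI)
    (simp add: lookup_sum lookup_pm_scale lookup_single when_def if_distrib sum.delta in_keys_iff cong: if_cong)

lemma pm_induct [case_names single add scale]:
  assumes "\<And>a. P (single a 1)" "\<And>p q. P p \<Longrightarrow> P q \<Longrightarrow> P (p + q)" "\<And>c p. P p \<Longrightarrow> P (pm_scale c p)"
  shows "P (p :: 'a \<Rightarrow>\<^sub>0 'k::field)"
proof -
  have zero: "P 0" using assms(3)[OF assms(1), of 0 undefined] by simp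
  have "P (\<Sum>a\<in>A. pm_scale (lookup p a) (single a 1))" if "finite A" for A
    using that by (induction A rule: finite_induct) (auto simp: zero intro!: assms)
  from this[of "keys p"] show ?thesis using pm_expansion[of p] by simp
qed

lemma pm_mem_subspace:
  assumes "pm.subspace V" "\<And>a. a \<in> keys p \<Longrightarrow> single a 1 \<in> V"
  shows "p \<in> V"
  by (subst pm_expansion) (intro pm.subspace_sum pm.subspace_scale assms)

lemma pm_scale_mult_left [simp]: "pm_scale c p * q = pm_scale c (p * q)"
  for p q :: "'a::monoid_add \<Rightarrow>\<^sub>0 'k::field"
  by (simp add: pm_scale_eq_mult mult.assoc)

lemma pm_scale_mult_right [simp]: "p * pm_scale c q = pm_scale c (p * q)"
  for p q :: "'a::monoid_add \<Rightarrow>\<^sub>0 'k::field"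
proof -
  have comm: "single 0 c * p = p * single 0 c" for p :: "'a \<Rightarrow>\<^sub>0 'k"
  proof (induction p rule: pm_induct)
    case (scale b p)
    have "single 0 c * pm_scale b p = pm_scale b (single 0 c * p)"
      by (simp add: pm_scale_eq_mult mult_single mult.commute flip: mult.assoc)
    with scale show ?case by simp
  qed (simp_all add: mult_single distrib_left distrib_right)
  have "p * pm_scale c q = p * single 0 c * q" by (simp add: pm_scale_eq_mult mult.assoc)
  also have "\<dots> = single 0 c * p * q" by (subst comm) (rule refl)
  finally show ?thesis by (simp add: pm_scale_eq_mult mult.assoc)
qed

lemma span_induct_linear:
  assumes "x \<in> pm.span S" "\<And>x. x \<in> S \<Longrightarrow> f x \<in> pm.span T"
    "\<And>x y. f (x + y) = f x + f y" "\<And>c x. f (pm_scale c x) = pm_scale c (f x)"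
  shows "f x \<in> pm.span T"
  using assms(1)
proof (induction rule: pm.span_induct_alt)
  case base
  have "f 0 = 0" using assms(3)[of 0 0] by simp
  then show ?case by (simp add: pm.span_zero)
next
  case (step c x y)
  then show ?case by (simp add: assms pm.span_add pm.span_scale)
qed

lemma in_span_image_coeffs:
  assumes "x \<in> pm.span (f ` S)"
  obtains W c where "finite W" "W \<subseteq> S" "\<And>w. w \<in> W \<Longrightarrow> c w \<noteq> 0" "x = (\<Sum>w\<in>W. pm_scale (c w) (f w))"
proof -
  obtain t r where t: "finite t" "t \<subseteq> f ` S" "x = (\<Sum>a\<in>t. pm_scale (r a) a)"
    using assms by (auto simp: pm.span_explicit)
  obtain V where V: "V \<subseteq> S" "inj_on f V" "t = f ` V" using t(2) by (metis subset_image_inj)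
  define W where "W = {w \<in> V. r (f w) \<noteq> 0}"
  have fin: "finite V" using t(1) V finite_image_iff by blast
  have "x = (\<Sum>w\<in>V. pm_scale (r (f w)) (f w))" using t(3) V by (simp add: sum.reindex)
  also have "\<dots> = (\<Sum>w\<in>W. pm_scale (r (f w)) (f w))"
    using fin by (intro sum.mono_neutral_right) (auto simp: W_def)
  finally have x: "x = (\<Sum>w\<in>W. pm_scale (r (f w)) (f w))" .
  have "finite W" "W \<subseteq> S" "\<And>w. w \<in> W \<Longrightarrow> r (f w) \<noteq> 0" using fin V(1) by (auto simp: W_def)
  from that[OF this x] show ?thesis .
qed

lemma sum_set_subspace:
  assumes "pm.subspace V" "\<And>i. i \<in> A \<Longrightarrow> f i \<subseteq> V"
  shows "sum f A \<subseteq> V"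
  using assms(2)
proof (induction A rule: infinite_finite_induct)
  case (insert i A)
  then have "f i \<subseteq> V" "sum f A \<subseteq> V" by auto
  then have "f i + sum f A \<subseteq> V"
    using pm.subspace_add[OF assms(1)] by (auto elim!: set_plus_elim)
  then show ?case using insert.hyps by simp
qed (use pm.subspace_0[OF assms(1)] in \<open>auto simp: set_zero\<close>)

lemma subspace_set_plus:
  assumes "pm.subspace A" "pm.subspace B" shows "pm.subspace (A + B)"
proof (rule pm.subspaceI)
  show "0 \<in> A + B" using pm.subspace_0[OF assms(1)] pm.subspace_0[OF assms(2)] by (metis add_0 set_plus_intro)
  fix x y c assume "x \<in> A + B"
  then obtain a b where x: "x = a + b" "a \<in> A" "b \<in> B" by (auto elim: set_plus_elim)
  show "pm_scale c x \<in> A + B" unfolding x(1) pm.scale_right_distrib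
    using assms x by (intro set_plus_intro pm.subspace_scale)
  assume "y \<in> A + B"
  then obtain a' b' where y: "y = a' + b'" "a' \<in> A" "b' \<in> B" by (auto elim: set_plus_elim)
  have "x + y = (a + a') + (b + b')" using x y by simp
  then show "x + y \<in> A + B"
    using set_plus_intro[OF pm.subspace_add[OF assms(1) x(2) y(2)] pm.subspace_add[OF assms(2) x(3) y(3)]]
    by simp
qed

lemma keys_mult_append:
  "w \<in> keys (p * q) \<Longrightarrow> \<exists>u v. u \<in> keys p \<and> v \<in> keys q \<and> w = u @ v"
  for p q :: "'x list \<Rightarrow>\<^sub>0 'k::field"
  using keys_mult[of p q] unfolding plus_list_def by blast

lemma mult_single_list: "single u a * single v b = single (u @ v) (a * b :: 'k::field)"
  by (simp add: mult_single plus_list_def)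

lemma single_Nil [simp]: "single [] 1 = (1 :: 'x list \<Rightarrow>\<^sub>0 'k::field)"
  by (metis single_one zero_list_def)

lemma single_mult_single_expansion:
  "single a 1 * p * single b 1 = (\<Sum>w\<in>keys p. pm_scale (lookup p w) (single (a @ w @ b) (1 :: 'k::field)))"
proof -
  have "single a 1 * p * single b 1 = single a 1 * (\<Sum>w\<in>keys p. pm_scale (lookup p w) (single w 1)) * single b 1"
    using pm_expansion[of p] by simp
  then show ?thesis by (simp add: sum_distrib_left sum_distrib_right mult_single_list)
qed

section \<open>Gradings\<close>

lemma word_deg_simps [simp]:
  "word_deg d [] = 0" "word_deg d (x # u) = d x + word_deg d u"
  "word_deg d (u @ v) = word_deg d u + word_deg d v"
  by (simp_all add: word_deg_def)

lemma word_deg_mset: "mset u = mset v \<Longrightarrow> word_deg d u = word_deg d v"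
  unfolding word_deg_def by (metis mset_map sum_mset_sum_list)

lemma word_deg_concat_replicate [simp]: "word_deg d (concat (replicate r u)) = r * word_deg d u"
  by (induction r) auto

lemma word_deg_member_le: "c \<in> set bs \<Longrightarrow> word_deg d c \<le> word_deg d (concat bs)"
  by (induction bs) auto

lemma glex_less_irrefl [simp]: "\<not> glex_less d u u"
  by (simp add: glex_less_def)

lemma glex_less_trans: "glex_less d u v \<Longrightarrow> glex_less d v w \<Longrightarrow> glex_less d u w"
  unfolding glex_less_def using lex_less_trans less_trans by metis

lemma subspace_hom_part: "pm.subspace V \<Longrightarrow> pm.subspace (hom_part \<delta> V n)"
proof (rule pm.subspaceI)
  assume V: "pm.subspace V"
  show "0 \<in> hom_part \<delta> V n" using pm.subspace_0[OF V] by (simp add: hom_part_def)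
  fix x y c assume x: "x \<in> hom_part \<delta> V n"
  have "keys (pm_scale c x) \<subseteq> keys x" by (auto simp: in_keys_iff lookup_pm_scale)
  with x show "pm_scale c x \<in> hom_part \<delta> V n"
    by (auto simp: hom_part_def intro: pm.subspace_scale[OF V])
  assume y: "y \<in> hom_part \<delta> V n"
  with x show "x + y \<in> hom_part \<delta> V n"
    using keys_add[of x y] by (auto simp: hom_part_def intro: pm.subspace_add[OF V])
qed

lemma lower_part_Suc: "lower_part \<delta> V (Suc n) = hom_part \<delta> V n + lower_part \<delta> V n"
  by (simp add: lower_part_def lessThan_Suc)

lemma subspace_lower_part: "pm.subspace V \<Longrightarrow> pm.subspace (lower_part \<delta> V n)"
proof (induction n)
  case 0
  then show ?case by (simp add: lower_part_def set_zero pm.subspace_single_0)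
next
  case (Suc n)
  then show ?case unfolding lower_part_Suc by (intro subspace_set_plus subspace_hom_part)
qed

lemma hom_part_lower_part:
  assumes "pm.subspace V" "p \<in> hom_part \<delta> V m" "m < n" shows "p \<in> lower_part \<delta> V n"
  using assms(3)
proof (induction n)
  case (Suc n)
  show ?case
  proof (cases "m = n")
    case True
    have "p + 0 \<in> hom_part \<delta> V n + lower_part \<delta> V n"
      using assms True pm.subspace_0[OF subspace_lower_part[OF assms(1)]] by (intro set_plus_intro) auto
    then show ?thesis by (simp add: lower_part_Suc)
  next
    case False
    then have "p \<in> lower_part \<delta> V n" using Suc by simp
    then have "0 + p \<in> hom_part \<delta> V n + lower_part \<delta> V n"
      using assms pm.subspace_0[OF subspace_hom_part[OF assms(1)]] by (intro set_plus_intro) auto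
    then show ?thesis by (simp add: lower_part_Suc)
  qed
qed simp

definition hom_component :: "('a \<Rightarrow> nat) \<Rightarrow> nat \<Rightarrow> ('a \<Rightarrow>\<^sub>0 'k::field) \<Rightarrow> ('a \<Rightarrow>\<^sub>0 'k)"
  where "hom_component \<delta> n p = (\<Sum>a\<in>keys p. if \<delta> a = n then single a (lookup p a) else 0)"

lemma lookup_hom_component: "lookup (hom_component \<delta> n p) a = (if \<delta> a = n then lookup p a else 0)"
proof -
  have "lookup (hom_component \<delta> n p) a = (\<Sum>b\<in>keys p. if b = a then if \<delta> a = n then lookup p a else 0 else 0)"
    unfolding hom_component_def lookup_sum by (intro sum.cong) (auto simp: lookup_single when_def)
  then show ?thesis by (auto simp: sum.delta in_keys_iff)
qed

lemma hom_component_add: "hom_component \<delta> n (p + q) = hom_component \<delta> n p + hom_component \<delta> n q"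
  and hom_component_scale: "hom_component \<delta> n (pm_scale c p) = pm_scale c (hom_component \<delta> n p)"
  by (rule poly_mapping_eqI; simp add: lookup_hom_component lookup_add lookup_pm_scale)+

lemma hom_component_homogeneous:
  assumes "\<And>a. a \<in> keys p \<Longrightarrow> \<delta> a = m"
  shows "hom_component \<delta> n p = (if n = m then p else 0)"
  by (rule poly_mapping_eqI) (use assms in \<open>auto simp: lookup_hom_component in_keys_iff\<close>)

section \<open>Leading words of standard brackets\<close>

text \<open>
Comparing multisets of letters is stronger than comparing degrees and does not mention the grading.
\<close>

definition monic_at :: "'x::linorder list \<Rightarrow> ('x list \<Rightarrow>\<^sub>0 'k::field) \<Rightarrow> bool"
  where "monic_at u p \<longleftrightarrow> (\<forall>w\<in>keys (p - single u 1). mset w = mset u \<and> lex_less w u)"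

lemma monic_at_keys:
  assumes "monic_at u p" "w \<in> keys p"
  shows "w = u \<or> mset w = mset u \<and> lex_less w u"
proof (cases "w = u")
  case False
  then have "w \<in> keys (p - single u 1)"
    using assms(2) by (auto simp: in_keys_iff lookup_minus lookup_single when_def)
  then show ?thesis using assms(1) by (auto simp: monic_at_def)
qed simp

lemma monic_at_lookup: "monic_at u p \<Longrightarrow> lookup p u = 1"
  unfolding monic_at_def
  by (metis cancel_comm_monoid_add_class.diff_cancel eq_iff_diff_eq_0 in_keys_iff lex_less_irrefl lookup_minus lookup_single_eq)

lemma monic_at_mult:
  assumes p: "monic_at u p" and q: "monic_at v q"
  shows "monic_at (u @ v) (p * q)"
  unfolding monic_at_def
proof
  define p' q' where "p' = p - single u 1" and "q' = q - single v 1"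
  fix w assume w: "w \<in> keys (p * q - single (u @ v) 1)"
  have "p * q - single (u @ v) 1 = p' * q + single u 1 * q'"
    by (simp add: p'_def q'_def algebra_simps mult_single_list)
  with w have "w \<in> keys (p' * q) \<or> w \<in> keys (single u 1 * q')"
    using keys_add[of "p' * q" "single u 1 * q'"] by auto
  then obtain a b where ab: "w = a @ b" "a \<in> keys p' \<and> b \<in> keys q \<or> a = u \<and> b \<in> keys q'"
    by (auto dest!: keys_mult_append)
  from ab(2) show "mset w = mset (u @ v) \<and> lex_less w (u @ v)"
  proof
    assume *: "a \<in> keys p' \<and> b \<in> keys q"
    then have a: "mset a = mset u" "lex_less a u" using p by (auto simp: monic_at_def p'_def)
    have "mset b = mset v" using * monic_at_keys[OF q] by auto
    moreover have "lex_less (a @ b) (u @ v)"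
      using lex_less_extend[OF a(2)] a(1) by (metis mset_eq_length order_refl)
    ultimately show ?thesis using a ab by simp
  next
    assume "a = u \<and> b \<in> keys q'"
    then show ?thesis using q ab(1) by (auto simp: monic_at_def q'_def)
  qed
qed

text \<open>
For a Lyndon word \<open>u\<close> the second term \<open>[u\<^sub>R][u\<^sub>L]\<close> of the bracket only contributes words \<open>\<le> u\<^sub>Ru\<^sub>L\<close>, and this
rotation is smaller than \<open>u\<close>.
\<close>

lemma monic_at_bracket: "monic_at u (bracket u)"
proof (induction u rule: length_induct)
  case (1 u)
  consider "u = []" | "length u = 1" | "length u \<ge> 2" by (cases u; cases "tl u") auto
  then show ?case
  proof cases
    case 3
    note lr = left_right_factor[OF 3]
    have ne: "u \<noteq> []" "length u \<noteq> 1" using 3 by auto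
    have m: "monic_at (left_factor u) (bracket (left_factor u) :: 'a list \<Rightarrow>\<^sub>0 'b)"
      "monic_at (right_factor u) (bracket (right_factor u) :: 'a list \<Rightarrow>\<^sub>0 'b)"
      using 1 factor_length[OF ne] by auto
    have LR: "monic_at u (bracket (left_factor u) * bracket (right_factor u) :: 'a list \<Rightarrow>\<^sub>0 'b)"
      using monic_at_mult[OF m] lr(1) by simp
    show ?thesis
    proof (cases "lyndon u")
      case True
      let ?P = "bracket (left_factor u) * bracket (right_factor u) :: 'a list \<Rightarrow>\<^sub>0 'b"
      let ?Q = "bracket (right_factor u) * bracket (left_factor u) :: 'a list \<Rightarrow>\<^sub>0 'b"
      have b: "bracket u = ?P - ?Q" using True 3 by (subst bracket.simps) auto
      have less: "lex_less (right_factor u @ left_factor u) u"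
        using True lr unfolding lyndon_def by metis
      have ms: "mset (right_factor u @ left_factor u) = mset u"
        using lr(1) by (metis mset_append add.commute)
      show ?thesis unfolding monic_at_def
      proof
        fix w assume w: "w \<in> keys (bracket u - single u 1 :: 'a list \<Rightarrow>\<^sub>0 'b)"
        have "bracket u - single u 1 = (?P - single u 1) - ?Q" using b by simp
        with w have "w \<in> keys (?P - single u 1) \<or> w \<in> keys ?Q"
          using keys_diff[of "?P - single u 1" ?Q] by auto
        then show "mset w = mset u \<and> lex_less w u"
        proof
          assume "w \<in> keys (?P - single u 1)"
          then show ?thesis using LR by (auto simp: monic_at_def)
        next
          assume "w \<in> keys ?Q"
          then show ?thesis
            using monic_at_keys[OF monic_at_mult[OF m(2,1)]] less ms lex_less_trans by metis
        qed
      qed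
    next
      case False
      then have "bracket u = bracket (left_factor u) * (bracket (right_factor u) :: 'a list \<Rightarrow>\<^sub>0 'b)"
        using 3 by (subst bracket.simps) auto
      then show ?thesis using LR by simp
    qed
  qed (auto simp: bracket.simps[of u] bracket.simps[of "[]"] monic_at_def)
qed

definition bracket_prod :: "'x::linorder list list \<Rightarrow> ('x list \<Rightarrow>\<^sub>0 'k::field)"
  where "bracket_prod us = prod_list (map bracket us)"

lemma bracket_prod_simps [simp]:
  "bracket_prod [] = 1" "bracket_prod (u # us) = bracket u * bracket_prod us"
  "bracket_prod (us @ vs) = bracket_prod us * bracket_prod vs"
  by (simp_all add: bracket_prod_def)

lemma bracket_power: "bracket u ^ j = bracket_prod (replicate j u)"
  by (induction j) auto

lemma monic_at_bracket_prod: "monic_at (concat us) (bracket_prod us)"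
  by (induction us) (auto simp: monic_at_mult monic_at_bracket, simp add: monic_at_def)

lemma word_deg_bracket_prod:
  "w \<in> keys (bracket_prod bs) \<Longrightarrow> word_deg d w = word_deg d (concat bs)"
  using monic_at_keys[OF monic_at_bracket_prod] word_deg_mset by metis

lemma keys_bracket_sum:
  assumes "a \<in> keys (\<Sum>w\<in>A. pm_scale (c w) (bracket w))"
  shows "\<exists>w\<in>A. word_deg d a = word_deg d w"
proof -
  have "\<exists>w\<in>A. lookup (pm_scale (c w) (bracket w)) a \<noteq> 0"
    using assms unfolding in_keys_iff lookup_sum by (meson sum.neutral)
  then obtain w where w: "w \<in> A" "a \<in> keys (bracket_prod [w] :: 'a list \<Rightarrow>\<^sub>0 'b)"
    by (auto simp: lookup_pm_scale in_keys_iff)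
  then show ?thesis using word_deg_bracket_prod[OF w(2), of d] by auto
qed

lemma bracket_Nil [simp]: "bracket [] = 1"
  by (simp add: bracket.simps)

lemma bracket_concat_sorted:
  assumes "sorted_wrt lex_le us" "\<forall>u\<in>set us. lyndon u"
  shows "bracket (concat us) = bracket_prod us"
  using assms
proof (induction us rule: rev_induct)
  case Nil
  then show ?case by simp
next
  case (snoc v us)
  show ?case
  proof (cases "us = []")
    case False
    note f = right_factor_concat[OF snoc.prems False]
    have "v \<noteq> []" "concat us \<noteq> []" using snoc.prems(2) lyndon_nonempty False by (auto simp: neq_Nil_conv)
    then have ne: "length (concat (us @ [v])) \<noteq> 1" "concat (us @ [v]) \<noteq> []"
      by (cases v; cases "concat us"; auto)+
    have "bracket (concat (us @ [v])) = bracket (concat us) * (bracket v :: 'a list \<Rightarrow>\<^sub>0 'b)"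
      by (subst bracket.simps) (simp only: ne f if_False)
    also have "bracket (concat us) = (bracket_prod us :: 'a list \<Rightarrow>\<^sub>0 'b)"
      using snoc by (auto simp: sorted_wrt_append)
    finally show ?thesis by simp
  qed simp
qed

lemma bracket_lyndon_append:
  assumes "lyndon u" "lyndon v" "lex_less v u" "length u = 1 \<or> lex_le (right_factor u) v"
  shows "bracket (u @ v) = bracket u * bracket v - bracket v * bracket u"
proof -
  have "length (u @ v) \<noteq> 1" "u @ v \<noteq> []"
    using lyndon_nonempty[OF assms(1)] lyndon_nonempty[OF assms(2)] by (cases u; cases v; auto)+
  then show ?thesis
    using standard_factorization_append[OF assms(1,2,4)] lyndon_append[OF assms(1-3)]
    by (subst bracket.simps) auto
qed

section \<open>Commutators of brackets of Lyndon words\<close>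

definition commutator :: "'a::ring \<Rightarrow> 'a \<Rightarrow> 'a"
  where "commutator p q = p * q - q * p"

lemma commutator_linear:
  "commutator p (q + q') = commutator p q + commutator p q'"
  "commutator (p + p') q = commutator p q + commutator p' q"
  "commutator p (pm_scale c r) = pm_scale c (commutator p r)"
  "commutator (pm_scale c p) r = pm_scale c (commutator p r)"
  for p q r :: "'a::monoid_add \<Rightarrow>\<^sub>0 'k::field"
  by (simp_all add: commutator_def algebra_simps pm.scale_right_diff_distrib)

lemma commutator_jacobi:
  "commutator (commutator x y) z = commutator (commutator x z) y + commutator x (commutator y z)"
  for x y z :: "'a::ring"
  unfolding commutator_def by (simp add: algebra_simps)

text \<open>
The lower bound is there for the induction that proves the next lemma, whose measure decreases when the
smaller word of a pair grows.
\<close>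

definition lyndon_between :: "'x::linorder list \<Rightarrow> 'x list \<Rightarrow> 'x multiset \<Rightarrow> ('x list \<Rightarrow>\<^sub>0 'k::field) set"
  where "lyndon_between v b M =
    pm.span (bracket ` {w. lyndon w \<and> lex_less v w \<and> lex_le w b \<and> mset w = M})"

text \<open>
The brackets of Lyndon words span a Lie algebra, with control over the words that occur. If \<open>uv\<close> has
standard factorization \<open>(u, v)\<close>, the commutator is \<open>[uv]\<close>. Otherwise \<open>u\<close> is not a letter and \<open>u\<^sub>R > v\<close>; the
Jacobi identity rewrites the commutator by commutators of shorter words and then by commutators of words
with the same letters whose smaller member exceeds \<open>v\<close>. As only finitely many words have those
letters, this recursion ends.
\<close>

lemma commutator_bracket_lyndon:
  assumes "lyndon u" "lyndon v" "lex_less v u"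
  shows "commutator (bracket u) (bracket v) \<in> lyndon_between v (u @ v) (mset (u @ v))"
proof -
  have key: "lyndon u \<longrightarrow> lyndon v \<longrightarrow> lex_less v u \<longrightarrow>
      commutator (bracket u) (bracket v :: 'a list \<Rightarrow>\<^sub>0 'b) \<in> lyndon_between v (u @ v) (mset (u @ v))"
    for u v :: "'a list"
  proof (induction "(length (u @ v), card {x. mset x \<subseteq># mset (u @ v) \<and> lex_less v x})"
      arbitrary: u v rule: wf_induct_rule[OF wf_lex_prod[OF wf_less_than wf_less_than]])
    case (1 u v)
    have IH: "commutator (bracket a) (bracket b :: 'a list \<Rightarrow>\<^sub>0 'b) \<in> lyndon_between b (a @ b) (mset (a @ b))"
      if "lyndon a" "lyndon b" "lex_less b a"
        "length (a @ b) < length (u @ v) \<or> mset (a @ b) = mset (u @ v) \<and> lex_less v b" for a b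
    proof -
      have "card {x. mset x \<subseteq># mset (a @ b) \<and> lex_less b x} < card {x. mset x \<subseteq># mset (u @ v) \<and> lex_less v x}"
        if "mset (a @ b) = mset (u @ v)" "lex_less v b"
      proof (rule psubset_card_mono)
        have "set x \<subseteq> set (u @ v) \<and> length x \<le> length (u @ v)" if "mset x \<subseteq># mset (u @ v)" for x
          using set_mset_mono[OF that] size_mset_mono[OF that] by (simp only: set_mset_mset size_mset)
        then have "{x. mset x \<subseteq># mset (u @ v)} \<subseteq> {x. set x \<subseteq> set (u @ v) \<and> length x \<le> length (u @ v)}"
          by blast
        then have "finite {x. mset x \<subseteq># mset (u @ v)}"
          by (rule finite_subset) (rule finite_lists_length_le, simp)
        then show "finite {x. mset x \<subseteq># mset (u @ v) \<and> lex_less v x}"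
          by (rule finite_subset[rotated]) auto
        have "b \<in> {x. mset x \<subseteq># mset (u @ v) \<and> lex_less v x}"
          using that by (metis (mono_tags, lifting) mem_Collect_eq mset_append mset_subset_eq_add_right)
        moreover have "b \<notin> {x. mset x \<subseteq># mset (a @ b) \<and> lex_less b x}" by simp
        moreover have "{x. mset x \<subseteq># mset (a @ b) \<and> lex_less b x} \<subseteq> {x. mset x \<subseteq># mset (u @ v) \<and> lex_less v x}"
          using that lex_less_trans by auto
        ultimately show "{x. mset x \<subseteq># mset (a @ b) \<and> lex_less b x} \<subset> {x. mset x \<subseteq># mset (u @ v) \<and> lex_less v x}"
          by blast
      qed
      then have "((length (a @ b), card {x. mset x \<subseteq># mset (a @ b) \<and> lex_less b x}),
          (length (u @ v), card {x. mset x \<subseteq># mset (u @ v) \<and> lex_less v x})) \<in> less_than <*lex*> less_than"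
        using that(4) mset_eq_length[of "a @ b" "u @ v"] by auto
      from 1[OF this] that show ?thesis by blast
    qed
    show ?case
    proof (intro impI)
      assume u: "lyndon u" and v: "lyndon v" and vu: "lex_less v u"
      show "commutator (bracket u) (bracket v :: 'a list \<Rightarrow>\<^sub>0 'b) \<in> lyndon_between v (u @ v) (mset (u @ v))"
      proof (cases "length u = 1 \<or> lex_le (right_factor u) v")
        case True
        have "lyndon (u @ v)" using lyndon_append u v vu by blast
        moreover have "lex_less v (u @ v)"
          using lyndon_suffix_less[OF calculation refl] lyndon_nonempty u v by blast
        ultimately have "u @ v \<in> {w. lyndon w \<and> lex_less v w \<and> lex_le w (u @ v) \<and> mset w = mset (u @ v)}"
          by simp
        then have "bracket (u @ v) \<in> lyndon_between v (u @ v) (mset (u @ v))"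
          unfolding lyndon_between_def by (intro pm.span_base imageI)
        then show ?thesis
          unfolding bracket_lyndon_append[OF u v vu True] commutator_def .
      next
        case False
        have len: "length u \<ge> 2" using False lyndon_nonempty[OF u] by (cases u; cases "tl u"; auto)
        define l r where "l = left_factor u" and "r = right_factor u"
        note lr = left_right_factor[OF len, folded l_def r_def]
        note lyn = lyndon_left_right_factor[OF u len, folded l_def r_def]
        have vr: "lex_less v r" using False lex.not_le unfolding r_def by blast
        have ulr: "u = l @ r" using lr by simp
        let ?B = "bracket :: 'a list \<Rightarrow> 'a list \<Rightarrow>\<^sub>0 'b"
        let ?T = "lyndon_between v (u @ v) (mset (u @ v)) :: ('a list \<Rightarrow>\<^sub>0 'b) set"
        have bu: "?B u = commutator (?B l) (?B r)"
          using u len unfolding l_def r_def commutator_def by (subst bracket.simps) auto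
        have jacobi: "commutator (?B u) (?B v) =
            commutator (commutator (?B l) (?B v)) (?B r) + commutator (?B l) (commutator (?B r) (?B v))"
          unfolding bu by (rule commutator_jacobi)
        \<comment> \<open>Induction hypothesis for pairs with the same letters whose smaller word exceeds \<open>v\<close>.\<close>
        have sub: "commutator (?B a) (?B b) \<in> ?T"
          if "lyndon a" "lyndon b" "lex_less b a" "mset (a @ b) = mset (u @ v)" "lex_less v b"
            "lex_le (a @ b) (u @ v)" for a b
        proof -
          have "commutator (?B a) (?B b) \<in> lyndon_between b (a @ b) (mset (a @ b))"
            by (rule IH) (use that in auto)
          also have "\<dots> \<subseteq> ?T" unfolding lyndon_between_def
            using lex_less_trans[OF that(5)] lex.order_trans[OF _ that(6)] that(4)
            by (intro pm.span_mono image_mono) (simp add: Collect_mono)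
          finally show ?thesis .
        qed
        have r_vs_u: "lex_less (r @ x) (u @ y)" for x y
          using lex_less_extend[OF lyn(4)] ulr by simp
        have "commutator (?B l) (commutator (?B r) (?B v)) \<in> ?T"
        proof -
          have "commutator (?B r) (?B v) \<in> lyndon_between v (r @ v) (mset (r @ v))"
            by (rule IH[OF lyn(2) v vr]) (simp add: ulr lr(2))
          then show ?thesis unfolding lyndon_between_def
          proof (rule span_induct_linear)
            fix x assume "x \<in> ?B ` {w. lyndon w \<and> lex_less v w \<and> lex_le w (r @ v) \<and> mset w = mset (r @ v)}"
            then obtain w where w: "x = ?B w" "lyndon w" "lex_less v w" "lex_le w (r @ v)" "mset w = mset (r @ v)"
              by blast
            have wl: "lex_less w l"
              using lex.le_less_trans[OF lex.order_trans[OF w(4) lex_le_prefix] lex_less_trans[OF lyn(4,3)]] .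
            have lw: "lex_le (l @ w) (u @ v)" using w(4) by (auto simp: ulr lex_le_def)
            have "mset (l @ w) = mset (u @ v)" using w(5) by (simp add: ulr)
            from sub[OF lyn(1) w(2) wl this w(3) lw] show "commutator (?B l) x \<in> pm.span (?B ` {w. lyndon w \<and> lex_less v w \<and> lex_le w (u @ v) \<and> mset w = mset (u @ v)})"
              unfolding lyndon_between_def w(1) .
          qed (simp_all add: commutator_linear)
        qed
        moreover have "commutator (commutator (?B l) (?B v)) (?B r) \<in> ?T"
        proof -
          have vl: "lex_less v l" by (rule lex_less_trans[OF vu lyn(3)])
          have "commutator (?B l) (?B v) \<in> lyndon_between v (l @ v) (mset (l @ v))"
            by (rule IH[OF lyn(1) v vl]) (simp add: ulr lr(3))
          then show ?thesis unfolding lyndon_between_def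
          proof (rule span_induct_linear[where f = "\<lambda>x. commutator x (?B r)"])
            fix x assume "x \<in> ?B ` {w. lyndon w \<and> lex_less v w \<and> lex_le w (l @ v) \<and> mset w = mset (l @ v)}"
            then obtain w where w: "x = ?B w" "lyndon w" "lex_less v w" "lex_le w (l @ v)" "mset w = mset (l @ v)"
              by blast
            have ms: "mset (w @ r) = mset (u @ v)" "mset (r @ w) = mset (u @ v)" using w(5) ulr by simp_all
            have "commutator x (?B r) \<in> ?T"
            proof -
              consider "w = r" | "lex_less r w" | "lex_less w r" using lex_less_total by blast
              then show ?thesis
              proof cases
                case 1
                then show ?thesis using w(1) by (simp add: commutator_def lyndon_between_def pm.span_zero)
              next
                case 2
                \<comment> \<open>\<open>wr \<le> lvr < lrv = uv\<close>, where \<open>vr < rv\<close> because \<open>rv\<close> is Lyndon.\<close>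
                have "lex_less (v @ r) (r @ v)"
                  using lyndon_append[OF lyn(2) v vr] lyndon_nonempty lyn(2) v unfolding lyndon_def by blast
                then have "lex_less (l @ v @ r) (u @ v)" using ulr by simp
                moreover have "lex_le (w @ r) (l @ v @ r)"
                  using w(4) lex_less_extend[of w "l @ v" r r] mset_eq_length[OF w(5)] by (auto simp: lex_le_def)
                ultimately have "lex_le (w @ r) (u @ v)"
                  using lex.le_less_trans[THEN lex.less_imp_le] by blast
                then show ?thesis using sub[OF w(2) lyn(2) 2 ms(1) vr] w(1) by simp
              next
                case 3
                have "commutator (?B r) (?B w) \<in> ?T"
                  using sub[OF lyn(2) w(2) 3 ms(2) w(3)] r_vs_u lex.less_imp_le by blast
                moreover have "commutator x (?B r) = - commutator (?B r) (?B w)"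
                  using w(1) by (simp add: commutator_def)
                ultimately show ?thesis unfolding lyndon_between_def by (simp add: pm.span_neg)
              qed
            qed
            then show "commutator x (?B r) \<in> pm.span (?B ` {w. lyndon w \<and> lex_less v w \<and> lex_le w (u @ v) \<and> mset w = mset (u @ v)})"
              by (simp add: lyndon_between_def)
          qed (simp_all add: commutator_linear)
        qed
        ultimately show ?thesis unfolding jacobi
          by (simp add: lyndon_between_def pm.span_add)
      qed
    qed
  qed
  then show ?thesis using assms by blast
qed

section \<open>Subalgebras generated by brackets\<close>

text \<open>
The homogeneous component of degree \<open>n\<close> of a span of products of brackets. Selecting lists of words
by a predicate covers the subalgebras generated by brackets as well as subspaces defined by a
condition on all factors together.
\<close>

definition bracket_span :: "('x::linorder \<Rightarrow> nat) \<Rightarrow> ('x list list \<Rightarrow> bool) \<Rightarrow> nat \<Rightarrow> ('x list \<Rightarrow>\<^sub>0 'k::field) set"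
  where "bracket_span d P n = pm.span {bracket_prod bs | bs. P bs \<and> word_deg d (concat bs) = n}"

lemma bracket_span_base: "P bs \<Longrightarrow> word_deg d (concat bs) = n \<Longrightarrow> bracket_prod bs \<in> bracket_span d P n"
  unfolding bracket_span_def by (intro pm.span_base) blast

lemma bracket_span_keys:
  assumes "g \<in> bracket_span d P n" "w \<in> keys g" shows "word_deg d w = n"
proof -
  have "pm.subspace (hom_part (word_deg d) (UNIV :: ('a list \<Rightarrow>\<^sub>0 'b) set) n)"
    by (rule subspace_hom_part) simp
  then have "bracket_span d P n \<subseteq> hom_part (word_deg d) (UNIV :: ('a list \<Rightarrow>\<^sub>0 'b) set) n"
    unfolding bracket_span_def by (rule pm.span_minimal[rotated]) (auto simp: hom_part_def word_deg_bracket_prod)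
  then show ?thesis using assms by (auto simp: hom_part_def)
qed

lemma subalgebra_gen_span:
  "p \<in> subalgebra_gen (bracket ` S) \<Longrightarrow> p \<in> pm.span {bracket_prod bs | bs. set bs \<subseteq> S}"
proof (induction rule: subalgebra_gen.induct)
  case one
  have "set [] \<subseteq> S \<and> 1 = bracket_prod ([] :: 'a list list)" by simp
  then show ?case by (intro pm.span_base) blast
next
  case (gen p)
  then obtain u where "u \<in> S" "p = bracket u" by blast
  then have "set [u] \<subseteq> S \<and> p = bracket_prod [u]" by simp
  then show ?case by (intro pm.span_base) blast
next
  case (mult p q)
  from mult.IH(1) show ?case
  proof (rule span_induct_linear)
    fix x :: "'a list \<Rightarrow>\<^sub>0 'b" assume "x \<in> {bracket_prod bs | bs. set bs \<subseteq> S}"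
    then obtain bs where bs: "x = bracket_prod bs" "set bs \<subseteq> S" by blast
    from mult.IH(2) show "x * q \<in> pm.span {bracket_prod bs | bs. set bs \<subseteq> S}"
    proof (rule span_induct_linear)
      fix y :: "'a list \<Rightarrow>\<^sub>0 'b" assume "y \<in> {bracket_prod bs | bs. set bs \<subseteq> S}"
      then obtain cs where "y = bracket_prod cs" "set cs \<subseteq> S" by blast
      with bs have "x * y = bracket_prod (bs @ cs)" "set (bs @ cs) \<subseteq> S" by simp_all
      then show "x * y \<in> pm.span {bracket_prod bs | bs. set bs \<subseteq> S}"
        by (intro pm.span_base) blast
    qed (simp_all add: algebra_simps)
  qed (simp_all add: algebra_simps)
qed (simp_all add: pm.span_add pm.span_scale)

lemma bracket_prod_subalgebra:
  assumes "set bs \<subseteq> S" shows "bracket_prod bs \<in> subalgebra_gen (bracket ` S)"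
  using assms by (induction bs) (auto intro: subalgebra_gen.intros)

lemma subspace_subalgebra_gen: "pm.subspace (subalgebra_gen S)"
proof (rule pm.subspaceI)
  show "0 \<in> subalgebra_gen S"
    using subalgebra_gen.scale[where c = 0, OF subalgebra_gen.one[of S]] by simp
qed (auto intro: subalgebra_gen.intros)

text \<open>
Generators are homogeneous, so a homogeneous element of the subalgebra needs only products of its own
degree.
\<close>

lemma hom_part_subalgebra:
  "hom_part (word_deg d) (subalgebra_gen (bracket ` S)) n =
    (bracket_span d (\<lambda>bs. set bs \<subseteq> S) n :: ('a::linorder list \<Rightarrow>\<^sub>0 'b::field) set)"
proof
  show "bracket_span d (\<lambda>bs. set bs \<subseteq> S) n \<subseteq> hom_part (word_deg d) (subalgebra_gen (bracket ` S)) n"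
    unfolding bracket_span_def
    by (rule pm.span_minimal[OF _ subspace_hom_part[OF subspace_subalgebra_gen]])
      (auto simp: hom_part_def bracket_prod_subalgebra word_deg_bracket_prod)
  show "hom_part (word_deg d) (subalgebra_gen (bracket ` S)) n \<subseteq> (bracket_span d (\<lambda>bs. set bs \<subseteq> S) n :: ('a list \<Rightarrow>\<^sub>0 'b) set)"
  proof
    fix p :: "'a list \<Rightarrow>\<^sub>0 'b"
    assume p: "p \<in> hom_part (word_deg d) (subalgebra_gen (bracket ` S)) n"
    then have "p \<in> pm.span {bracket_prod bs | bs. set bs \<subseteq> S}"
      using subalgebra_gen_span by (auto simp: hom_part_def)
    then have "hom_component (word_deg d) n p \<in> bracket_span d (\<lambda>bs. set bs \<subseteq> S) n" unfolding bracket_span_def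
    proof (rule span_induct_linear)
      fix x :: "'a list \<Rightarrow>\<^sub>0 'b" assume "x \<in> {bracket_prod bs | bs. set bs \<subseteq> S}"
      then obtain bs where bs: "x = bracket_prod bs" "set bs \<subseteq> S" by blast
      have "hom_component (word_deg d) n x = (if n = word_deg d (concat bs) then x else 0)"
        by (rule hom_component_homogeneous) (simp add: bs word_deg_bracket_prod)
      then show "hom_component (word_deg d) n x \<in> pm.span {bracket_prod bs | bs. set bs \<subseteq> S \<and> word_deg d (concat bs) = n}"
        using bs by (auto intro!: pm.span_base pm.span_zero)
    qed (simp_all add: hom_component_add hom_component_scale)
    moreover have "hom_component (word_deg d) n p = p"
      using p hom_component_homogeneous[of p "word_deg d" n n] by (simp add: hom_part_def)
    ultimately show "p \<in> bracket_span d (\<lambda>bs. set bs \<subseteq> S) n" by simp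
  qed
qed

text \<open>
Commuting with \<open>[v]\<close> is a derivation, so each term replaces one factor \<open>[c]\<close> by \<open>[v][c] - [c][v]\<close>, a
combination of brackets of Lyndon words \<open>\<le> vc < u\<close>.
\<close>

lemma commutator_bracket_prod:
  assumes v: "lyndon v"
    and bs: "\<forall>c\<in>set bs. lyndon c \<and> lex_less c v \<and> lex_less (v @ c) u \<and> lex_less c u"
  shows "commutator (bracket v) (bracket_prod bs) \<in>
    bracket_span d (\<lambda>cs. cs \<noteq> [] \<and> (\<forall>c\<in>set cs. lex_less c u) \<and> (\<forall>c\<in>set cs. lyndon c)) (word_deg d v + word_deg d (concat bs))"
  using bs
proof (induction bs)
  case Nil
  then show ?case by (simp add: commutator_def bracket_span_def pm.span_zero)
next
  case (Cons b bs)
  let ?P = "\<lambda>cs. cs \<noteq> [] \<and> (\<forall>c\<in>set cs. lex_less c u) \<and> (\<forall>c\<in>set cs. lyndon c)"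
  let ?n = "word_deg d v + word_deg d (concat (b # bs))"
  have eq: "commutator (bracket v) (bracket_prod (b # bs) :: 'a list \<Rightarrow>\<^sub>0 'b) =
      commutator (bracket v) (bracket b) * bracket_prod bs + bracket b * commutator (bracket v) (bracket_prod bs)"
    by (simp add: commutator_def algebra_simps)
  have "commutator (bracket v) (bracket b :: 'a list \<Rightarrow>\<^sub>0 'b) \<in> lyndon_between b (v @ b) (mset (v @ b))"
    using commutator_bracket_lyndon v Cons.prems by auto
  then have "commutator (bracket v) (bracket b :: 'a list \<Rightarrow>\<^sub>0 'b) * bracket_prod bs \<in> bracket_span d ?P ?n"
    unfolding lyndon_between_def bracket_span_def
  proof (rule span_induct_linear, goal_cases)
    case (1 x)
    then obtain w where w: "x = bracket w" "lyndon w" "lex_le w (v @ b)" "mset w = mset (v @ b)" by blast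
    have "lex_less w u" using w(3) Cons.prems by auto
    then have "?P (w # bs)" using w Cons.prems by auto
    moreover have "x * bracket_prod bs = bracket_prod (w # bs)" using w by simp
    moreover have "word_deg d (concat (w # bs)) = ?n" using word_deg_mset[OF w(4)] by simp
    ultimately show ?case by (intro pm.span_base) blast
  qed (simp_all add: algebra_simps)
  moreover have "commutator (bracket v) (bracket_prod bs :: 'a list \<Rightarrow>\<^sub>0 'b) \<in> bracket_span d ?P (word_deg d v + word_deg d (concat bs))"
    using Cons by simp
  then have "bracket b * commutator (bracket v) (bracket_prod bs :: 'a list \<Rightarrow>\<^sub>0 'b) \<in> bracket_span d ?P ?n"
    unfolding bracket_span_def
  proof (rule span_induct_linear, goal_cases)
    case (1 x)
    then obtain cs where cs: "x = bracket_prod cs" "?P cs"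
      "word_deg d (concat cs) = word_deg d v + word_deg d (concat bs)" by blast
    then have "?P (b # cs)" "bracket b * x = bracket_prod (b # cs)" "word_deg d (concat (b # cs)) = ?n"
      using Cons.prems by auto
    then show ?case by (intro pm.span_base) blast
  qed (simp_all add: algebra_simps)
  ultimately show ?case unfolding eq by (simp add: bracket_span_def pm.span_add)
qed

section \<open>Tensor squares\<close>

lemma lookup_tensor [simp]: "lookup (tensor p q) (a, b) = lookup p a * lookup q b"
proof -
  have "lookup (tensor p q) (a, b) =
      (\<Sum>u\<in>keys p. \<Sum>v\<in>keys q. if v = b then (if u = a then lookup p u * lookup q v else 0) else 0)"
    unfolding tensor_def lookup_sum
    by (intro sum.cong refl) (auto simp: lookup_single when_def)
  also have "\<dots> = (\<Sum>u\<in>keys p. if u = a then lookup p u * lookup q b else 0)"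
    by (intro sum.cong refl) (auto simp: sum.delta in_keys_iff)
  also have "\<dots> = lookup p a * lookup q b"
    by (auto simp: sum.delta in_keys_iff)
  finally show ?thesis .
qed

lemma keys_tensor: "(a, b) \<in> keys (tensor p q) \<longleftrightarrow> a \<in> keys p \<and> b \<in> keys q"
  by (simp add: in_keys_iff)

lemma tensor_linear:
  "tensor (p + p') q = tensor p q + tensor p' q"
  "tensor p (q + q') = tensor p q + tensor p q'"
  "tensor (p - p') q = tensor p q - tensor p' q"
  "tensor p (q - q') = tensor p q - tensor p q'"
  "tensor (pm_scale c p) q = pm_scale c (tensor p q)"
  "tensor p (pm_scale c q) = pm_scale c (tensor p q)"
  by (rule poly_mapping_eqI;
      auto simp: lookup_add lookup_minus lookup_pm_scale algebra_simps)+

lemma tensor_single: "tensor (single a x) (single b y) = single (a, b) (x * y)"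
  by (rule poly_mapping_eqI) (auto simp: lookup_single when_def split: if_splits)

lemma tensor_one [simp]: "tensor 1 1 = (1 :: 'a::monoid_add \<times> 'b::monoid_add \<Rightarrow>\<^sub>0 'k::field)"
  by (metis mult_1 single_one tensor_single zero_prod_def)

lemma tensor_mult: "tensor p q * tensor p' q' = tensor (p * p') (q * q')"
  for p p' :: "'a::monoid_add \<Rightarrow>\<^sub>0 'k::field" and q q' :: "'b::monoid_add \<Rightarrow>\<^sub>0 'k"
proof (induction p rule: pm_induct)
  case (single a)
  show ?case
  proof (induction q rule: pm_induct)
    case (single b)
    show ?case
    proof (induction p' rule: pm_induct)
      case (single a')
      show ?case
        by (induction q' rule: pm_induct)
          (simp_all add: tensor_single mult_single tensor_linear algebra_simps)
    qed (simp_all add: tensor_linear algebra_simps)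
  qed (simp_all add: tensor_linear algebra_simps)
qed (simp_all add: tensor_linear algebra_simps)

text \<open>
The summands \<open>b \<otimes> 1\<close> and \<open>1 \<otimes> b\<close> commute although the algebra does not.
\<close>

lemma tensor_power_binomial:
  "(tensor b 1 + tensor 1 b) ^ n =
    (\<Sum>j\<le>n. pm_scale (of_nat (n choose j)) (tensor (b ^ (n - j)) (b ^ j)))"
  for b :: "'a::monoid_add \<Rightarrow>\<^sub>0 'k::field"
proof (induction n)
  case 0
  then show ?case by simp
next
  case (Suc n)
  define f where "f j = tensor (b ^ (Suc n - j)) (b ^ j)" for j
  have step: "(tensor b 1 + tensor 1 b) * tensor (b ^ (n - j)) (b ^ j) = f j + f (Suc j)" if "j \<le> n" for j
    using that by (simp add: f_def distrib_right tensor_mult Suc_diff_le)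
  have "(tensor b 1 + tensor 1 b) ^ Suc n =
      (\<Sum>j\<le>n. pm_scale (of_nat (n choose j)) (f j + f (Suc j)))"
    by (simp add: Suc.IH sum_distrib_left step)
  also have "\<dots> = (\<Sum>j\<le>n. pm_scale (of_nat (n choose j)) (f j)) + (\<Sum>j\<le>n. pm_scale (of_nat (n choose j)) (f (Suc j)))"
    by (simp add: pm.scale_right_distrib sum.distrib)
  also have "(\<Sum>j\<le>n. pm_scale (of_nat (n choose j)) (f j)) = (\<Sum>j\<le>Suc n. pm_scale (of_nat (n choose j)) (f j))"
    by (simp add: binomial_eq_0)
  also have "\<dots> = f 0 + (\<Sum>j\<le>n. pm_scale (of_nat (n choose Suc j)) (f (Suc j)))"
    by (subst sum.atMost_Suc_shift) simp
  also have "\<dots> + (\<Sum>j\<le>n. pm_scale (of_nat (n choose j)) (f (Suc j))) =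
      f 0 + (\<Sum>j\<le>n. pm_scale (of_nat (Suc n choose Suc j)) (f (Suc j)))"
    by (simp add: pm.scale_left_distrib sum.distrib add_ac)
  also have "\<dots> = (\<Sum>j\<le>Suc n. pm_scale (of_nat (Suc n choose j)) (f j))"
    by (subst sum.atMost_Suc_shift) simp
  finally show ?case by (simp add: f_def)
qed

text \<open>
Tensors of degree \<open>n\<close> whose second factors are products of Lyndon brackets selected by \<open>P\<close>, modulo tensors
of total degree below \<open>n\<close>. First factors are arbitrary: the argument evaluates second factors only.
\<close>

definition bracket_tensors :: "('x::linorder \<Rightarrow> nat) \<Rightarrow> ('x list list \<Rightarrow> bool) \<Rightarrow> nat \<Rightarrow> ('x list \<times> 'x list \<Rightarrow>\<^sub>0 'k::field) set"
  where "bracket_tensors d P n = pm.span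
    ({tensor (single a 1) (bracket_prod bs) | a bs.
        P bs \<and> (\<forall>b\<in>set bs. lyndon b) \<and> word_deg d a + word_deg d (concat bs) = n}
     \<union> {single (a, b) 1 | a b. word_deg d a + word_deg d b < n})"

lemma subspace_bracket_tensors: "pm.subspace (bracket_tensors d P n)"
  by (simp add: bracket_tensors_def)

lemma bracket_tensors_mono:
  assumes "\<And>bs. P bs \<Longrightarrow> \<forall>b\<in>set bs. lyndon b \<Longrightarrow> Q bs"
  shows "bracket_tensors d P n \<subseteq> bracket_tensors d Q n"
  unfolding bracket_tensors_def by (rule pm.span_mono) (use assms in blast)

lemma bracket_tensors_lower:
  assumes "\<And>a b. (a, b) \<in> keys t \<Longrightarrow> word_deg d a + word_deg d b < n"
  shows "t \<in> bracket_tensors d P n"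
proof (rule pm_mem_subspace[OF subspace_bracket_tensors])
  fix ab assume "ab \<in> keys t"
  then show "single ab 1 \<in> bracket_tensors d P n" using assms[of "fst ab" "snd ab"]
    unfolding bracket_tensors_def by (intro pm.span_base) (cases ab; auto)
qed

lemma bracket_tensors_tensor:
  assumes p: "\<And>a. a \<in> keys p \<Longrightarrow> word_deg d a = i"
    and q: "q \<in> bracket_span d (\<lambda>bs. P bs \<and> (\<forall>b\<in>set bs. lyndon b)) j" and n: "i + j = n"
  shows "tensor p q \<in> bracket_tensors d P n"
proof -
  have *: "tensor (single a 1) q \<in> bracket_tensors d P n" if a: "word_deg d a = i" for a
    using q unfolding bracket_span_def bracket_tensors_def
  proof (rule span_induct_linear, goal_cases)
    case (1 x)
    then show ?case using a n by (intro pm.span_base) auto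
  qed (simp_all add: tensor_linear)
  have "tensor p q = (\<Sum>a\<in>keys p. pm_scale (lookup p a) (tensor (single a 1) q))"
    by (rule poly_mapping_eqI)
      (auto simp: lookup_sum lookup_pm_scale lookup_single when_def if_distrib if_distribR sum.delta in_keys_iff
        simp flip: mult.assoc cong: if_cong)
  also have "\<dots> \<in> bracket_tensors d P n"
    by (intro pm.subspace_sum pm.subspace_scale subspace_bracket_tensors * p)
  finally show ?thesis .
qed

text \<open>
In checking \<open>R\<close>, the degrees of the two products may be assumed to be at most \<open>n\<close> and \<open>m\<close>, since the first
factors have degree \<open>\<ge> 0\<close>.
\<close>

lemma bracket_tensors_mult:
  assumes x: "x \<in> bracket_tensors d P n" and y: "y \<in> bracket_tensors d Q m"
    and PQ: "\<And>bs cs. P bs \<Longrightarrow> Q cs \<Longrightarrow> \<forall>b\<in>set bs. lyndon b \<Longrightarrow> \<forall>b\<in>set cs. lyndon b \<Longrightarrow>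
      \<exists>k. word_deg d (concat bs) + k = n \<Longrightarrow> \<exists>k. word_deg d (concat cs) + k = m \<Longrightarrow> R (bs @ cs)"
  shows "x * y \<in> bracket_tensors d R (n + m)"
proof -
  have low: "z * single (a, b) 1 \<in> bracket_tensors d R (n + m)" "single (a, b) 1 * z \<in> bracket_tensors d R (n + m)"
    if "\<And>a' b'. (a', b') \<in> keys z \<Longrightarrow> word_deg d a + word_deg d b + (word_deg d a' + word_deg d b') < n + m"
    for z :: "'a list \<times> 'a list \<Rightarrow>\<^sub>0 'b" and a b
    using that keys_mult[of z "single (a, b) 1"] keys_mult[of "single (a, b) 1" z]
    by (intro bracket_tensors_lower; fastforce simp: plus_prod_def plus_list_def)+
  from x show ?thesis unfolding bracket_tensors_def[of d P]
  proof (rule span_induct_linear[where T = "bracket_tensors d R (n + m)", unfolded pm.span_eq_iff[THEN iffD2, OF subspace_bracket_tensors]], goal_cases)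
    case (1 x)
    from y show ?case unfolding bracket_tensors_def[of d Q]
    proof (rule span_induct_linear[where T = "bracket_tensors d R (n + m)", unfolded pm.span_eq_iff[THEN iffD2, OF subspace_bracket_tensors]], goal_cases)
      case (1 y)
      from \<open>x \<in> _\<close> consider (1) a bs where "x = tensor (single a 1) (bracket_prod bs)" "P bs"
          "\<forall>b\<in>set bs. lyndon b" "word_deg d a + word_deg d (concat bs) = n"
        | (2) a b where "x = single (a, b) 1" "word_deg d a + word_deg d b < n" by blast
      note cx = this
      from 1 consider (1) a bs where "y = tensor (single a 1) (bracket_prod bs)" "Q bs"
          "\<forall>b\<in>set bs. lyndon b" "word_deg d a + word_deg d (concat bs) = m"
        | (2) a b where "y = single (a, b) 1" "word_deg d a + word_deg d b < m" by blast
      note cy = this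
      have kx: "word_deg d a + word_deg d b \<le> n" if "(a, b) \<in> keys x" for a b
        using cx that by cases (auto simp: keys_tensor word_deg_bracket_prod)
      have ky: "word_deg d a + word_deg d b \<le> m" if "(a, b) \<in> keys y" for a b
        using cy that by cases (auto simp: keys_tensor word_deg_bracket_prod)
      from cx show "x * y \<in> bracket_tensors d R (n + m)"
      proof cases
        case x: (1 a bs)
        from cy show ?thesis
        proof cases
          case y: (1 a' cs)
          have "R (bs @ cs)"
            using PQ[OF x(2) y(2) x(3) y(3)] x(4) y(4) by (metis add.commute)
          then show ?thesis using x y
            by (auto simp: tensor_mult mult_single_list simp flip: bracket_prod_simps(3)
                intro!: bracket_tensors_tensor[where i = "word_deg d (a @ a')"] bracket_span_base)
        next
          case y: (2 a' b')
          then show ?thesis using low(1)[of x a' b'] kx by fastforce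
        qed
      next
        case x: (2 a b)
        then show ?thesis using low(2)[of y a b] ky by fastforce
      qed
    qed (simp_all add: algebra_simps)
  qed (simp_all add: algebra_simps)
qed

lemma bracket_tensors_bracket_one: "tensor (bracket_prod bs) 1 \<in> bracket_tensors d P (word_deg d (concat bs))" if "P []"
  using that bracket_span_base[of "\<lambda>bs. P bs \<and> (\<forall>b\<in>set bs. lyndon b)" "[]" d 0]
  by (intro bracket_tensors_tensor[where i = "word_deg d (concat bs)" and j = 0] word_deg_bracket_prod) auto

lemma bracket_tensors_bracket_one': "tensor (bracket c) 1 \<in> bracket_tensors d P (word_deg d c)" if "P []"
  using bracket_tensors_bracket_one[of P "[c]" d] that by simp

lemma bracket_tensors_one_bracket: "tensor 1 (bracket c) \<in> bracket_tensors d P (word_deg d c)" if "P [c]" "lyndon c"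
  using that bracket_span_base[of "\<lambda>bs. P bs \<and> (\<forall>b\<in>set bs. lyndon b)" "[c]" d "word_deg d c"]
  by (intro bracket_tensors_tensor[where i = 0 and j = "word_deg d c"]) (auto simp: zero_list_def)

section \<open>The comultiplication on brackets of Lyndon words\<close>

text \<open>
The degree bound is what propagates triangularity from letters to Lyndon words: a word below \<open>u\<close> of
smaller degree than \<open>u\<close> does not start with \<open>u\<close>, and so stays below every word that does.
\<close>

definition smaller_factors :: "('x::linorder \<Rightarrow> nat) \<Rightarrow> 'x list \<Rightarrow> 'x list list \<Rightarrow> bool"
  where "smaller_factors d u bs \<longleftrightarrow> bs \<noteq> [] \<and> (\<forall>c\<in>set bs. lex_less c u) \<and> word_deg d (concat bs) < word_deg d u"

locale triangular_comultiplication =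
  fixes d :: "'x::wellorder \<Rightarrow> nat"
    and \<Delta> :: "('x list \<Rightarrow>\<^sub>0 'k::field) \<Rightarrow> ('x list \<times> 'x list \<Rightarrow>\<^sub>0 'k)"
  assumes deg_pos: "d x > 0"
    and comultiplication: "comultiplication \<Delta>"
    and triangular: "triangular d \<Delta>"
begin

lemma word_deg_eq_0 [simp]: "word_deg d w = 0 \<longleftrightarrow> w = []"
  using deg_pos by (cases w) auto

lemma word_deg_pos [simp]: "0 < word_deg d w \<longleftrightarrow> w \<noteq> []"
  using word_deg_eq_0 neq0_conv by blast

lemma comult_simps:
  "\<Delta> 1 = 1" "\<Delta> (p * q) = \<Delta> p * \<Delta> q" "\<Delta> (p + q) = \<Delta> p + \<Delta> q" "\<Delta> (pm_scale c p) = pm_scale c (\<Delta> p)"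
  "\<Delta> (p - q) = \<Delta> p - \<Delta> q"
proof -
  have lin: "Vector_Spaces.linear pm_scale pm_scale \<Delta>"
    using comultiplication by (simp add: comultiplication_def)
  interpret l: Vector_Spaces.linear pm_scale pm_scale \<Delta> by (fact lin)
  show "\<Delta> 1 = 1" "\<Delta> (p * q) = \<Delta> p * \<Delta> q" "\<Delta> (p + q) = \<Delta> p + \<Delta> q" "\<Delta> (pm_scale c p) = pm_scale c (\<Delta> p)"
    "\<Delta> (p - q) = \<Delta> p - \<Delta> q"
    using comultiplication by (auto simp: comultiplication_def l.add l.scale l.diff)
qed

text \<open>
This is triangularity with the information about first factors forgotten.
\<close>

lemma comult_letter:
  "\<Delta> (single [x] 1) - tensor 1 (single [x] 1) - tensor (single [x] 1) 1 \<in> bracket_tensors d (smaller_factors d [x]) (d x)"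
proof -
  let ?T = "bracket_tensors d (smaller_factors d [x]) (d x) :: ('x list \<times> 'x list \<Rightarrow>\<^sub>0 'k) set"
  let ?S = "{u. lyndon u \<and> lex_less u [x]}"
  have "tensor_space (hom_part (word_deg d) (free_lt [x]) i) (hom_part (word_deg d) (free_lt [x]) j) \<subseteq> ?T"
    if ij: "0 < i" "0 < j" "i + j = d x" for i j
    unfolding tensor_space_def
  proof (rule pm.span_minimal[OF _ subspace_bracket_tensors], safe)
    fix p q :: "'x list \<Rightarrow>\<^sub>0 'k"
    assume p: "p \<in> hom_part (word_deg d) (free_lt [x]) i" and q: "q \<in> hom_part (word_deg d) (free_lt [x]) j"
    have "q \<in> bracket_span d (\<lambda>bs. set bs \<subseteq> ?S) j"
      using q by (simp add: free_lt_def hom_part_subalgebra)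
    also have "\<dots> \<subseteq> bracket_span d (\<lambda>bs. smaller_factors d [x] bs \<and> (\<forall>b\<in>set bs. lyndon b)) j"
      unfolding bracket_span_def smaller_factors_def using ij by (intro pm.span_mono) auto
    finally show "tensor p q \<in> ?T"
      using p ij by (intro bracket_tensors_tensor[where i = i and j = j]) (auto simp: hom_part_def)
  qed
  then have "(\<Sum>(i, j)\<in>{(i, j). 0 < i \<and> 0 < j \<and> i + j = d x}.
            tensor_space (hom_part (word_deg d) (free_lt [x]) i)
                         (hom_part (word_deg d) (free_lt [x]) j)) \<subseteq> ?T"
    by (intro sum_set_subspace[OF subspace_bracket_tensors]) auto
  moreover have "lower_part (tensor_deg d) UNIV (d x) \<subseteq> ?T"
    unfolding lower_part_def
    by (intro sum_set_subspace[OF subspace_bracket_tensors])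
      (auto simp: hom_part_def tensor_deg_def intro!: bracket_tensors_lower)
  ultimately have sub: "(\<Sum>(i, j)\<in>{(i, j). 0 < i \<and> 0 < j \<and> i + j = d x}.
            tensor_space (hom_part (word_deg d) (free_lt [x]) i)
                         (hom_part (word_deg d) (free_lt [x]) j))
         + lower_part (tensor_deg d) UNIV (d x) \<subseteq> ?T"
    using pm.subspace_add[OF subspace_bracket_tensors] by (fastforce elim!: set_plus_elim)
  have "\<Delta> (single [x] 1) \<in> (tensor 1 (single [x] 1) + tensor (single [x] 1) 1) +o
        ((\<Sum>(i, j)\<in>{(i, j). 0 < i \<and> 0 < j \<and> i + j = d x}.
            tensor_space (hom_part (word_deg d) (free_lt [x]) i)
                         (hom_part (word_deg d) (free_lt [x]) j))
         + lower_part (tensor_deg d) UNIV (d x))"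
    using triangular unfolding triangular_def Let_def by blast
  with sub show ?thesis by (auto simp: elt_set_plus_def algebra_simps)
qed

text \<open>
Expand \<open>\<Delta>[u]\<close> as the commutator of \<open>\<Delta>[u\<^sub>L]\<close> and \<open>\<Delta>[u\<^sub>R]\<close>. The cross terms of \<open>1 \<otimes> [u\<^sub>L]\<close> with \<open>[u\<^sub>R] \<otimes> 1\<close> vanish,
and the diagonal ones give \<open>1 \<otimes> [u] + [u] \<otimes> 1\<close>. All other terms have second factors below \<open>u\<close>. The factor
\<open>[u\<^sub>L]\<close>, which exceeds \<open>u\<close>, enters second factors only through its commutator with products of brackets
below \<open>u\<^sub>R\<close>, and that commutator only involves brackets below \<open>u\<^sub>Lu\<^sub>R = u\<close>.
\<close>

lemma comult_lyndon:
  assumes "lyndon u"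
  shows "\<Delta> (bracket u) - tensor 1 (bracket u) - tensor (bracket u) 1 \<in> bracket_tensors d (smaller_factors d u) (word_deg d u)"
  using assms
proof (induction u rule: length_induct)
  case (1 u)
  then have u: "lyndon u" by simp
  show ?case
  proof (cases "length u = 1")
    case True
    then obtain x where "u = [x]" by (auto simp: length_Suc_conv)
    then show ?thesis using comult_letter[of x] by (simp add: bracket.simps)
  next
    case False
    have len: "length u \<ge> 2" using False lyndon_nonempty[OF u] by (cases u; cases "tl u"; auto)
    define l r where "l = left_factor u" and "r = right_factor u"
    note lr = left_right_factor[OF len, folded l_def r_def]
    note lyn = lyndon_left_right_factor[OF u len, folded l_def r_def]
    let ?B = "bracket :: 'x list \<Rightarrow> 'x list \<Rightarrow>\<^sub>0 'k"
    let ?T = "bracket_tensors d (smaller_factors d u) (word_deg d u) :: ('x list \<times> 'x list \<Rightarrow>\<^sub>0 'k) set"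
    have ulr: "u = l @ r" using lr by simp
    have bu: "?B u = commutator (?B l) (?B r)"
      using u len unfolding l_def r_def commutator_def by (subst bracket.simps) auto
    have du: "word_deg d u = word_deg d l + word_deg d r" using ulr by simp
    have pos: "word_deg d l > 0" "word_deg d r > 0"
      using lr(2,3) deg_pos by (cases l; cases r; simp)+
    define \<rho> \<sigma> where "\<rho> = \<Delta> (?B l) - tensor 1 (?B l) - tensor (?B l) 1"
      and "\<sigma> = \<Delta> (?B r) - tensor 1 (?B r) - tensor (?B r) 1"
    have "length l < length u" "length r < length u" using lr(2,3) by (simp_all add: ulr)
    then have \<rho>: "\<rho> \<in> bracket_tensors d (smaller_factors d l) (word_deg d l)" and \<sigma>: "\<sigma> \<in> bracket_tensors d (smaller_factors d r) (word_deg d r)"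
      using 1 lyn unfolding \<rho>_def \<sigma>_def by blast+
    have expand: "\<Delta> (?B u) - tensor 1 (?B u) - tensor (?B u) 1 =
        commutator \<rho> (tensor 1 (?B r)) + commutator \<rho> (tensor (?B r) 1) + commutator (tensor 1 (?B l)) \<sigma>
        + commutator (tensor (?B l) 1) \<sigma> + commutator \<rho> \<sigma>"
    proof -
      have "\<Delta> (?B l) = tensor 1 (?B l) + tensor (?B l) 1 + \<rho>" "\<Delta> (?B r) = tensor 1 (?B r) + tensor (?B r) 1 + \<sigma>"
        by (simp_all add: \<rho>_def \<sigma>_def)
      then show ?thesis
        by (simp add: bu commutator_def comult_simps tensor_linear algebra_simps tensor_mult)
    qed
    have less_r: "lex_less c u" if "lex_less c r" for c by (rule lex_less_trans[OF that lyn(4)])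
    \<comment> \<open>A word below \<open>l\<close> of smaller degree differs from \<open>l\<close> at a letter, hence is below \<open>l @ r\<close> too.\<close>
    have less_l: "lex_less c u" if c: "lex_less c l" and dc: "word_deg d c < word_deg d l" for c
    proof -
      have "\<not> (\<exists>s. s \<noteq> [] \<and> c = l @ s)" using dc by auto
      then show ?thesis using lex_less_dichotomy[OF c] ulr by (metis append_Nil2)
    qed
    have l_small: "\<forall>c\<in>set bs. lex_less c u" if "smaller_factors d l bs" for bs
      using that less_l word_deg_member_le unfolding smaller_factors_def by (metis le_less_trans)
    have kl: "word_deg d a = word_deg d w" if "a \<in> keys (?B w)" for a w
      using word_deg_bracket_prod[of a "[w]" d] that by simp
    have one: "1 \<in> bracket_span d (\<lambda>bs. bs = [] \<and> (\<forall>b\<in>set bs. lyndon b)) 0"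
      using bracket_span_base[of "\<lambda>bs. bs = [] \<and> (\<forall>b\<in>set bs. lyndon b)" "[]" d 0] by simp
    have l1: "tensor (?B l) 1 \<in> bracket_tensors d (\<lambda>bs. bs = []) (word_deg d l)"
      and r1: "tensor (?B r) 1 \<in> bracket_tensors d (\<lambda>bs. bs = []) (word_deg d r)"
      by (rule bracket_tensors_tensor[OF kl one], simp_all)+
    have "?B r \<in> bracket_span d (\<lambda>bs. bs = [r] \<and> (\<forall>b\<in>set bs. lyndon b)) (word_deg d r)"
      using bracket_span_base[of "\<lambda>bs. bs = [r] \<and> (\<forall>b\<in>set bs. lyndon b)" "[r]" d "word_deg d r"] lyn by simp
    then have r2: "tensor 1 (?B r) \<in> bracket_tensors d (\<lambda>bs. bs = [r]) (word_deg d r)"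
      by (intro bracket_tensors_tensor[where i = 0 and j = "word_deg d r"]) (auto simp: zero_list_def)
    have sp: "smaller_factors d u (bs @ cs)"
      if "\<forall>c\<in>set (bs @ cs). lex_less c u" "bs @ cs \<noteq> []"
        "word_deg d (concat bs) + word_deg d (concat cs) < word_deg d u" for bs cs
      using that by (auto simp: smaller_factors_def)
    have "commutator \<rho> (tensor 1 (?B r)) \<in> ?T"
      unfolding commutator_def du
    proof (intro pm.subspace_diff subspace_bracket_tensors)
      show "\<rho> * tensor 1 (?B r) \<in> bracket_tensors d (smaller_factors d u) (word_deg d l + word_deg d r)"
        by (rule bracket_tensors_mult[OF \<rho> r2], rule sp) (use l_small lyn du in \<open>auto simp: smaller_factors_def\<close>)
      have "tensor 1 (?B r) * \<rho> \<in> bracket_tensors d (smaller_factors d u) (word_deg d r + word_deg d l)"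
        by (rule bracket_tensors_mult[OF r2 \<rho>], rule sp) (use l_small lyn du in \<open>auto simp: smaller_factors_def\<close>)
      then show "tensor 1 (?B r) * \<rho> \<in> bracket_tensors d (smaller_factors d u) (word_deg d l + word_deg d r)"
        by (simp add: add.commute)
    qed
    moreover have "commutator \<rho> (tensor (?B r) 1) \<in> ?T"
      unfolding commutator_def du
    proof (intro pm.subspace_diff subspace_bracket_tensors)
      show "\<rho> * tensor (?B r) 1 \<in> bracket_tensors d (smaller_factors d u) (word_deg d l + word_deg d r)"
        by (rule bracket_tensors_mult[OF \<rho> r1], rule sp) (use l_small lyn du in \<open>auto simp: smaller_factors_def\<close>)
      have "tensor (?B r) 1 * \<rho> \<in> bracket_tensors d (smaller_factors d u) (word_deg d r + word_deg d l)"
        by (rule bracket_tensors_mult[OF r1 \<rho>], rule sp) (use l_small lyn du in \<open>auto simp: smaller_factors_def\<close>)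
      then show "tensor (?B r) 1 * \<rho> \<in> bracket_tensors d (smaller_factors d u) (word_deg d l + word_deg d r)"
        by (simp add: add.commute)
    qed
    moreover have "commutator (tensor (?B l) 1) \<sigma> \<in> ?T"
      unfolding commutator_def du
    proof (intro pm.subspace_diff subspace_bracket_tensors)
      show "tensor (?B l) 1 * \<sigma> \<in> bracket_tensors d (smaller_factors d u) (word_deg d l + word_deg d r)"
        by (rule bracket_tensors_mult[OF l1 \<sigma>], rule sp) (use less_r du in \<open>auto simp: smaller_factors_def\<close>)
      have "\<sigma> * tensor (?B l) 1 \<in> bracket_tensors d (smaller_factors d u) (word_deg d r + word_deg d l)"
        by (rule bracket_tensors_mult[OF \<sigma> l1], rule sp) (use less_r du in \<open>auto simp: smaller_factors_def\<close>)
      then show "\<sigma> * tensor (?B l) 1 \<in> bracket_tensors d (smaller_factors d u) (word_deg d l + word_deg d r)"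
        by (simp add: add.commute)
    qed
    moreover have "commutator \<rho> \<sigma> \<in> ?T"
      unfolding commutator_def du
    proof (intro pm.subspace_diff subspace_bracket_tensors)
      show "\<rho> * \<sigma> \<in> bracket_tensors d (smaller_factors d u) (word_deg d l + word_deg d r)"
        by (rule bracket_tensors_mult[OF \<rho> \<sigma>], rule sp) (use l_small less_r du in \<open>auto simp: smaller_factors_def\<close>)
      have "\<sigma> * \<rho> \<in> bracket_tensors d (smaller_factors d u) (word_deg d r + word_deg d l)"
        by (rule bracket_tensors_mult[OF \<sigma> \<rho>], rule sp) (use l_small less_r du in \<open>auto simp: smaller_factors_def\<close>)
      then show "\<sigma> * \<rho> \<in> bracket_tensors d (smaller_factors d u) (word_deg d l + word_deg d r)"
        by (simp add: add.commute)
    qed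
    moreover have "commutator (tensor 1 (?B l)) \<sigma> \<in> ?T"
      using \<sigma> unfolding bracket_tensors_def[of d "smaller_factors d r"]
    proof (rule span_induct_linear[where T = "?T", unfolded pm.span_eq_iff[THEN iffD2, OF subspace_bracket_tensors]], goal_cases)
      case (1 x)
      then consider (1) a bs where "x = tensor (single a 1) (bracket_prod bs)" "smaller_factors d r bs"
          "\<forall>b\<in>set bs. lyndon b" "word_deg d a + word_deg d (concat bs) = word_deg d r"
        | (2) a b where "x = single (a, b) 1" "word_deg d a + word_deg d b < word_deg d r" by blast
      then show ?case
      proof cases
        case (1 a bs)
        have rl: "lex_less r l" by (rule lex_less_trans[OF lyn(4,3)])
        have "lyndon c \<and> lex_less c l \<and> lex_less (l @ c) u \<and> lex_less c u" if "c \<in> set bs" for c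
          using that 1(2,3) lyn rl less_r lex_less_trans[of c r l] by (auto simp: smaller_factors_def ulr)
        then have "commutator (?B l) (bracket_prod bs) \<in>
            bracket_span d (\<lambda>cs. cs \<noteq> [] \<and> (\<forall>c\<in>set cs. lex_less c u) \<and> (\<forall>c\<in>set cs. lyndon c)) (word_deg d l + word_deg d (concat bs))"
          using commutator_bracket_prod[OF lyn(1)] by blast
        also have "\<dots> \<subseteq> bracket_span d (\<lambda>cs. smaller_factors d u cs \<and> (\<forall>b\<in>set cs. lyndon b)) (word_deg d l + word_deg d (concat bs))"
          unfolding bracket_span_def using 1(2) by (intro pm.span_mono) (auto simp: smaller_factors_def du)
        finally have "tensor (single a 1) (commutator (?B l) (bracket_prod bs)) \<in> ?T"
          by (intro bracket_tensors_tensor[where i = "word_deg d a"]) (use 1 du in auto)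
        then show ?thesis using 1(1) by (simp add: commutator_def tensor_mult tensor_linear)
      next
        case (2 a b)
        have x: "x = tensor (single a 1) (single b 1)" using 2 by (simp add: tensor_single)
        have "commutator (tensor 1 (?B l)) x = tensor (single a 1) (commutator (?B l) (single b 1))"
          unfolding x by (simp add: commutator_def tensor_mult tensor_linear)
        also have "\<dots> \<in> ?T"
        proof (rule bracket_tensors_lower)
          fix a' b' assume ab: "(a', b') \<in> keys (tensor (single a 1) (commutator (?B l) (single b 1)))"
          then have "b' \<in> keys (commutator (?B l) (single b 1))" "a' = a" by (auto simp: keys_tensor)
          then have "word_deg d b' = word_deg d l + word_deg d b"
            using keys_diff[of "?B l * single b 1" "single b 1 * ?B l"] unfolding commutator_def
            by (auto dest!: keys_mult_append kl)
          then show "word_deg d a' + word_deg d b' < word_deg d u" using 2 du \<open>a' = a\<close> by simp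
        qed
        finally show ?thesis .
      qed
    qed (simp_all add: commutator_linear)
    ultimately show ?thesis unfolding expand by (intro pm.subspace_add subspace_bracket_tensors)
  qed
qed

lemma comult_word_deg:
  "(a, b) \<in> keys (\<Delta> (single w 1)) \<Longrightarrow> word_deg d a + word_deg d b \<le> word_deg d w"
proof (induction w arbitrary: a b)
  case Nil
  then show ?case by (simp add: comult_simps zero_prod_def zero_list_def)
next
  case (Cons x w)
  have bracket_tensors_le: "word_deg d a + word_deg d b \<le> n" if "t \<in> bracket_tensors d P n" "(a, b) \<in> keys t"
    for t :: "'x list \<times> 'x list \<Rightarrow>\<^sub>0 'k" and P n a b
  proof -
    let ?V = "{t :: 'x list \<times> 'x list \<Rightarrow>\<^sub>0 'k. \<forall>(a, b)\<in>keys t. word_deg d a + word_deg d b \<le> n}"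
    have "pm.subspace ?V"
    proof (rule pm.subspaceI, goal_cases)
      case (2 x y)
      then show ?case using keys_add[of x y] by blast
    next
      case (3 x c)
      then show ?case by (fastforce simp: in_keys_iff lookup_pm_scale)
    qed simp
    then have "bracket_tensors d P n \<subseteq> ?V"
      unfolding bracket_tensors_def by (rule pm.span_minimal[rotated]) (auto simp: keys_tensor word_deg_bracket_prod)
    from subsetD[OF this that(1)] show ?thesis using that(2) by auto
  qed
  have letter: "word_deg d a + word_deg d b \<le> d x" if "(a, b) \<in> keys (\<Delta> (single [x] 1))" for a b
  proof -
    define t where "t = \<Delta> (single [x] 1) - tensor 1 (single [x] 1) - tensor (single [x] 1) 1"
    have "\<Delta> (single [x] 1) = t + tensor 1 (single [x] 1) + tensor (single [x] 1) 1" by (simp add: t_def)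
    then have "(a, b) \<in> keys t \<or> (a, b) \<in> keys (tensor 1 (single [x] (1::'k))) \<or> (a, b) \<in> keys (tensor (single [x] 1) (1 :: 'x list \<Rightarrow>\<^sub>0 'k))"
      using that keys_add[of "t + tensor 1 (single [x] 1)" "tensor (single [x] 1) 1"] keys_add[of t "tensor 1 (single [x] 1)"] by auto
    then show ?thesis using bracket_tensors_le comult_letter[of x, folded t_def]
      by (auto simp: keys_tensor zero_list_def)
  qed
  have "single (x # w) 1 = single [x] 1 * (single w 1 :: 'x list \<Rightarrow>\<^sub>0 'k)" by (simp add: mult_single_list)
  then have "(a, b) \<in> keys (\<Delta> (single [x] 1) * \<Delta> (single w 1))" using Cons.prems by (simp add: comult_simps)
  then obtain a1 b1 a2 b2 where "(a1, b1) \<in> keys (\<Delta> (single [x] 1))" "(a2, b2) \<in> keys (\<Delta> (single w 1))"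
    "a = a1 @ a2" "b = b1 @ b2"
    using keys_mult[of "\<Delta> (single [x] 1)" "\<Delta> (single w 1)"] by (fastforce simp: plus_list_def)
  then show ?case using letter[of a1 b1] Cons.IH[of a2 b2] by simp
qed

end

section \<open>Coproducts modulo products with a factor other than the largest one\<close>

text \<open>
Products of this kind are what the functional used later kills: in the degree of \<open>u\<^sup>s\<close> their leading words
lie below \<open>u\<^sup>s\<close>.
\<close>

definition lex_mixed :: "'x::linorder list \<Rightarrow> 'x list list \<Rightarrow> bool"
  where "lex_mixed u bs \<longleftrightarrow> (\<forall>c\<in>set bs. lex_le c u) \<and> (\<exists>c\<in>set bs. c \<noteq> u)"

definition lex_bounded :: "'x::linorder list \<Rightarrow> 'x list list \<Rightarrow> bool"
  where "lex_bounded u bs \<longleftrightarrow> (\<forall>c\<in>set bs. lex_le c u)"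

lemma lex_mixed_cong_mult:
  assumes "x - x0 \<in> bracket_tensors d (lex_mixed u) n" "x0 \<in> bracket_tensors d (lex_bounded u) n"
    "y - y0 \<in> bracket_tensors d (lex_mixed u) m" "y0 \<in> bracket_tensors d (lex_bounded u) m"
  shows "x * y - x0 * y0 \<in> bracket_tensors d (lex_mixed u) (n + m)"
proof -
  have "x * y - x0 * y0 = (x - x0) * (y - y0) + (x - x0) * y0 + x0 * (y - y0)"
    by (simp add: algebra_simps)
  moreover have "(x - x0) * (y - y0) \<in> bracket_tensors d (lex_mixed u) (n + m)"
    by (rule bracket_tensors_mult[OF assms(1,3)]) (auto simp: lex_mixed_def)
  moreover have "(x - x0) * y0 \<in> bracket_tensors d (lex_mixed u) (n + m)"
    by (rule bracket_tensors_mult[OF assms(1,4)]) (auto simp: lex_mixed_def lex_bounded_def)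
  moreover have "x0 * (y - y0) \<in> bracket_tensors d (lex_mixed u) (n + m)"
    by (rule bracket_tensors_mult[OF assms(2,3)]) (auto simp: lex_mixed_def lex_bounded_def)
  ultimately show ?thesis by (simp add: pm.subspace_add[OF subspace_bracket_tensors])
qed

lemma bracket_tensors_bounded_mult:
  assumes "x \<in> bracket_tensors d (lex_bounded u) n" "y \<in> bracket_tensors d (lex_bounded u) m"
  shows "x * y \<in> bracket_tensors d (lex_bounded u) (n + m)"
  by (rule bracket_tensors_mult[OF assms]) (auto simp: lex_bounded_def)

context triangular_comultiplication
begin

lemma comult_less:
  assumes c: "lyndon c" "lex_less c u"
  shows "\<Delta> (bracket c) - tensor (bracket c) 1 \<in> bracket_tensors d (lex_mixed u) (word_deg d c)"
proof -
  have "\<Delta> (bracket c) - tensor 1 (bracket c) - tensor (bracket c) 1 \<in> bracket_tensors d (lex_mixed u) (word_deg d c)"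
  proof (rule subsetD[OF bracket_tensors_mono comult_lyndon[OF c(1)]])
    show "lex_mixed u bs" if bs: "smaller_factors d c bs" for bs
    proof -
      have "lex_less x u" if "x \<in> set bs" for x
        using that \<open>smaller_factors d c bs\<close> lex_less_trans[OF _ c(2)] by (auto simp: smaller_factors_def)
      note lt = this
      obtain x where x: "x \<in> set bs" using bs by (cases bs) (auto simp: smaller_factors_def)
      have "x \<noteq> u" using lt[OF x] by auto
      then show ?thesis using lt x by (auto simp: lex_mixed_def lex_le_def)
    qed
  qed
  moreover have "tensor 1 (bracket c) \<in> bracket_tensors d (lex_mixed u) (word_deg d c)"
    using c by (intro bracket_tensors_one_bracket) (auto simp: lex_mixed_def lex_le_def)
  ultimately show ?thesis
    using pm.subspace_add[OF subspace_bracket_tensors] by (fastforce simp: algebra_simps)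
qed

lemma comult_less_prod:
  assumes "\<forall>c\<in>set us. lyndon c \<and> lex_less c u"
  shows "\<Delta> (bracket_prod us) - tensor (bracket_prod us) 1 \<in> bracket_tensors d (lex_mixed u) (word_deg d (concat us))"
  using assms
proof (induction us)
  case Nil
  then show ?case by (simp add: comult_simps pm.subspace_0[OF subspace_bracket_tensors])
next
  case (Cons c us)
  have "\<Delta> (bracket c) * \<Delta> (bracket_prod us) - tensor (bracket c) 1 * tensor (bracket_prod us) 1
      \<in> bracket_tensors d (lex_mixed u) (word_deg d c + word_deg d (concat us))"
    using Cons by (intro lex_mixed_cong_mult comult_less bracket_tensors_bracket_one bracket_tensors_bracket_one') (auto simp: lex_bounded_def)
  then show ?case by (simp add: comult_simps tensor_mult)
qed

text \<open>
The second conjunct is carried along because congruences can only be multiplied when the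
representatives are bounded by \<open>u\<close> as well.
\<close>

lemma comult_power:
  assumes u: "lyndon u"
  shows "\<Delta> (bracket u ^ r) - (tensor (bracket u) 1 + tensor 1 (bracket u)) ^ r \<in> bracket_tensors d (lex_mixed u) (r * word_deg d u)
    \<and> (tensor (bracket u) 1 + tensor 1 (bracket u)) ^ r \<in> (bracket_tensors d (lex_bounded u) (r * word_deg d u) :: ('x list \<times> 'x list \<Rightarrow>\<^sub>0 'k) set)"
proof (induction r)
  case 0
  have "tensor (bracket_prod []) 1 \<in> (bracket_tensors d (lex_bounded u) (word_deg d (concat [])) :: ('x list \<times> 'x list \<Rightarrow>\<^sub>0 'k) set)"
    by (rule bracket_tensors_bracket_one) (simp add: lex_bounded_def)
  then have "(1 :: 'x list \<times> 'x list \<Rightarrow>\<^sub>0 'k) \<in> bracket_tensors d (lex_bounded u) 0"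
    by (simp only: bracket_prod_simps tensor_one concat.simps word_deg_simps)
  then show ?case by (simp add: comult_simps(1) pm.subspace_0[OF subspace_bracket_tensors])
next
  case (Suc r)
  let ?E = "tensor (bracket u) 1 + tensor 1 (bracket u) :: 'x list \<times> 'x list \<Rightarrow>\<^sub>0 'k"
  have "smaller_factors d u bs \<Longrightarrow> lex_mixed u bs" for bs
    by (auto simp: smaller_factors_def lex_mixed_def lex_le_def neq_Nil_conv)
  then have E: "\<Delta> (bracket u) - ?E \<in> bracket_tensors d (lex_mixed u) (word_deg d u)"
    using comult_lyndon[OF u] bracket_tensors_mono[of "smaller_factors d u" "lex_mixed u"]
    by (fastforce simp: algebra_simps)
  have E2: "?E \<in> bracket_tensors d (lex_bounded u) (word_deg d u)"
    using u by (intro pm.subspace_add subspace_bracket_tensors bracket_tensors_one_bracket bracket_tensors_bracket_one')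
      (auto simp: lex_bounded_def)
  show ?case
    using lex_mixed_cong_mult[OF E E2 conjunct1[OF Suc] conjunct2[OF Suc]] bracket_tensors_bounded_mult[OF E2 conjunct2[OF Suc]]
    by (simp add: comult_simps)
qed

end

section \<open>Evaluating the second tensor factor\<close>

text \<open>
The map \<open>id \<otimes> l\<close>, for the linear functional \<open>l\<close> given by its values on the basis of the second factor.
\<close>

definition contract :: "('b \<Rightarrow> 'k) \<Rightarrow> ('a \<times> 'b \<Rightarrow>\<^sub>0 'k::field) \<Rightarrow> ('a \<Rightarrow>\<^sub>0 'k)"
  where "contract l t = (\<Sum>ab\<in>keys t. single (fst ab) (lookup t ab * l (snd ab)))"

lemma contract_add: "contract l (s + t) = contract l s + contract l t"
  unfolding contract_def
  by (rule setsum_keys_plus_distrib[where f = "\<lambda>ab x. single (fst ab) (x * l (snd ab))"])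
    (simp_all add: single_add distrib_right)

lemma contract_scale: "contract l (pm_scale c t) = pm_scale c (contract l t)"
proof (cases "c = 0")
  case True
  then show ?thesis by (simp add: contract_def)
next
  case False
  then have "keys (pm_scale c t) = keys t" by (auto simp: in_keys_iff lookup_pm_scale)
  moreover have "pm_scale c (single a x) = single a (c * x)" for a :: 'a and x
    by (rule poly_mapping_eqI) (simp add: lookup_pm_scale lookup_single when_def)
  ultimately show ?thesis
    by (simp add: contract_def pm.scale_sum_right lookup_pm_scale mult.assoc)
qed

lemma contract_tensor:
  fixes f :: "('b \<Rightarrow>\<^sub>0 'k::field) \<Rightarrow> 'k"
  assumes "Vector_Spaces.linear pm_scale (*) f"
  shows "contract (\<lambda>b. f (single b 1)) (tensor p q) = pm_scale (f q) p"
proof (induction p rule: pm_induct)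
  case (single a)
  interpret f: Vector_Spaces.linear pm_scale "(*)" f by (fact assms)
  show ?case
  proof (induction q rule: pm_induct)
    case (single b)
    have "pm_scale c (single a 1) = single a c" for c :: 'k
      by (rule poly_mapping_eqI) (simp add: lookup_pm_scale lookup_single when_def)
    then show ?case by (simp add: tensor_single contract_def)
  qed (simp_all add: tensor_linear contract_add contract_scale f.add f.scale pm.scale_left_distrib)
qed (simp_all add: tensor_linear contract_add contract_scale pm.scale_right_distrib mult.commute)

section \<open>Reducible words and divided derivatives\<close>

locale triangular_quotient = triangular_comultiplication d \<Delta>
  for d :: "'x::wellorder \<Rightarrow> nat"
    and \<Delta> :: "('x list \<Rightarrow>\<^sub>0 'k::field) \<Rightarrow> ('x list \<times> 'x list \<Rightarrow>\<^sub>0 'k)" +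
  fixes I :: "('x list \<Rightarrow>\<^sub>0 'k) set"
  assumes ideal: "ideal I class_ring"
    and comult_ideal: "\<Delta> ` I \<subseteq> tensor_space UNIV I + tensor_space I UNIV"
begin

lemma ideal_mult_left: "p \<in> I \<Longrightarrow> q * p \<in> I" and ideal_mult_right: "p \<in> I \<Longrightarrow> p * q \<in> I"
  using ideal.I_l_closed[OF ideal, of p q] ideal.I_r_closed[OF ideal, of p q] by auto

lemma subspace_ideal: "pm.subspace I"
proof (rule pm.subspaceI)
  interpret ideal I class_ring by (fact ideal)
  show "0 \<in> I" using zero_closed by simp
  show "x + y \<in> I" if "x \<in> I" "y \<in> I" for x y using a_closed[OF that] by simp
  show "pm_scale c x \<in> I" if "x \<in> I" for c x using ideal_mult_left[OF that] by (simp add: pm_scale_eq_mult)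
qed

lemma glex_less_append:
  assumes "glex_less d w x"
  shows "glex_less d (a @ w @ b) (a @ x @ b)"
proof (cases "word_deg d w < word_deg d x")
  case True
  then show ?thesis by (simp add: glex_less_def)
next
  case False
  then have w: "word_deg d w = word_deg d x" "lex_less w x" using assms by (auto simp: glex_less_def)
  have "\<not> (\<exists>s. s \<noteq> [] \<and> w = x @ s)" using w(1) by auto
  then have "lex_less (w @ b) (x @ b)" using lex_less_dichotomy[OF w(2)] by blast
  then show ?thesis using w by (simp add: glex_less_def)
qed

text \<open>
The ideal is two-sided and the graded order is compatible with concatenation on both sides, the degree
excluding the case of a proper prefix.
\<close>

lemma reducible_append:
  assumes "reducible d I x"
  shows "reducible d I (a @ x @ b)"
proof -
  obtain p where p: "p \<in> I" "x \<in> keys p" "\<And>u. u \<in> keys p \<Longrightarrow> u \<noteq> x \<Longrightarrow> glex_less d u x"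
    using assms unfolding reducible_def is_leading_word_def by blast
  define q where "q = single a 1 * p * single b 1"
  have q: "q = (\<Sum>w\<in>keys p. pm_scale (lookup p w) (single (a @ w @ b) 1))"
    unfolding q_def by (rule single_mult_single_expansion)
  have "lookup q (a @ x @ b) = (\<Sum>w\<in>keys p. if w = x then lookup p w else 0)"
    unfolding q lookup_sum by (intro sum.cong) (auto simp: lookup_pm_scale lookup_single when_def)
  then have "lookup q (a @ x @ b) = lookup p x" using p(2) by simp
  then have lead: "a @ x @ b \<in> keys q" using p(2) by (simp add: in_keys_iff)
  moreover have "glex_less d u (a @ x @ b)" if "u \<in> keys q" "u \<noteq> a @ x @ b" for u
  proof -
    from that(1) have "(\<Sum>w\<in>keys p. lookup (pm_scale (lookup p w) (single (a @ w @ b) 1)) u) \<noteq> 0"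
      unfolding q by (simp add: in_keys_iff lookup_sum)
    then obtain w where "w \<in> keys p" "lookup (pm_scale (lookup p w) (single (a @ w @ b) (1::'k))) u \<noteq> 0"
      by (meson sum.neutral)
    then have "w \<in> keys p" "u = a @ w @ b" by (auto simp: lookup_pm_scale lookup_single when_def split: if_splits)
    then show ?thesis using p(3) that(2) glex_less_append by blast
  qed
  moreover have "q \<in> I" unfolding q_def using p(1) ideal_mult_left ideal_mult_right by blast
  ultimately show ?thesis unfolding reducible_def is_leading_word_def by blast
qed

lemma irreducible_factor: "\<not> reducible d I (a @ x @ b) \<Longrightarrow> \<not> reducible d I x"
  using reducible_append by blast

lemma irreducible_concat_factor:
  assumes "\<not> reducible d I (concat bs)" "c \<in> set bs" shows "\<not> reducible d I c"
proof -
  obtain xs ys where "bs = xs @ c # ys" using assms(2) by (metis split_list)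
  then have "concat bs = concat xs @ c @ concat ys" by simp
  then show ?thesis using assms(1) irreducible_factor by metis
qed

text \<open>
A word \<open>u\<close> is irreducible iff it is not in the sum of \<open>I\<close> and the span \<open>L\<close> of the smaller words, so a
functional that vanishes on this sum can be prescribed at \<open>u\<close>.
\<close>

lemma irreducible_functional:
  assumes irr: "\<not> reducible d I u"
  obtains f where "Vector_Spaces.linear pm_scale (*) f" "\<And>p. p \<in> I \<Longrightarrow> f p = 0"
    "\<And>w. glex_less d w u \<Longrightarrow> f (single w 1) = 0" "f (single u 1) = 1"
proof -
  interpret vp: vector_space_pair "pm_scale :: 'k \<Rightarrow> ('x list \<Rightarrow>\<^sub>0 'k) \<Rightarrow> _" "(*) :: 'k \<Rightarrow> 'k \<Rightarrow> 'k"
    by unfold_locales (auto simp: algebra_simps)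
  define L where "L = {q :: 'x list \<Rightarrow>\<^sub>0 'k. \<forall>w\<in>keys q. glex_less d w u}"
  have L: "pm.subspace L"
  proof (rule pm.subspaceI)
    show "0 \<in> L" by (simp add: L_def)
    show "x + y \<in> L" if "x \<in> L" "y \<in> L" for x y using that keys_add[of x y] by (auto simp: L_def)
    show "pm_scale c x \<in> L" if "x \<in> L" for x c
      using that by (auto simp: L_def in_keys_iff lookup_pm_scale)
  qed
  have notin: "single u 1 \<notin> pm.span (I \<union> L)"
  proof
    assume "single u 1 \<in> pm.span (I \<union> L)"
    then obtain p q where pq: "p \<in> I" "q \<in> L" "single u 1 = p + q"
      using subspace_ideal L by (auto simp: pm.span_Un pm.span_eq_iff[THEN iffD2])
    have p: "p = single u 1 - q" using pq(3) by simp
    have "u \<notin> keys q" using pq(2) by (auto simp: L_def)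
    then have "is_leading_word d p u" using pq(2) unfolding is_leading_word_def p L_def
      by (auto simp: in_keys_iff lookup_minus lookup_single when_def split: if_splits)
    then show False using irr pq(1) by (auto simp: reducible_def)
  qed
  obtain B where B: "B \<subseteq> I \<union> L" "pm.independent B" "I \<union> L \<subseteq> pm.span B"
    using pm.maximal_independent_subset[of "I \<union> L"] by metis
  have "pm.span (I \<union> L) \<subseteq> pm.span B" using B(3) by (simp add: pm.span_minimal)
  have "single u 1 \<notin> pm.span B" using notin B(1) pm.span_mono by blast
  then have ind: "pm.independent (insert (single u 1) B)" using B(2) by (rule pm.independent_insertI)
  have uB: "single u 1 \<notin> B" using \<open>single u 1 \<notin> pm.span B\<close> pm.span_base by blast
  obtain f where f: "Vector_Spaces.linear pm_scale (*) f"
    "\<forall>x\<in>insert (single u 1) B. f x = (if x = single u 1 then 1 else (0::'k))"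
    using vp.linear_independent_extend[OF ind, of "\<lambda>x. if x = single u 1 then 1 else 0"] by blast
  have f0: "f x = 0" if "x \<in> I \<union> L" for x
    by (rule vp.linear_eq_0_on_span[OF f(1), of B]) (use f(2) uB B(3) that in auto)
  show ?thesis
  proof (rule that[OF f(1)])
    show "f p = 0" if "p \<in> I" for p using f0 that by blast
    show "f (single w 1) = 0" if "glex_less d w u" for w
      by (rule f0) (use that in \<open>simp add: L_def\<close>)
    show "f (single u 1) = 1" using f(2) by simp
  qed
qed

text \<open>
Polynomials of degree below \<open>n - k\<close>, written without truncated subtraction.
\<close>

definition shifted_lower :: "nat \<Rightarrow> nat \<Rightarrow> ('x list \<Rightarrow>\<^sub>0 'k) set"
  where "shifted_lower k n = {p. \<forall>w\<in>keys p. word_deg d w + k < n}"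

lemma subspace_shifted_lower: "pm.subspace (shifted_lower k n)"
proof (rule pm.subspaceI)
  show "0 \<in> shifted_lower k n" by (simp add: shifted_lower_def)
  show "x + y \<in> shifted_lower k n" if "x \<in> shifted_lower k n" "y \<in> shifted_lower k n" for x y
    using that keys_add[of x y] by (auto simp: shifted_lower_def)
  show "pm_scale c x \<in> shifted_lower k n" if "x \<in> shifted_lower k n" for x c
    using that by (auto simp: shifted_lower_def in_keys_iff lookup_pm_scale)
qed

text \<open>
The map \<open>\<theta>\<close> evaluates the second factor of \<open>\<Delta>\<close> with a functional attached to the irreducible word \<open>u\<^sup>s\<close>. In
\<open>\<Delta>(p [u]\<^sup>r)\<close> the relevant terms are \<open>(r choose j) p [u]\<^sup>r\<^sup>-\<^sup>j \<otimes> [u]\<^sup>j\<close>: for \<open>j < s\<close> the functional vanishes by degree, for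
\<open>j > s\<close> the first factor has too small a degree to matter, and for \<open>j = s\<close> the functional is \<open>1\<close>.
\<close>

lemma divided_derivative_exists:
  assumes u: "lyndon u" and irr: "\<not> reducible d I (concat (replicate s u))"
  obtains \<theta> where
    "\<And>p q. \<theta> (p + q) = \<theta> p + \<theta> q" "\<And>c p. \<theta> (pm_scale c p) = pm_scale c (\<theta> p)"
    "\<And>p. p \<in> I \<Longrightarrow> \<theta> p \<in> I"
    "\<And>us r. \<forall>c\<in>set us. lyndon c \<and> lex_less c u \<Longrightarrow>
      \<theta> (bracket_prod us * bracket u ^ r) - pm_scale (of_nat (r choose s)) (bracket_prod us * bracket u ^ (r - s))
        \<in> shifted_lower (s * word_deg d u) (word_deg d (concat us) + r * word_deg d u)"
    "\<And>p n. \<forall>w\<in>keys p. word_deg d w < n \<Longrightarrow> \<theta> p \<in> shifted_lower (s * word_deg d u) n"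
proof -
  let ?us = "concat (replicate s u)" and ?k = "s * word_deg d u"
  obtain f where f: "Vector_Spaces.linear pm_scale (*) f" "\<And>p. p \<in> I \<Longrightarrow> f p = 0"
    "\<And>w. glex_less d w ?us \<Longrightarrow> f (single w 1) = 0" "f (single ?us 1) = 1"
    using irreducible_functional[OF irr] by blast
  interpret f: Vector_Spaces.linear pm_scale "(*)" f by (fact f(1))
  define l where "l = (\<lambda>b. f (single b 1))"
  note ct = contract_tensor[OF f(1), folded l_def]
  have f_zero: "f q = 0" if "\<And>w. w \<in> keys q \<Longrightarrow> glex_less d w ?us" for q
  proof -
    have "f q = f (\<Sum>w\<in>keys q. pm_scale (lookup q w) (single w 1))" using pm_expansion[of q] by simp
    also have "\<dots> = 0" using that f(3) by (simp add: f.sum f.scale)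
    finally show ?thesis .
  qed
  have f_deg: "f (bracket_prod bs) = 0" if "word_deg d (concat bs) < ?k" for bs
    by (rule f_zero) (use that word_deg_bracket_prod in \<open>fastforce simp: glex_less_def\<close>)
  \<comment> \<open>In the degree of \<open>u\<^sup>s\<close>, a product with a factor other than \<open>u\<close> has its leading word below \<open>u\<^sup>s\<close>.\<close>
  have f_mixed: "f (bracket_prod bs) = 0"
    if bs: "lex_mixed u bs" "\<forall>b\<in>set bs. lyndon b" "word_deg d (concat bs) = ?k" for bs
  proof -
    have le: "lex_le (concat bs) ?us"
    proof (rule suffixes_le_imp_le_power)
      show "lex_le t u" if "concat bs = s' @ t" "t \<noteq> []" for s' t
        using concat_lyndon_suffix_le[of bs u s' t] bs that by (auto simp: lex_mixed_def)
      show "z = []" if "?us = concat bs @ z" for z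
        using arg_cong[OF that, of "word_deg d"] bs(3) by simp
    qed
    have "concat bs \<noteq> ?us"
    proof
      assume "concat bs = ?us"
      then have "bs = replicate s u"
        using concat_lyndon_eq_power[OF _ u] bs by (auto simp: lex_mixed_def)
      then show False using bs(1) by (auto simp: lex_mixed_def)
    qed
    with le have less: "lex_less (concat bs) ?us" by (simp add: lex_le_def)
    show ?thesis
    proof (rule f_zero)
      fix w assume w: "w \<in> keys (bracket_prod bs :: 'x list \<Rightarrow>\<^sub>0 'k)"
      then have "lex_less w ?us"
        using monic_at_keys[OF monic_at_bracket_prod w] less lex_less_trans[OF _ less] by auto
      then show "glex_less d w ?us" using word_deg_bracket_prod[OF w, of d] bs(3) by (simp add: glex_less_def)
    qed
  qed
  have c_tens: "contract l t \<in> shifted_lower ?k n" if "t \<in> bracket_tensors d (lex_mixed u) n" for t n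
  proof -
    have "contract l t \<in> pm.span (shifted_lower ?k n)"
      using that unfolding bracket_tensors_def
    proof (rule span_induct_linear, goal_cases)
      case (1 x)
      then consider (1) a bs where "x = tensor (single a 1) (bracket_prod bs)" "lex_mixed u bs"
          "\<forall>b\<in>set bs. lyndon b" "word_deg d a + word_deg d (concat bs) = n"
        | (2) a b where "x = single (a, b) 1" "word_deg d a + word_deg d b < n" by blast
      then show ?case
      proof cases
        case (1 a bs)
        have c: "contract l x = pm_scale (f (bracket_prod bs)) (single a 1)" using 1 by (simp add: ct)
        show ?thesis
        proof (cases "word_deg d (concat bs) > ?k")
          case True
          then have "single a 1 \<in> shifted_lower ?k n" using 1 by (simp add: shifted_lower_def)
          then show ?thesis unfolding c by (intro pm.span_scale pm.span_base)
        next
          case False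
          then have "f (bracket_prod bs) = 0" using f_deg f_mixed 1 by (meson linorder_neqE_nat)
          then show ?thesis by (simp add: c pm.span_zero)
        qed
      next
        case (2 a b)
        have "x = tensor (single a 1) (single b 1)" using 2 by (simp add: tensor_single)
        then have c: "contract l x = pm_scale (f (single b 1)) (single a 1)" by (simp add: ct)
        show ?thesis
        proof (cases "word_deg d b < ?k")
          case True
          then have "f (single b 1) = 0" by (intro f(3)) (simp add: glex_less_def)
          then show ?thesis by (simp add: c pm.span_zero)
        next
          case False
          then have "single a 1 \<in> shifted_lower ?k n" using 2 by (simp add: shifted_lower_def)
          then show ?thesis unfolding c by (intro pm.span_scale pm.span_base)
        qed
      qed
    qed (simp_all add: contract_add contract_scale)
    then show ?thesis using pm.span_eq_iff[THEN iffD2, OF subspace_shifted_lower] by blast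
  qed
  define \<theta> where "\<theta> p = contract l (\<Delta> p)" for p
  show ?thesis
  proof
    show "\<theta> (p + q) = \<theta> p + \<theta> q" "\<theta> (pm_scale c p) = pm_scale c (\<theta> p)" for p q c
      by (simp_all add: \<theta>_def comult_simps contract_add contract_scale)
    show "\<theta> p \<in> I" if "p \<in> I" for p
    proof -
      have "\<Delta> p \<in> tensor_space UNIV I + tensor_space I UNIV" using comult_ideal that by blast
      then obtain t t' where t: "\<Delta> p = t + t'" "t \<in> tensor_space UNIV I" "t' \<in> tensor_space I UNIV"
        by (auto elim!: set_plus_elim)
      have "contract l t \<in> pm.span I" using t(2) unfolding tensor_space_def
        by (rule span_induct_linear) (auto simp: ct f(2) contract_add contract_scale pm.span_zero)
      moreover have "contract l t' \<in> pm.span I" using t(3) unfolding tensor_space_def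
        by (rule span_induct_linear) (auto simp: ct contract_add contract_scale pm.span_base pm.span_scale)
      ultimately show ?thesis
        using pm.span_eq_iff[THEN iffD2, OF subspace_ideal] pm.span_add
        by (metis \<theta>_def contract_add t(1))
    qed
    show "\<theta> p \<in> shifted_lower ?k n" if "\<forall>w\<in>keys p. word_deg d w < n" for p n
    proof -
      have "pm.subspace {p. \<Delta> p \<in> bracket_tensors d (lex_mixed u) n}"
        using pm.subspace_0[OF subspace_bracket_tensors] pm.subspace_add[OF subspace_bracket_tensors] pm.subspace_scale[OF subspace_bracket_tensors]
          comult_simps(4)[of 0 0]
        by (intro pm.subspaceI) (auto simp: comult_simps)
      then have "p \<in> {p. \<Delta> p \<in> bracket_tensors d (lex_mixed u) n}"
        by (rule pm_mem_subspace) (use that comult_word_deg in \<open>force intro!: bracket_tensors_lower dest: le_less_trans\<close>)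
      then show ?thesis unfolding \<theta>_def by (intro c_tens) simp
    qed
    fix us r assume us: "\<forall>c\<in>set us. lyndon c \<and> lex_less c u"
    let ?P = "bracket_prod us :: 'x list \<Rightarrow>\<^sub>0 'k" and ?b = "bracket u :: 'x list \<Rightarrow>\<^sub>0 'k"
    let ?n = "word_deg d (concat us) + r * word_deg d u"
    let ?E = "tensor ?b 1 + tensor 1 ?b"
    have "\<Delta> (?P * ?b ^ r) - tensor ?P 1 * ?E ^ r \<in> bracket_tensors d (lex_mixed u) ?n"
      unfolding comult_simps
      using comult_power[OF u, of r] us
      by (intro lex_mixed_cong_mult comult_less_prod bracket_tensors_bracket_one) (auto simp: lex_bounded_def)
    from c_tens[OF this]
    have 1: "\<theta> (?P * ?b ^ r) - contract l (tensor ?P 1 * ?E ^ r) \<in> shifted_lower ?k ?n"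
      using contract_add[of l "\<Delta> (?P * ?b ^ r) - tensor ?P 1 * ?E ^ r" "tensor ?P 1 * ?E ^ r"]
      by (simp add: \<theta>_def algebra_simps)
    have b_pow: "?b ^ j = bracket_prod (replicate j u)" for j by (induction j) auto
    have contract_sum: "contract l (sum g A) = (\<Sum>x\<in>A. contract l (g x))" for g :: "nat \<Rightarrow> _" and A
      using contract_scale[of l 0 0] by (induction A rule: infinite_finite_induct) (auto simp: contract_add)
    have 2: "contract l (tensor ?P 1 * ?E ^ r) =
        (\<Sum>j\<le>r. pm_scale (of_nat (r choose j) * f (?b ^ j)) (?P * ?b ^ (r - j)))"
      by (simp add: tensor_power_binomial sum_distrib_left tensor_mult contract_sum contract_scale ct mult.commute)
    define g where "g j = pm_scale (of_nat (r choose j) * f (?b ^ j)) (?P * ?b ^ (r - j))" for j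
    have fs: "f (?b ^ s) = 1"
    proof -
      have "f (bracket_prod (replicate s u) - single ?us 1) = 0"
        by (rule f_zero) (use monic_at_bracket_prod[of "replicate s u", where 'b = 'k] word_deg_mset[of _ ?us d] in \<open>auto simp: monic_at_def glex_less_def\<close>)
      then show ?thesis using f(4) by (simp add: f.diff b_pow)
    qed
    have g_low: "g j \<in> shifted_lower ?k ?n" if "j \<noteq> s" "j \<le> r" for j
    proof (cases "j < s")
      case True
      then have "word_deg d (concat (replicate j u)) < ?k"
        using lyndon_nonempty[OF u] by simp
      then have "f (?b ^ j) = 0" unfolding b_pow by (rule f_deg)
      then show ?thesis by (simp add: g_def pm.subspace_0[OF subspace_shifted_lower])
    next
      case False
      with that have "s < j" by simp
      have "?P * ?b ^ (r - j) \<in> shifted_lower ?k ?n"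
        unfolding shifted_lower_def
      proof safe
        fix w assume w: "w \<in> keys (?P * ?b ^ (r - j))"
        have "?P * ?b ^ (r - j) = bracket_prod (us @ replicate (r - j) u)" by (simp add: b_pow)
        with w have "word_deg d w = word_deg d (concat us) + (r - j) * word_deg d u"
          using word_deg_bracket_prod[of w "us @ replicate (r - j) u" d] by simp
        moreover have "(r - j + s) * word_deg d u < r * word_deg d u"
          using \<open>s < j\<close> \<open>j \<le> r\<close> lyndon_nonempty[OF u] by (intro mult_strict_right_mono) auto
        ultimately show "word_deg d w + ?k < ?n" by (simp add: algebra_simps)
      qed
      then show ?thesis unfolding g_def by (rule pm.subspace_scale[OF subspace_shifted_lower])
    qed
    have 3: "(\<Sum>j\<le>r. g j) - pm_scale (of_nat (r choose s)) (?P * ?b ^ (r - s)) \<in> shifted_lower ?k ?n"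
    proof (cases "s \<le> r")
      case True
      then have "(\<Sum>j\<le>r. g j) = g s + (\<Sum>j\<in>{..r} - {s}. g j)" by (intro sum.remove) auto
      moreover have "g s = pm_scale (of_nat (r choose s)) (?P * ?b ^ (r - s))" by (simp add: g_def fs)
      moreover have "(\<Sum>j\<in>{..r} - {s}. g j) \<in> shifted_lower ?k ?n"
        using g_low by (intro pm.subspace_sum subspace_shifted_lower) auto
      ultimately show ?thesis by simp
    next
      case False
      then have "(\<Sum>j\<le>r. g j) \<in> shifted_lower ?k ?n"
        using g_low by (intro pm.subspace_sum subspace_shifted_lower) auto
      then show ?thesis using False by (simp add: binomial_eq_0)
    qed
    show "\<theta> (?P * ?b ^ r) - pm_scale (of_nat (r choose s)) (?P * ?b ^ (r - s)) \<in> shifted_lower ?k ?n"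
      using pm.subspace_add[OF subspace_shifted_lower 1 3[folded 2[folded g_def]]] unfolding 2 g_def
      by (simp add: algebra_simps)
  qed
qed

text \<open>
A combination of monic polynomials with distinct leading words of equal degree keeps the
largest of these words as its leading word, whatever is added in lower degree.
\<close>

lemma leading_reducible:
  assumes f: "f \<in> I" and W: "finite W" "w0 \<in> W" and inj: "inj_on v W"
    and q: "\<And>w. w \<in> W \<Longrightarrow> monic_at (v w) (q w) \<and> word_deg d (v w) = m \<and> c w \<noteq> 0"
    and low: "\<And>a. a \<in> keys (f - (\<Sum>w\<in>W. pm_scale (c w) (q w))) \<Longrightarrow> word_deg d a < m"
    and max: "\<And>w. w \<in> W \<Longrightarrow> lex_le (v w) (v w0)"
  shows "reducible d I (v w0)"
proof -
  define h where "h = (\<Sum>w\<in>W. pm_scale (c w) (q w))"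
  have lq: "lookup (q w) (v w0) = (if w = w0 then 1 else 0)" if w: "w \<in> W" for w
  proof (cases "w = w0")
    case True
    then show ?thesis using q[OF w] monic_at_lookup by auto
  next
    case False
    then have "lex_less (v w) (v w0)" using max[OF w] inj w W(2) by (auto simp: lex_le_def inj_on_def)
    moreover have "lex_le (v w0) (v w)" if "v w0 \<in> keys (q w)"
      using monic_at_keys[OF conjunct1[OF q[OF w]] that] by (auto simp: lex_le_def)
    ultimately have "v w0 \<notin> keys (q w)" using lex.leD by blast
    then show ?thesis using False by (simp add: in_keys_iff)
  qed
  have "lookup h (v w0) = (\<Sum>w\<in>W. if w = w0 then c w else 0)"
    unfolding h_def lookup_sum lookup_pm_scale by (intro sum.cong) (auto simp: lq)
  then have hv: "lookup h (v w0) = c w0" using W by simp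
  have "v w0 \<notin> keys (f - h)" using low q[OF W(2)] unfolding h_def by blast
  then have "lookup f (v w0) = c w0" using hv by (simp add: in_keys_iff lookup_minus)
  then have "v w0 \<in> keys f" using q[OF W(2)] by (simp add: in_keys_iff)
  moreover have "glex_less d a (v w0)" if a: "a \<in> keys f" "a \<noteq> v w0" for a
  proof -
    have "a \<in> keys (f - h) \<or> a \<in> keys h" using a(1) by (auto simp: in_keys_iff lookup_minus)
    then show ?thesis
    proof
      assume "a \<in> keys (f - h)"
      then have "word_deg d a < m" using low unfolding h_def by blast
      then show ?thesis using q[OF W(2)] by (simp add: glex_less_def)
    next
      assume "a \<in> keys h"
      then obtain w where w: "w \<in> W" "lookup (pm_scale (c w) (q w)) a \<noteq> 0"
        unfolding h_def in_keys_iff lookup_sum by (meson sum.neutral)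
      then have "a \<in> keys (q w)" by (auto simp: lookup_pm_scale in_keys_iff)
      from monic_at_keys[OF conjunct1[OF q[OF w(1)]] this]
      have aw: "word_deg d a = m" "lex_le a (v w)"
        using q[OF w(1)] word_deg_mset[of a "v w" d] by (auto simp: lex_le_def)
      moreover have "lex_le a (v w0)" using lex.order_trans[OF aw(2) max[OF w(1)]] .
      ultimately show ?thesis using a(2) q[OF W(2)] by (auto simp: glex_less_def lex_le_def)
    qed
  qed
  ultimately show ?thesis using f unfolding reducible_def is_leading_word_def by blast
qed

lemma some_reducible:
  assumes f: "f \<in> I" and W: "finite W" "W \<noteq> {}" and inj: "inj_on v W"
    and q: "\<And>w. w \<in> W \<Longrightarrow> monic_at (v w) (q w) \<and> word_deg d (v w) = m \<and> c w \<noteq> 0"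
    and low: "\<And>a. a \<in> keys (f - (\<Sum>w\<in>W. pm_scale (c w) (q w))) \<Longrightarrow> word_deg d a < m"
  shows "\<exists>w\<in>W. reducible d I (v w)"
proof -
  obtain w0 where "w0 \<in> W" "\<And>w. w \<in> W \<Longrightarrow> lex_le (v w) (v w0)"
    using lex_max_exists[of "v ` W"] W by auto
  then show ?thesis using leading_reducible[OF f W(1) _ inj q low] by blast
qed

text \<open>
Apply \<open>\<theta>\<close> to the relation \<open>f\<close>. The part \<open>g\<close> has no factor \<open>u\<close> and disappears in lower degree as \<open>s > 0\<close>. Each
word \<open>w\<close> with coefficient \<open>c w\<close> loses \<open>s\<close> copies of \<open>u\<close> from its end and acquires the coefficient
\<open>c w (r w choose s)\<close>; the word can be recovered from what is left, so no cancellation occurs.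
\<close>

lemma divided_derivative_reducible:
  assumes f: "f \<in> I" and u: "lyndon u" and s: "s > 0"
    and irr: "\<not> reducible d I (concat (replicate s u))"
    and W: "finite W" and w0: "w0 \<in> W" "c w0 * of_nat (r w0 choose s) \<noteq> 0"
    and fac: "\<And>w. w \<in> W \<Longrightarrow> (\<forall>a\<in>set (us w). lyndon a \<and> lex_less a u) \<and>
        concat (us w) @ concat (replicate (r w) u) = w \<and> word_deg d w = n"
    and g: "g \<in> bracket_span d (\<lambda>bs. \<forall>a\<in>set bs. lyndon a \<and> lex_less a u) n"
    and low: "\<And>a. a \<in> keys (f - g - (\<Sum>w\<in>W. pm_scale (c w) (bracket_prod (us w) * bracket u ^ r w))) \<Longrightarrow>
        word_deg d a < n"
  shows "\<exists>w\<in>W. s \<le> r w \<and> reducible d I (concat (us w) @ concat (replicate (r w - s) u))"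
proof -
  let ?k = "s * word_deg d u"
  obtain \<theta> where th:
    "\<And>p q. \<theta> (p + q) = \<theta> p + \<theta> q" "\<And>c p. \<theta> (pm_scale c p) = pm_scale c (\<theta> p)"
    "\<And>p. p \<in> I \<Longrightarrow> \<theta> p \<in> I"
    "\<And>us r. \<forall>c\<in>set us. lyndon c \<and> lex_less c u \<Longrightarrow>
      \<theta> (bracket_prod us * bracket u ^ r) - pm_scale (of_nat (r choose s)) (bracket_prod us * bracket u ^ (r - s))
        \<in> shifted_lower ?k (word_deg d (concat us) + r * word_deg d u)"
    "\<And>p n. \<forall>w\<in>keys p. word_deg d w < n \<Longrightarrow> \<theta> p \<in> shifted_lower ?k n"
    by (rule divided_derivative_exists[OF u irr]) (rule that)
  note sub = subspace_shifted_lower[of ?k n]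
  define q where "q w = (bracket_prod (us w) * bracket u ^ (r w - s) :: 'x list \<Rightarrow>\<^sub>0 'k)" for w
  define h where "h = (\<Sum>w\<in>W. pm_scale (c w) (bracket_prod (us w) * bracket u ^ r w))"
  have th_sum: "\<theta> (sum F A) = (\<Sum>x\<in>A. \<theta> (F x))" for F :: "'x list \<Rightarrow> _" and A
    using th(2)[of 0 0] by (induction A rule: infinite_finite_induct) (auto simp: th(1))
  have "\<theta> g \<in> pm.span (shifted_lower ?k n)" using g unfolding bracket_span_def
  proof (rule span_induct_linear)
    fix x :: "'x list \<Rightarrow>\<^sub>0 'k"
    assume "x \<in> {bracket_prod bs | bs. (\<forall>a\<in>set bs. lyndon a \<and> lex_less a u) \<and> word_deg d (concat bs) = n}"
    then obtain bs where "x = bracket_prod bs" "\<forall>a\<in>set bs. lyndon a \<and> lex_less a u" "word_deg d (concat bs) = n"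
      by blast
    then show "\<theta> x \<in> pm.span (shifted_lower ?k n)"
      using th(4)[of bs 0] s by (auto simp: binomial_eq_0 intro!: pm.span_base)
  qed (simp_all add: th)
  then have tg: "\<theta> g \<in> shifted_lower ?k n" using pm.span_eq_iff[THEN iffD2, OF sub] by blast
  have tl: "\<theta> (f - g - h) \<in> shifted_lower ?k n" by (rule th(5)) (use low h_def in blast)
  have th_h: "\<theta> h - (\<Sum>w\<in>W. pm_scale (c w * of_nat (r w choose s)) (q w)) \<in> shifted_lower ?k n"
  proof -
    have "\<theta> h - (\<Sum>w\<in>W. pm_scale (c w * of_nat (r w choose s)) (q w)) =
        (\<Sum>w\<in>W. pm_scale (c w) (\<theta> (bracket_prod (us w) * bracket u ^ r w) - pm_scale (of_nat (r w choose s)) (q w)))"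
      by (simp add: h_def th_sum th(2) sum_subtractf pm.scale_right_diff_distrib)
    also have "\<dots> \<in> shifted_lower ?k n"
    proof (intro pm.subspace_sum pm.subspace_scale sub)
      fix w assume w: "w \<in> W"
      have "word_deg d (concat (us w)) + r w * word_deg d u = n"
        using fac[OF w] by (metis word_deg_concat_replicate word_deg_simps(3))
      then show "\<theta> (bracket_prod (us w) * bracket u ^ r w) - pm_scale (of_nat (r w choose s)) (q w) \<in> shifted_lower ?k n"
        using th(4)[of "us w" "r w"] fac[OF w] by (simp add: q_def)
    qed
    finally show ?thesis .
  qed
  \<comment> \<open>The words whose coefficient survives; dropping the others keeps all coefficients nonzero.\<close>
  define W' where "W' = {w \<in> W. c w * of_nat (r w choose s) \<noteq> 0}"
  have W': "s \<le> r w" "w \<in> W" if "w \<in> W'" for w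
    using that by (auto simp: W'_def) (metis binomial_eq_0 leI of_nat_0)
  have sumW': "(\<Sum>w\<in>W. pm_scale (c w * of_nat (r w choose s)) (q w)) = (\<Sum>w\<in>W'. pm_scale (c w * of_nat (r w choose s)) (q w))"
    using W by (intro sum.mono_neutral_right) (auto simp: W'_def)
  define v where "v w = concat (us w) @ concat (replicate (r w - s) u)" for w
  have vw: "w = v w @ concat (replicate s u)" if w: "w \<in> W'" for w
  proof -
    have "concat (replicate (r w) u) = concat (replicate (r w - s) u) @ concat (replicate s u)"
      using W'(1)[OF w] by (metis concat_append le_add_diff_inverse2 replicate_add)
    then show ?thesis using fac[OF W'(2)[OF w]] by (simp add: v_def)
  qed
  have "\<theta> f \<in> I" using th(3) f by blast
  moreover have "\<theta> f = \<theta> (f - g - h) + \<theta> g + \<theta> h" by (simp flip: th(1))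
  then have "\<theta> f - (\<Sum>w\<in>W'. pm_scale (c w * of_nat (r w choose s)) (q w)) =
      \<theta> (f - g - h) + \<theta> g + (\<theta> h - (\<Sum>w\<in>W. pm_scale (c w * of_nat (r w choose s)) (q w)))"
    by (simp add: sumW')
  then have low': "\<theta> f - (\<Sum>w\<in>W'. pm_scale (c w * of_nat (r w choose s)) (q w)) \<in> shifted_lower ?k n"
    using tl tg th_h by (simp add: pm.subspace_add[OF sub])
  have "\<exists>w\<in>W'. reducible d I (v w)"
  proof (rule some_reducible[OF \<open>\<theta> f \<in> I\<close>])
    show "finite W'" using W by (simp add: W'_def)
    show "W' \<noteq> {}" using w0 by (auto simp: W'_def)
    show "inj_on v W'" using vw by (metis inj_onI)
    show "monic_at (v w) (q w) \<and> word_deg d (v w) = n - ?k \<and> c w * of_nat (r w choose s) \<noteq> 0" if w: "w \<in> W'" for w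
    proof (intro conjI)
      have "q w = bracket_prod (us w @ replicate (r w - s) u)" by (simp add: q_def bracket_power)
      then show "monic_at (v w) (q w)"
        using monic_at_bracket_prod[of "us w @ replicate (r w - s) u"] by (simp add: v_def)
      have "word_deg d w = n" using fac W'(2)[OF w] by blast
      then show "word_deg d (v w) = n - ?k" using arg_cong[OF vw[OF w], of "word_deg d"] by simp
      show "c w * of_nat (r w choose s) \<noteq> 0" using w by (simp add: W'_def)
    qed
    show "word_deg d a < n - ?k" if "a \<in> keys (\<theta> f - (\<Sum>w\<in>W'. pm_scale (c w * of_nat (r w choose s)) (q w)))" for a
      using low' that by (auto simp: shifted_lower_def)
  qed
  then show ?thesis using W' v_def by auto
qed

end

section \<open>Normal forms modulo the ideal\<close>

context triangular_quotient
begin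

text \<open>
Letters have positive degree, so words of fixed degree have bounded length.
\<close>

lemma wf_glex: "wf {(u, v). glex_less d u v}"
proof (rule wfI_min)
  fix x and Q :: "'x list set" assume "x \<in> Q"
  define k where "k = (LEAST k. \<exists>w\<in>Q. word_deg d w = k)"
  have k: "\<exists>w\<in>Q. word_deg d w = k" unfolding k_def by (rule LeastI_ex) (use \<open>x \<in> Q\<close> in blast)
  have k_le: "k \<le> word_deg d w" if "w \<in> Q" for w unfolding k_def by (rule Least_le) (use that in blast)
  have len: "length w \<le> word_deg d w" for w
  proof (induction w)
    case (Cons a w)
    then show ?case using deg_pos[of a] by simp
  qed simp
  have "\<exists>m\<in>{w\<in>Q. word_deg d w = k}. \<forall>w\<in>{w\<in>Q. word_deg d w = k}. lex_le m w"
  proof (rule lex_bounded_length_min[of _ k])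
    show "\<forall>w\<in>{w \<in> Q. word_deg d w = k}. length w \<le> k" using len by auto
  qed (use k in blast)
  then obtain m where m: "m \<in> Q" "word_deg d m = k" "\<And>w. w \<in> Q \<Longrightarrow> word_deg d w = k \<Longrightarrow> lex_le m w"
    by blast
  have "y \<notin> Q" if "glex_less d y m" for y
    using that m(2) m(3)[of y] k_le[of y] by (auto simp: glex_less_def lex_le_def dest: lex.less_asym)
  then show "\<exists>z\<in>Q. \<forall>y. (y, z) \<in> {(u, v). glex_less d u v} \<longrightarrow> y \<notin> Q" using m(1) by blast
qed

definition normal_forms :: "('x list \<Rightarrow> bool) \<Rightarrow> ('x list \<Rightarrow>\<^sub>0 'k) set"
  where "normal_forms P = pm.span (I \<union> bracket ` {a. \<not> reducible d I a \<and> P a})"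

lemma normal_forms_mono: "(\<And>a. P a \<Longrightarrow> Q a) \<Longrightarrow> normal_forms P \<subseteq> normal_forms Q"
  unfolding normal_forms_def by (rule pm.span_mono) blast

lemma subspace_normal_forms: "pm.subspace (normal_forms P)"
  by (simp add: normal_forms_def)

lemma ideal_normal_forms: "p \<in> I \<Longrightarrow> p \<in> normal_forms P"
  unfolding normal_forms_def by (rule pm.span_base) blast

text \<open>
An irreducible word is replaced by its bracket and a reducible one by an element of \<open>I\<close> with that leading
word; either way only smaller words remain.
\<close>

lemma single_normal_forms: "single w 1 \<in> normal_forms (\<lambda>a. a = w \<or> glex_less d a w)"
proof (induction w rule: wf_induct_rule[OF wf_glex])
  case (1 w)
  have low: "q \<in> normal_forms (\<lambda>a. a = w \<or> glex_less d a w)" if q: "\<And>v. v \<in> keys q \<Longrightarrow> glex_less d v w" for q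
  proof (rule pm_mem_subspace[OF subspace_normal_forms])
    fix v assume "v \<in> keys q"
    then have v: "glex_less d v w" by (rule q)
    then have "single v 1 \<in> normal_forms (\<lambda>a. a = v \<or> glex_less d a v)" using 1 by simp
    also have "\<dots> \<subseteq> normal_forms (\<lambda>a. a = w \<or> glex_less d a w)"
      by (rule normal_forms_mono) (use v glex_less_trans[OF _ v] in auto)
    finally show "single v 1 \<in> normal_forms (\<lambda>a. a = w \<or> glex_less d a w)" .
  qed
  show ?case
  proof (cases "reducible d I w")
    case False
    have "bracket w \<in> normal_forms (\<lambda>a. a = w \<or> glex_less d a w)"
      unfolding normal_forms_def using False by (intro pm.span_base) blast
    moreover have "bracket w - single w 1 \<in> normal_forms (\<lambda>a. a = w \<or> glex_less d a w)"
    proof (rule low)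
      fix v assume "v \<in> keys (bracket w - single w 1 :: 'x list \<Rightarrow>\<^sub>0 'k)"
      then have v: "mset v = mset w" "lex_less v w"
        using monic_at_bracket[of w, where 'b = 'k] unfolding monic_at_def by blast+
      then show "glex_less d v w" using word_deg_mset[OF v(1), of d] by (simp add: glex_less_def)
    qed
    ultimately have "bracket w - (bracket w - single w 1) \<in> normal_forms (\<lambda>a. a = w \<or> glex_less d a w)"
      by (rule pm.subspace_diff[OF subspace_normal_forms])
    then show ?thesis by simp
  next
    case True
    then obtain p where p: "p \<in> I" "w \<in> keys p" "\<And>u. u \<in> keys p \<Longrightarrow> u \<noteq> w \<Longrightarrow> glex_less d u w"
      unfolding reducible_def is_leading_word_def by blast
    define q where "q = pm_scale (1 / lookup p w) p"
    have qw: "lookup q w = 1" using p(2) by (simp add: q_def lookup_pm_scale in_keys_iff)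
    have "q \<in> I" unfolding q_def by (rule pm.subspace_scale[OF subspace_ideal p(1)])
    then have "q \<in> normal_forms (\<lambda>a. a = w \<or> glex_less d a w)" by (rule ideal_normal_forms)
    moreover have "q - single w 1 \<in> normal_forms (\<lambda>a. a = w \<or> glex_less d a w)"
    proof (rule low)
      fix v assume v: "v \<in> keys (q - single w 1)"
      then have "v \<noteq> w" using qw by (auto simp: in_keys_iff lookup_minus)
      moreover from this v have "v \<in> keys p"
        by (auto simp: in_keys_iff lookup_minus q_def lookup_pm_scale lookup_single when_def split: if_splits)
      ultimately show "glex_less d v w" using p(3) by blast
    qed
    ultimately have "q - (q - single w 1) \<in> normal_forms (\<lambda>a. a = w \<or> glex_less d a w)"
      by (rule pm.subspace_diff[OF subspace_normal_forms])
    then show ?thesis by simp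
  qed
qed

lemma mem_normal_forms:
  assumes "\<And>w a. w \<in> keys p \<Longrightarrow> a = w \<or> glex_less d a w \<Longrightarrow> P a"
  shows "p \<in> normal_forms P"
proof (rule pm_mem_subspace[OF subspace_normal_forms])
  fix w assume w: "w \<in> keys p"
  show "single w 1 \<in> normal_forms P"
    using single_normal_forms[of w] normal_forms_mono[of "\<lambda>a. a = w \<or> glex_less d a w" P] assms[OF w] by blast
qed

lemma normal_forms_cases:
  assumes "p \<in> normal_forms P"
  obtains W c where "finite W" "\<And>w. w \<in> W \<Longrightarrow> \<not> reducible d I w \<and> P w \<and> c w \<noteq> 0"
    "p - (\<Sum>w\<in>W. pm_scale (c w) (bracket w)) \<in> I"
proof -
  obtain q r where qr: "q \<in> I" "r \<in> pm.span (bracket ` {a. \<not> reducible d I a \<and> P a})" "p = q + r"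
    using assms subspace_ideal unfolding normal_forms_def by (auto simp: pm.span_Un pm.span_eq_iff[THEN iffD2])
  obtain W c where W: "finite W" "W \<subseteq> {a. \<not> reducible d I a \<and> P a}" "\<And>w. w \<in> W \<Longrightarrow> c w \<noteq> 0"
    "r = (\<Sum>w\<in>W. pm_scale (c w) (bracket w))"
    by (rule in_span_image_coeffs[OF qr(2)]) (rule that)
  have "p - r \<in> I" using qr by simp
  then have "p - (\<Sum>w\<in>W. pm_scale (c w) (bracket w)) \<in> I" unfolding W(4) .
  with W(1) _ show ?thesis by (rule that) (use W(2,3) in auto)
qed

lemma irreducible_nondecreasing:
  assumes "\<not> reducible d I w"
  obtains us where "sorted_wrt lex_le us" "set us \<subseteq> irred_lyndon d I" "concat us = w"
proof -
  obtain us where us: "sorted_wrt lex_le us" "\<forall>u\<in>set us. lyndon u" "concat us = w"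
    using lyndon_factorization_exists by metis
  have "set us \<subseteq> irred_lyndon d I"
    using us irreducible_concat_factor[of us] assms by (auto simp: irred_lyndon_def)
  then show ?thesis using that us by blast
qed

lemma bracket_concat_irred:
  assumes "sorted_wrt lex_le us" "set us \<subseteq> irred_lyndon d I"
  shows "bracket (concat us) = bracket_prod us"
  using assms by (intro bracket_concat_sorted) (auto simp: irred_lyndon_def)

lemma irreducible_bracket_generate:
  "\<exists>W c. finite W \<and> W \<subseteq> {w. \<not> reducible d I w} \<and> p - (\<Sum>w\<in>W. pm_scale (c w) (bracket w)) \<in> I"
proof -
  have "p \<in> normal_forms (\<lambda>a. True)" by (rule mem_normal_forms) simp
  then obtain W c where "finite W" "\<And>w. w \<in> W \<Longrightarrow> \<not> reducible d I w \<and> True \<and> c w \<noteq> 0"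
    "p - (\<Sum>w\<in>W. pm_scale (c w) (bracket w)) \<in> I"
    by (rule normal_forms_cases) (rule that)
  then show ?thesis by blast
qed

text \<open>
The largest word of top degree in a relation would be the leading word of an element of \<open>I\<close>.
\<close>

lemma irreducible_bracket_independent:
  assumes W: "finite W" "W \<subseteq> {w. \<not> reducible d I w}" "(\<Sum>w\<in>W. pm_scale (c w) (bracket w)) \<in> I" "w \<in> W"
  shows "c w = 0"
proof (rule ccontr)
  assume "c w \<noteq> 0"
  define V where "V = {w \<in> W. c w \<noteq> 0}"
  define n where "n = Max (word_deg d ` V)"
  define Vn where "Vn = {w \<in> V. word_deg d w = n}"
  have fin: "finite V" "V \<noteq> {}" using W(1,4) \<open>c w \<noteq> 0\<close> by (auto simp: V_def)
  have "n \<in> word_deg d ` V" unfolding n_def using fin by (intro Max_in) auto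
  then have Vn: "Vn \<noteq> {}" "finite Vn" using fin by (auto simp: Vn_def)
  have le: "word_deg d w \<le> n" if "w \<in> V" for w using fin that by (simp add: n_def)
  let ?f = "\<Sum>w\<in>W. pm_scale (c w) (bracket w)"
  have fV: "?f = (\<Sum>w\<in>V. pm_scale (c w) (bracket w))"
    using W(1) by (intro sum.mono_neutral_right) (auto simp: V_def)
  have "\<exists>w\<in>Vn. reducible d I (id w)"
  proof (rule some_reducible[OF W(3) Vn(2,1)])
    show "monic_at (id w) (bracket w :: 'x list \<Rightarrow>\<^sub>0 'k) \<and> word_deg d (id w) = n \<and> c w \<noteq> 0" if "w \<in> Vn" for w
      using monic_at_bracket that by (auto simp: Vn_def V_def)
    fix a assume a: "a \<in> keys (?f - (\<Sum>w\<in>Vn. pm_scale (c w) (bracket w)))"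
    have "?f - (\<Sum>w\<in>Vn. pm_scale (c w) (bracket w)) = (\<Sum>w\<in>V - Vn. pm_scale (c w) (bracket w))"
      unfolding fV using fin by (subst sum_diff) (auto simp: Vn_def)
    with a have "a \<in> keys (\<Sum>w\<in>V - Vn. pm_scale (c w) (bracket w))" by simp
    then obtain w where w: "w \<in> V - Vn" "word_deg d a = word_deg d w" using keys_bracket_sum by blast
    then show "word_deg d a < n" using w(1) le[of w] by (auto simp: Vn_def)
  qed simp
  then show False using W(2) by (auto simp: Vn_def V_def)
qed

section \<open>Relations between brackets of irreducible Lyndon words\<close>

lemma split_maximal_factor:
  assumes sorted: "sorted_wrt lex_le bs" and bs: "\<And>a. a \<in> set bs \<Longrightarrow> lyndon a \<and> lex_le a u"
  defines "us \<equiv> filter (\<lambda>a. a \<noteq> u) bs" and "r \<equiv> count_list bs u"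
  shows "bs = us @ replicate r u" "\<forall>a\<in>set us. lyndon a \<and> lex_less a u"
    "concat us @ concat (replicate r u) = concat bs" "bracket (concat bs) = (bracket_prod us * bracket u ^ r :: 'x list \<Rightarrow>\<^sub>0 'k)"
proof -
  show 1: "bs = us @ replicate r u"
    unfolding us_def r_def using sorted bs by (intro sorted_split_max) auto
  show "\<forall>a\<in>set us. lyndon a \<and> lex_less a u"
    using bs by (auto simp: us_def lex_le_def)
  show "concat us @ concat (replicate r u) = concat bs"
    using arg_cong[OF 1, of concat] by simp
  have "bracket (concat bs) = (bracket_prod bs :: 'x list \<Rightarrow>\<^sub>0 'k)"
    using sorted bs by (intro bracket_concat_sorted) auto
  then show "bracket (concat bs) = (bracket_prod us * bracket u ^ r :: 'x list \<Rightarrow>\<^sub>0 'k)"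
    using arg_cong[OF 1, of bracket_prod] by (simp add: bracket_power)
qed

text \<open>
Let \<open>u\<close> be the largest Lyndon factor of the words of top degree in the normal form of \<open>g\<close>, and suppose
\<open>u > v\<close>. Both \<open>g\<close> and the top degree of the normal form are then built from factors \<open>\<le> u\<close>, and stripping the
highest power of \<open>u\<close> from their difference shows that a prefix of an irreducible word is reducible.
\<close>

lemma normal_form_bounded:
  assumes g: "g \<in> bracket_span d (\<lambda>bs. \<forall>a\<in>set bs. lyndon a \<and> lex_le a v) n"
  shows "g \<in> bracket_span d (\<lambda>bs. set bs \<subseteq> {a \<in> irred_lyndon d I. lex_le a v}) n
    + lower_part (word_deg d) (irred_alg d I) n + I"
proof -
  have "g \<in> normal_forms (\<lambda>a. word_deg d a \<le> n)"
    using bracket_span_keys[OF g] by (intro mem_normal_forms) (auto simp: glex_less_def)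
  then obtain W c where W: "finite W" "\<And>w. w \<in> W \<Longrightarrow> \<not> reducible d I w \<and> word_deg d w \<le> n \<and> c w \<noteq> 0"
    "g - (\<Sum>w\<in>W. pm_scale (c w) (bracket w)) \<in> I"
    by (rule normal_forms_cases) (rule that)
  have "\<forall>w\<in>W. \<exists>us. sorted_wrt lex_le us \<and> set us \<subseteq> irred_lyndon d I \<and> concat us = w"
    using irreducible_nondecreasing W(2) by metis
  then obtain \<phi> where \<phi>: "\<And>w. w \<in> W \<Longrightarrow> sorted_wrt lex_le (\<phi> w) \<and> set (\<phi> w) \<subseteq> irred_lyndon d I \<and> concat (\<phi> w) = w"
    by metis
  have b\<phi>: "bracket w = bracket_prod (\<phi> w)" if "w \<in> W" for w
    using \<phi>[OF that] bracket_concat_irred by metis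
  define Wn where "Wn = {w \<in> W. word_deg d w = n}"
  have fin: "finite Wn" using W(1) by (simp add: Wn_def)
  have split: "(\<Sum>w\<in>W. pm_scale (c w) (bracket w)) =
      (\<Sum>w\<in>Wn. pm_scale (c w) (bracket w)) + (\<Sum>w\<in>W - Wn. pm_scale (c w) (bracket w))"
    using sum.subset_diff[of Wn W "\<lambda>w. pm_scale (c w) (bracket w)"] W(1) by (simp add: Wn_def add.commute)
  have bounded: "lex_le a v" if wa: "w \<in> Wn" "a \<in> set (\<phi> w)" for w a
  proof (rule ccontr)
    assume "\<not> lex_le a v"
    then have va: "lex_less v a" by (simp add: lex.not_le)
    define U where "U = (\<Union>w\<in>Wn. set (\<phi> w))"
    have "finite U" "a \<in> U" using fin wa by (auto simp: U_def)
    then obtain u where u: "u \<in> U" "\<And>b. b \<in> U \<Longrightarrow> lex_le b u" using lex_max_exists[of U] by blast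
    have vu: "lex_less v u" using lex.less_le_trans[OF va u(2)[OF \<open>a \<in> U\<close>]] .
    have lyn: "lyndon u" using u(1) \<phi> by (auto simp: U_def Wn_def irred_lyndon_def)
    define us where "us w = filter (\<lambda>a. a \<noteq> u) (\<phi> w)" for w
    define r where "r w = count_list (\<phi> w) u" for w
    have spl: "\<phi> w = us w @ replicate (r w) u" "\<forall>a\<in>set (us w). lyndon a \<and> lex_less a u"
      "concat (us w) @ concat (replicate (r w) u) = w" "bracket w = (bracket_prod (us w) * bracket u ^ r w :: 'x list \<Rightarrow>\<^sub>0 'k)"
      if w: "w \<in> Wn" for w
    proof -
      have \<phi>w: "sorted_wrt lex_le (\<phi> w)" "concat (\<phi> w) = w" using \<phi>[of w] w by (auto simp: Wn_def)
      have "lyndon b \<and> lex_le b u" if "b \<in> set (\<phi> w)" for b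
        using that u(2)[of b] \<phi>[of w] w by (auto simp: U_def Wn_def irred_lyndon_def)
      from split_maximal_factor[OF \<phi>w(1) this]
      show "\<phi> w = us w @ replicate (r w) u" "\<forall>a\<in>set (us w). lyndon a \<and> lex_less a u"
        "concat (us w) @ concat (replicate (r w) u) = w" "bracket w = (bracket_prod (us w) * bracket u ^ r w :: 'x list \<Rightarrow>\<^sub>0 'k)"
        unfolding us_def r_def \<phi>w(2) by auto
    qed
    \<comment> \<open>With the highest multiplicity, the binomial coefficient of every surviving word is \<open>1\<close>.\<close>
    define s where "s = Max (r ` Wn)"
    have r_le: "r w \<le> s" if "w \<in> Wn" for w using fin that by (simp add: s_def)
    have "s \<in> r ` Wn" unfolding s_def using fin wa(1) by (intro Max_in) auto
    then obtain w0 where w0: "w0 \<in> Wn" "r w0 = s" by blast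
    obtain w1 where w1: "w1 \<in> Wn" "u \<in> set (\<phi> w1)" using u(1) by (auto simp: U_def)
    then have "r w1 > 0" unfolding r_def by (metis count_list_0_iff neq0_conv)
    then have s: "s > 0" using r_le[OF w1(1)] by simp
    have irr_Wn: "\<not> reducible d I w" if "w \<in> Wn" for w using W(2) that by (auto simp: Wn_def)
    have "\<not> reducible d I (concat (us w0) @ concat (replicate s u) @ [])"
      using irr_Wn[OF w0(1)] spl(3)[OF w0(1)] w0(2) by simp
    then have irr: "\<not> reducible d I (concat (replicate s u))" by (rule irreducible_factor)
    define f where "f = g - (\<Sum>w\<in>W. pm_scale (c w) (bracket w))"
    have "\<exists>w\<in>Wn. s \<le> r w \<and> reducible d I (concat (us w) @ concat (replicate (r w - s) u))"
    proof (rule divided_derivative_reducible[where f = f and g = g and c = "\<lambda>w. - c w" and ?w0.0 = w0 and n = n])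
      show "f \<in> I" using W(3) by (simp add: f_def)
      show "- c w0 * of_nat (r w0 choose s) \<noteq> 0" using W(2) w0 by (auto simp: Wn_def)
      show "(\<forall>a\<in>set (us w). lyndon a \<and> lex_less a u) \<and> concat (us w) @ concat (replicate (r w) u) = w \<and> word_deg d w = n"
        if "w \<in> Wn" for w using spl(2,3)[OF that] that by (simp add: Wn_def)
      have "bracket_span d (\<lambda>bs. \<forall>a\<in>set bs. lyndon a \<and> lex_le a v) n \<subseteq> bracket_span d (\<lambda>bs. \<forall>a\<in>set bs. lyndon a \<and> lex_less a u) n"
        unfolding bracket_span_def using lex.le_less_trans[OF _ vu] by (intro pm.span_mono) blast
      then show "g \<in> bracket_span d (\<lambda>bs. \<forall>a\<in>set bs. lyndon a \<and> lex_less a u) n" using g by blast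
      fix a assume a: "a \<in> keys (f - g - (\<Sum>w\<in>Wn. pm_scale (- c w) (bracket_prod (us w) * bracket u ^ r w)))"
      have "f - g - (\<Sum>w\<in>Wn. pm_scale (- c w) (bracket_prod (us w) * bracket u ^ r w)) =
          - (\<Sum>w\<in>W - Wn. pm_scale (c w) (bracket w))"
        by (simp add: f_def split spl(4) sum_negf)
      with a have "a \<in> keys (\<Sum>w\<in>W - Wn. pm_scale (c w) (bracket w))" by (simp add: in_keys_iff)
      then obtain w where w: "w \<in> W - Wn" "word_deg d a = word_deg d w" using keys_bracket_sum by blast
      then show "word_deg d a < n" using w(1) W(2)[of w] by (auto simp: Wn_def)
    qed (use fin w0 lyn s irr in auto)
    then obtain w where w: "w \<in> Wn" "s \<le> r w" "reducible d I (concat (us w) @ concat (replicate (r w - s) u))" by blast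
    have "concat (replicate (r w) u) = concat (replicate (r w - s) u) @ concat (replicate s u)"
      using w(2) by (metis concat_append le_add_diff_inverse2 replicate_add)
    then have "w = [] @ (concat (us w) @ concat (replicate (r w - s) u)) @ concat (replicate s u)"
      using spl(3)[OF w(1)] by simp
    then have "reducible d I w" using reducible_append[OF w(3)] by metis
    then show False using irr_Wn[OF w(1)] by blast
  qed
  have "(\<Sum>w\<in>Wn. pm_scale (c w) (bracket w)) \<in> bracket_span d (\<lambda>bs. set bs \<subseteq> {a \<in> irred_lyndon d I. lex_le a v}) n"
    unfolding bracket_span_def
  proof (intro pm.span_sum pm.span_scale pm.span_base CollectI)
    fix w assume w: "w \<in> Wn"
    then have "w \<in> W" by (simp add: Wn_def)
    have "set (\<phi> w) \<subseteq> {a \<in> irred_lyndon d I. lex_le a v}" using \<phi>[OF \<open>w \<in> W\<close>] bounded[OF w] by blast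
    moreover have "word_deg d (concat (\<phi> w)) = n" using \<phi>[OF \<open>w \<in> W\<close>] w by (simp add: Wn_def)
    ultimately show "\<exists>bs. bracket w = bracket_prod bs \<and> set bs \<subseteq> {a \<in> irred_lyndon d I. lex_le a v} \<and> word_deg d (concat bs) = n"
      using b\<phi>[OF \<open>w \<in> W\<close>] by blast
  qed
  moreover have "(\<Sum>w\<in>W - Wn. pm_scale (c w) (bracket w)) \<in> lower_part (word_deg d) (irred_alg d I) n"
  proof (intro pm.subspace_sum pm.subspace_scale)
    show sub: "pm.subspace (lower_part (word_deg d) (irred_alg d I) n)"
      unfolding irred_alg_def by (intro subspace_lower_part subspace_subalgebra_gen)
    then show "pm.subspace (lower_part (word_deg d) (irred_alg d I) n)" .
    fix w assume w: "w \<in> W - Wn"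
    have "bracket w \<in> hom_part (word_deg d) (irred_alg d I) (word_deg d w)"
      unfolding irred_alg_def hom_part_subalgebra b\<phi>[OF DiffD1[OF w]]
      using \<phi>[OF DiffD1[OF w]] by (intro bracket_span_base) auto
    moreover have "word_deg d w < n" using w W(2)[of w] by (auto simp: Wn_def)
    ultimately show "bracket w \<in> lower_part (word_deg d) (irred_alg d I) n"
      unfolding irred_alg_def by (intro hom_part_lower_part[OF subspace_subalgebra_gen])
  qed
  ultimately have "(\<Sum>w\<in>W. pm_scale (c w) (bracket w)) + (g - (\<Sum>w\<in>W. pm_scale (c w) (bracket w))) \<in>
      bracket_span d (\<lambda>bs. set bs \<subseteq> {a \<in> irred_lyndon d I. lex_le a v}) n + lower_part (word_deg d) (irred_alg d I) n + I"
    unfolding split[symmetric] using W(3) by (subst split) (intro set_plus_intro)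
  then show ?thesis by simp
qed

text \<open>
The bound \<open>\<le> v\<close> is strict here because \<open>v\<close> is itself reducible.
\<close>

lemma reducible_lyndon_relation:
  assumes v: "lyndon v" "reducible d I v"
  shows "bracket v \<in> hom_part (word_deg d) (irred_alg_lt d I v) (word_deg d v)
        + lower_part (word_deg d) (irred_alg d I) (word_deg d v) + I"
proof -
  have "bracket_prod [v] \<in> bracket_span d (\<lambda>bs. \<forall>a\<in>set bs. lyndon a \<and> lex_le a v) (word_deg d v)"
    using v by (intro bracket_span_base) auto
  from normal_form_bounded[OF this]
  have "bracket v \<in> bracket_span d (\<lambda>bs. set bs \<subseteq> {a \<in> irred_lyndon d I. lex_le a v}) (word_deg d v)
    + lower_part (word_deg d) (irred_alg d I) (word_deg d v) + I" by simp
  also have "{a \<in> irred_lyndon d I. lex_le a v} = {a \<in> irred_lyndon d I. lex_less a v}"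
    using v by (auto simp: irred_lyndon_def lex_le_def)
  finally show ?thesis by (simp add: irred_alg_lt_def hom_part_subalgebra)
qed

lemma commutator_relation:
  assumes u: "u \<in> irred_lyndon d I" and v: "v \<in> irred_lyndon d I" and vu: "lex_less v u"
  shows "bracket u * bracket v - bracket v * bracket u
        \<in> hom_part (word_deg d) (irred_alg_le d I (u @ v)) (word_deg d (u @ v))
          + lower_part (word_deg d) (irred_alg d I) (word_deg d (u @ v)) + I"
proof -
  have "commutator (bracket u) (bracket v :: 'x list \<Rightarrow>\<^sub>0 'k) \<in> lyndon_between v (u @ v) (mset (u @ v))"
    using commutator_bracket_lyndon u v vu by (auto simp: irred_lyndon_def)
  also have "\<dots> \<subseteq> bracket_span d (\<lambda>bs. \<forall>a\<in>set bs. lyndon a \<and> lex_le a (u @ v)) (word_deg d (u @ v))"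
    unfolding lyndon_between_def
  proof (rule pm.span_minimal)
    show "pm.subspace (bracket_span d (\<lambda>bs. \<forall>a\<in>set bs. lyndon a \<and> lex_le a (u @ v)) (word_deg d (u @ v)) :: ('x list \<Rightarrow>\<^sub>0 'k) set)"
      by (simp add: bracket_span_def)
    show "(bracket ` {w. lyndon w \<and> lex_less v w \<and> lex_le w (u @ v) \<and> mset w = mset (u @ v)} :: ('x list \<Rightarrow>\<^sub>0 'k) set)
        \<subseteq> bracket_span d (\<lambda>bs. \<forall>a\<in>set bs. lyndon a \<and> lex_le a (u @ v)) (word_deg d (u @ v))"
    proof (rule image_subsetI)
      fix w assume "w \<in> {w. lyndon w \<and> lex_less v w \<and> lex_le w (u @ v) \<and> mset w = mset (u @ v)}"
      then have w: "lyndon w" "lex_le w (u @ v)" "mset w = mset (u @ v)" by blast+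
      have "(bracket_prod [w] :: 'x list \<Rightarrow>\<^sub>0 'k) \<in> bracket_span d (\<lambda>bs. \<forall>a\<in>set bs. lyndon a \<and> lex_le a (u @ v)) (word_deg d (u @ v))"
        using w word_deg_mset[OF w(3), of d] by (intro bracket_span_base) auto
      then show "(bracket w :: 'x list \<Rightarrow>\<^sub>0 'k) \<in> bracket_span d (\<lambda>bs. \<forall>a\<in>set bs. lyndon a \<and> lex_le a (u @ v)) (word_deg d (u @ v))" by simp
    qed
  qed
  finally show ?thesis
    using normal_form_bounded by (simp add: irred_alg_le_def hom_part_subalgebra commutator_def)
qed

section \<open>Irreducibility of nondecreasing products in characteristic zero\<close>

text \<open>
Induction on the degree. A reducible \<open>b\<close> yields a relation \<open>f\<close> between \<open>[b]\<close> and brackets of smaller irreducible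
words. Let \<open>u\<close> be the largest factor in top degree \<open>n\<close> and \<open>s\<close> its highest multiplicity. Stripping \<open>u\<^sup>s\<close>
contradicts the induction hypothesis if \<open>u\<^sup>s\<close> has degree below \<open>n\<close>. Otherwise \<open>u\<^sup>s\<close> occurs in \<open>f\<close>, and stripping
\<open>u\<^sup>s\<^sup>-\<^sup>1\<close> leaves \<open>s [u]\<close> plus brackets of other words; here the characteristic enters. If \<open>s = 1\<close> there is nothing
to strip, but then \<open>u\<close> is the leading word of \<open>f\<close>.
\<close>

lemma nondecreasing_products_irreducible:
  assumes char: "CHAR('k) = 0" and proper: "I \<noteq> UNIV" and b: "b \<in> nondecreasing_products d I"
  shows "\<not> reducible d I b"
  using b
proof (induction "word_deg d b" arbitrary: b rule: less_induct)
  case less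
  show ?case
  proof
    assume red: "reducible d I b"
    define n where "n = word_deg d b"
    have IH: "\<not> reducible d I (concat us)"
      if "word_deg d (concat us) < n" "sorted_wrt lex_le us" "set us \<subseteq> irred_lyndon d I" for us
      using less.hyps[of "concat us"] that unfolding n_def nondecreasing_products_def by blast
    obtain p where p: "p \<in> I" "b \<in> keys p" "\<And>u. u \<in> keys p \<Longrightarrow> u \<noteq> b \<Longrightarrow> glex_less d u b"
      using red unfolding reducible_def is_leading_word_def by blast
    have "b \<noteq> []"
    proof
      assume "b = []"
      then have "keys p = {[]}" using p(2,3) by (auto simp: glex_less_def)
      then have "p = pm_scale (lookup p []) 1" using pm_expansion[of p] by simp
      then have "1 = pm_scale (1 / lookup p []) p" using \<open>b = []\<close> p(2)
        by (metis in_keys_iff nonzero_eq_divide_eq pm.scale_one pm.scale_scale)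
      then have "1 \<in> I" using pm.subspace_scale[OF subspace_ideal p(1)] by metis
      then have "q \<in> I" for q using ideal_mult_left[of 1 q] by simp
      then show False using proper by blast
    qed
    define q where "q = pm_scale (1 / lookup p b) p"
    have q: "q \<in> I" unfolding q_def by (rule pm.subspace_scale[OF subspace_ideal p(1)])
    have qb: "lookup q b = 1" using p(2) by (simp add: q_def lookup_pm_scale in_keys_iff)
    have "bracket b - q \<in> normal_forms (\<lambda>a. glex_less d a b)"
    proof (rule mem_normal_forms)
      fix w a assume w: "w \<in> keys (bracket b - q)" and a: "a = w \<or> glex_less d a w"
      have "w \<noteq> b" using w qb monic_at_lookup[OF monic_at_bracket[of b, where 'b = 'k]]
        by (auto simp: in_keys_iff lookup_minus)
      have "w \<in> keys (bracket b :: 'x list \<Rightarrow>\<^sub>0 'k) \<or> w \<in> keys p"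
        using w by (auto simp: in_keys_iff lookup_minus q_def lookup_pm_scale)
      then have wb: "glex_less d w b"
      proof
        assume "w \<in> keys (bracket b :: 'x list \<Rightarrow>\<^sub>0 'k)"
        then have "mset w = mset b" "lex_less w b" using monic_at_keys[OF monic_at_bracket] \<open>w \<noteq> b\<close> by blast+
        then show ?thesis using word_deg_mset[of w b d] by (simp add: glex_less_def)
      next
        assume "w \<in> keys p"
        then show ?thesis using p(3) \<open>w \<noteq> b\<close> by blast
      qed
      then show "glex_less d a b" using a glex_less_trans[OF _ wb] by blast
    qed
    then obtain W c where W: "finite W" "\<And>w. w \<in> W \<Longrightarrow> \<not> reducible d I w \<and> glex_less d w b \<and> c w \<noteq> 0"
      "bracket b - q - (\<Sum>w\<in>W. pm_scale (c w) (bracket w)) \<in> I"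
      by (rule normal_forms_cases) (rule that)
    define f where "f = bracket b - (\<Sum>w\<in>W. pm_scale (c w) (bracket w))"
    have "f = (bracket b - q - (\<Sum>w\<in>W. pm_scale (c w) (bracket w))) + q" by (simp add: f_def)
    then have f: "f \<in> I" using pm.subspace_add[OF subspace_ideal W(3) q] by simp
    have bW: "b \<notin> W" using W(2)[of b] by auto
    define V where "V = insert b {w \<in> W. word_deg d w = n}"
    define c' where "c' w = (if w = b then 1 else - c w)" for w
    have c': "c' w \<noteq> 0" if "w \<in> V" for w using that W(2) by (auto simp: c'_def V_def)
    have finV: "finite V" using W(1) by (simp add: V_def)
    have degV: "word_deg d w = n" if "w \<in> V" for w using that by (auto simp: V_def n_def)
    have low: "word_deg d a < n" if a: "a \<in> keys (f - (\<Sum>w\<in>V. pm_scale (c' w) (bracket w)))" for a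
    proof -
      have "(\<Sum>w\<in>V. pm_scale (c' w) (bracket w)) = bracket b + (\<Sum>w\<in>{w \<in> W. word_deg d w = n}. pm_scale (c' w) (bracket w))"
        using W(1) bW by (simp add: V_def c'_def)
      also have "(\<Sum>w\<in>{w \<in> W. word_deg d w = n}. pm_scale (c' w) (bracket w)) = - (\<Sum>w\<in>{w \<in> W. word_deg d w = n}. pm_scale (c w) (bracket w))"
        unfolding sum_negf[symmetric] using bW by (intro sum.cong) (auto simp: c'_def)
      finally have "f - (\<Sum>w\<in>V. pm_scale (c' w) (bracket w)) =
          (\<Sum>w\<in>{w \<in> W. word_deg d w = n}. pm_scale (c w) (bracket w)) - (\<Sum>w\<in>W. pm_scale (c w) (bracket w))"
        by (simp add: f_def)
      also have "\<dots> = - (\<Sum>w\<in>W - {w \<in> W. word_deg d w = n}. pm_scale (c w) (bracket w))"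
        using W(1) by (subst sum_diff) auto
      finally have "a \<in> keys (\<Sum>w\<in>W - {w \<in> W. word_deg d w = n}. pm_scale (c w) (bracket w))"
        using a by (simp add: in_keys_iff)
      then obtain w where "w \<in> W - {w \<in> W. word_deg d w = n}" "word_deg d a = word_deg d w"
        using keys_bracket_sum by blast
      then have w: "w \<in> W" "word_deg d w \<noteq> n" "word_deg d a = word_deg d w" by auto
      then show ?thesis using w W(2)[of w] by (auto simp: glex_less_def n_def)
    qed
    have "\<exists>us. sorted_wrt lex_le us \<and> set us \<subseteq> irred_lyndon d I \<and> concat us = w" if "w \<in> V" for w
    proof (cases "w = b")
      case True
      then show ?thesis using less.prems unfolding nondecreasing_products_def by blast
    next
      case False
      then have "\<not> reducible d I w" using that W(2) by (auto simp: V_def)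
      then show ?thesis using irreducible_nondecreasing by metis
    qed
    then obtain \<phi> where \<phi>: "\<And>w. w \<in> V \<Longrightarrow> sorted_wrt lex_le (\<phi> w) \<and> set (\<phi> w) \<subseteq> irred_lyndon d I \<and> concat (\<phi> w) = w"
      by metis
    define U where "U = (\<Union>w\<in>V. set (\<phi> w))"
    have bV: "b \<in> V" by (simp add: V_def)
    have "finite U" using finV by (simp add: U_def)
    moreover have "\<phi> b \<noteq> []" using \<phi>[OF bV] \<open>b \<noteq> []\<close> by auto
    then have "U \<noteq> {}" using bV by (auto simp: U_def)
    ultimately obtain u where u: "u \<in> U" "\<And>a. a \<in> U \<Longrightarrow> lex_le a u" using lex_max_exists[of U] by blast
    have uN: "u \<in> irred_lyndon d I" using u(1) \<phi> by (auto simp: U_def)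
    then have lyn: "lyndon u" and irr_u: "\<not> reducible d I u" by (auto simp: irred_lyndon_def)
    have du: "word_deg d u > 0" using lyndon_nonempty[OF lyn] by simp
    define us where "us w = filter (\<lambda>a. a \<noteq> u) (\<phi> w)" for w
    define r where "r w = count_list (\<phi> w) u" for w
    have spl: "\<phi> w = us w @ replicate (r w) u" "\<forall>a\<in>set (us w). lyndon a \<and> lex_less a u"
      "concat (us w) @ concat (replicate (r w) u) = w" "bracket w = (bracket_prod (us w) * bracket u ^ r w :: 'x list \<Rightarrow>\<^sub>0 'k)"
      if w: "w \<in> V" for w
    proof -
      have \<phi>w: "sorted_wrt lex_le (\<phi> w)" "concat (\<phi> w) = w" using \<phi>[OF w] by auto
      have "lyndon b \<and> lex_le b u" if "b \<in> set (\<phi> w)" for b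
        using that u(2)[of b] \<phi>[OF w] w by (auto simp: U_def irred_lyndon_def)
      from split_maximal_factor[OF \<phi>w(1) this]
      show "\<phi> w = us w @ replicate (r w) u" "\<forall>a\<in>set (us w). lyndon a \<and> lex_less a u"
        "concat (us w) @ concat (replicate (r w) u) = w" "bracket w = (bracket_prod (us w) * bracket u ^ r w :: 'x list \<Rightarrow>\<^sub>0 'k)"
        unfolding us_def r_def \<phi>w(2) by auto
    qed
    have deg_spl: "word_deg d (concat (us w)) + r w * word_deg d u = n" if "w \<in> V" for w
      using arg_cong[OF spl(3)[OF that], of "word_deg d"] degV[OF that] by simp
    have sorted_rep: "sorted_wrt lex_le (replicate k u)" for k by (induction k) auto
    \<comment> \<open>Stripping a power of \<open>u\<close> of smaller degree leaves a reducible word of \<open>\<B>\<^sub>I\<close> of smaller degree.\<close>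
    have no_power: False if s: "s > 0" "s * word_deg d u < n" and w0: "w0 \<in> V" "of_nat (r w0 choose s) \<noteq> (0 :: 'k)" for s w0
    proof -
      have irr: "\<not> reducible d I (concat (replicate s u))"
        using IH[of "replicate s u"] s uN sorted_rep by auto
      have "\<exists>w\<in>V. s \<le> r w \<and> reducible d I (concat (us w) @ concat (replicate (r w - s) u))"
      proof (rule divided_derivative_reducible[OF f lyn s(1) irr finV w0(1), where g = 0 and c = c' and n = n])
        show "c' w0 * of_nat (r w0 choose s) \<noteq> 0" using c' w0 by simp
        show "0 \<in> bracket_span d (\<lambda>bs. \<forall>a\<in>set bs. lyndon a \<and> lex_less a u) n" by (simp add: bracket_span_def pm.span_zero)
        show "(\<forall>a\<in>set (us w). lyndon a \<and> lex_less a u) \<and> concat (us w) @ concat (replicate (r w) u) = w \<and> word_deg d w = n"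
          if "w \<in> V" for w using spl(2,3)[OF that] degV[OF that] by simp
        show "word_deg d a < n" if "a \<in> keys (f - 0 - (\<Sum>w\<in>V. pm_scale (c' w) (bracket_prod (us w) * bracket u ^ r w)))" for a
          using low[of a] that by (simp add: spl(4))
      qed
      then obtain w where w: "w \<in> V" "s \<le> r w" "reducible d I (concat (us w) @ concat (replicate (r w - s) u))" by blast
      have \<phi>w: "\<phi> w = (us w @ replicate (r w - s) u) @ replicate s u"
        using spl(1)[OF w(1)] w(2) by (simp add: replicate_add[symmetric])
      then have "sorted_wrt lex_le (us w @ replicate (r w - s) u)" "set (us w @ replicate (r w - s) u) \<subseteq> irred_lyndon d I"
        using \<phi>[OF w(1)] by (metis sorted_wrt_append, metis le_sup_iff set_append)
      moreover have "word_deg d (concat (us w @ replicate (r w - s) u)) < n"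
      proof -
        have "word_deg d (concat (us w @ replicate (r w - s) u)) + s * word_deg d u = n"
          using arg_cong[OF \<phi>w, of "\<lambda>x. word_deg d (concat x)"] \<phi>[OF w(1)] degV[OF w(1)] by simp
        moreover have "0 < s * word_deg d u" using s(1) du by simp
        ultimately show ?thesis by linarith
      qed
      ultimately have "\<not> reducible d I (concat (us w @ replicate (r w - s) u))" using IH by blast
      then show False using w(3) by simp
    qed
    define s where "s = Max (r ` V)"
    have r_le: "r w \<le> s" if "w \<in> V" for w using finV that by (simp add: s_def)
    have "s \<in> r ` V" unfolding s_def using finV bV by (intro Max_in) auto
    then obtain w0 where w0: "w0 \<in> V" "r w0 = s" by blast
    obtain w1 where w1: "w1 \<in> V" "u \<in> set (\<phi> w1)" using u(1) by (auto simp: U_def)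
    then have "r w1 > 0" unfolding r_def by (metis count_list_0_iff neq0_conv)
    then have s: "s > 0" using r_le[OF w1(1)] by simp
    have "s * word_deg d u \<le> n" using deg_spl[OF w0(1)] w0(2) by simp
    then have sn: "s * word_deg d u = n" using no_power[OF s _ w0(1)] w0(2) by (cases "s * word_deg d u < n") auto
    show False
    proof (cases "s = 1")
      case False
      have "of_nat (s choose (s - 1)) \<noteq> (0 :: 'k)"
        using char s by (simp add: of_nat_eq_0_iff_char_dvd binomial_symmetric[of "s - 1" s])
      moreover have "(s - 1) * word_deg d u < n"
        unfolding sn[symmetric] using s du by (intro mult_strict_right_mono) auto
      ultimately show False using no_power[of "s - 1" w0] w0 s False by simp
    next
      case True
      \<comment> \<open>Now \<open>u\<close> has the degree of the relation, so it can only occur as a word on its own.\<close>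
      have u_top: "w = u" if "w \<in> V" "r w = 1" for w
      proof -
        have "word_deg d (concat (us w)) = 0" using deg_spl[OF that(1)] sn True that(2) by simp
        then have "concat (us w) = []" by (simp only: word_deg_eq_0)
        then show ?thesis using spl(3)[OF that(1)] that(2) by (simp del: concat_eq_Nil_conv)
      qed
      then have uV: "u \<in> V" using w0 True by auto
      have max: "lex_le w u" if "w \<in> V" for w
      proof (cases "r w = 1")
        case True
        then show ?thesis using u_top[OF that] by (simp add: lex_le_def)
      next
        case r1: False
        have "w \<noteq> []" using degV[OF that] sn s du by auto
        moreover have "lex_le w u"
          using concat_lyndon_suffix_le[of "\<phi> w" u "[]" w] \<phi>[OF that] u(2) \<open>w \<noteq> []\<close> that
          by (auto simp: irred_lyndon_def U_def)
        ultimately show ?thesis by blast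
      qed
      have "reducible d I (id u)"
      proof (rule leading_reducible[OF f finV uV, where v = id and q = bracket and c = c' and m = n])
        show "monic_at (id w) (bracket w :: 'x list \<Rightarrow>\<^sub>0 'k) \<and> word_deg d (id w) = n \<and> c' w \<noteq> 0" if "w \<in> V" for w
          using monic_at_bracket degV[OF that] c'[OF that] by simp
      qed (use low max in auto)
      then show False using irr_u by simp
    qed
  qed
qed

end

section \<open>Bases of quotient algebras\<close>

text \<open>
A translation between sums in the ambient algebra and linear combinations of cosets in the quotient.
\<close>

lemma quotient_basis:
  fixes I :: "('a::monoid_add \<Rightarrow>\<^sub>0 'k::field) set" and e :: "'b \<Rightarrow> 'a \<Rightarrow>\<^sub>0 'k"
  assumes ideal: "ideal I class_ring"
    and gen: "\<And>p. \<exists>W c. finite W \<and> W \<subseteq> S \<and> p - (\<Sum>w\<in>W. pm_scale (c w) (e w)) \<in> I"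
    and indep: "\<And>W c w. finite W \<Longrightarrow> W \<subseteq> S \<Longrightarrow> (\<Sum>w\<in>W. pm_scale (c w) (e w)) \<in> I \<Longrightarrow> w \<in> W \<Longrightarrow> c w = 0"
  shows "inj_on (\<lambda>w. I +>\<^bsub>class_ring\<^esub> e w) S"
    and "vectorspace.basis class_ring (quotient_algebra I) ((\<lambda>w. I +>\<^bsub>class_ring\<^esub> e w) ` S)"
proof -
  let ?R = "class_ring :: ('a \<Rightarrow>\<^sub>0 'k) ring"
  let ?A = "quotient_algebra I"
  let ?c = "\<lambda>p. I +>\<^bsub>?R\<^esub> p"
  interpret J: ideal I ?R by (fact ideal)
  interpret A: vectorspace "class_ring :: 'k ring" ?A by (rule vectorspace_quotient_algebra[OF ideal])
  have carr: "carrier ?A = range ?c"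
    by (auto simp: quotient_algebra_def FactRing_def A_RCOSETS_def')
  have coset: "?c p = {i + p | i. i \<in> I}" for p
    by (auto simp: a_r_coset_def')
  have self: "p \<in> ?c p" for p
    using J.a_rcos_self[of p] by simp
  have eqc: "?c q = ?c p" if "q \<in> ?c p" for p q
    using abelian_group.a_repr_independence[OF class_ring.abelian_group_axioms that _ J.a_subgroup] by simp
  have eq_iff: "?c q = ?c p \<longleftrightarrow> q - p \<in> I" for p q
  proof
    assume "?c q = ?c p"
    then have "q \<in> ?c p" using self[of q] by simp
    then obtain i where i: "i \<in> I" "q = i + p" by (auto simp: coset)
    then show "q - p \<in> I" by simp
  next
    assume "q - p \<in> I"
    then have "q \<in> ?c p" unfolding coset by (intro CollectI exI[of _ "q - p"]) simp
    then show "?c q = ?c p" by (rule eqc)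
  qed
  have add: "?c p \<oplus>\<^bsub>?A\<^esub> ?c q = ?c (p + q)" for p q
    using J.a_rcos_sum[of p q] by (simp add: quotient_algebra_def FactRing_def)
  have zero: "\<zero>\<^bsub>?A\<^esub> = ?c 0"
    by (auto simp: quotient_algebra_def FactRing_def coset)
  have smult: "a \<odot>\<^bsub>?A\<^esub> ?c p = ?c (pm_scale a p)" for a p
  proof -
    have "?c (pm_scale a q) = ?c (pm_scale a p)" if "q \<in> ?c p" for q
    proof -
      have "q - p \<in> I" using eqc[OF that] eq_iff by blast
      then have "pm_scale a (q - p) \<in> I"
        using J.I_l_closed[of "q - p" "Poly_Mapping.single 0 a"] by (simp add: pm_scale_eq_mult)
      then show ?thesis by (simp add: eq_iff pm.scale_right_diff_distrib)
    qed
    then have "(\<Union>q\<in>?c p. ?c (pm_scale a q)) = ?c (pm_scale a p)"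
      using self[of p] by blast
    then show ?thesis by (simp add: quotient_algebra_def)
  qed
  have fsum: "finsum ?A (\<lambda>w. ?c (g w)) W = ?c (\<Sum>w\<in>W. g w)" if "finite W" for g :: "'b \<Rightarrow> 'a \<Rightarrow>\<^sub>0 'k" and W
    using that by (induction W rule: finite_induct) (auto simp: zero add carr)
  let ?h = "\<lambda>w. ?c (e w)"
  show inj: "inj_on ?h S"
  proof (rule inj_onI, rule ccontr)
    fix v w assume vw: "v \<in> S" "w \<in> S" "?h v = ?h w" "v \<noteq> w"
    \<comment> \<open>Equal cosets give the relation \<open>e v - e w\<close>.\<close>
    define c :: "'b \<Rightarrow> 'k" where "c x = (if x = v then 1 else - 1)" for x
    have "(\<Sum>x\<in>{v, w}. pm_scale (c x) (e x)) = e v - e w" using vw(4) by (simp add: c_def)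
    then have "(\<Sum>x\<in>{v, w}. pm_scale (c x) (e x)) \<in> I" using vw(3) eq_iff by simp
    from indep[OF _ _ this, of v] have "c v = 0" using vw by simp
    then show False by (simp add: c_def)
  qed
  have lincomb: "A.lincomb a (?h ` W) = ?c (\<Sum>w\<in>W. pm_scale (a (?h w)) (e w))"
    if "finite W" "W \<subseteq> S" for a W
  proof -
    have "A.lincomb a (?h ` W) = finsum ?A (\<lambda>w. a (?h w) \<odot>\<^bsub>?A\<^esub> ?h w) W"
      unfolding A.lincomb_def
      by (rule A.finsum_reindex) (use inj that in \<open>auto simp: smult carr intro: inj_on_subset\<close>)
    then show ?thesis by (simp add: smult fsum that)
  qed
  show "A.basis (?h ` S)" unfolding A.basis_def
  proof (intro conjI)
    show "?h ` S \<subseteq> carrier ?A" by (auto simp: carr)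
    show "A.lin_indpt (?h ` S)"
    proof
      assume "A.lin_dep (?h ` S)"
      then obtain T a v where T: "finite T" "T \<subseteq> ?h ` S" "A.lincomb a T = \<zero>\<^bsub>?A\<^esub>" "v \<in> T" "a v \<noteq> 0"
        unfolding A.lin_dep_def by auto
      obtain W where W: "W \<subseteq> S" "inj_on ?h W" "T = ?h ` W" using T(2) unfolding subset_image_inj by blast
      have fin: "finite W" using T(1) W finite_image_iff by blast
      have "?c (\<Sum>w\<in>W. pm_scale (a (?h w)) (e w)) = ?c 0"
        using T(3) lincomb[OF fin W(1)] zero unfolding W(3) by simp
      then have "(\<Sum>w\<in>W. pm_scale (a (?h w)) (e w)) \<in> I" by (simp add: eq_iff)
      moreover obtain w where "w \<in> W" "v = ?h w" using T(4) W(3) by blast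
      ultimately show False using indep[OF fin W(1), of "\<lambda>w. a (?h w)" w] T(5) by simp
    qed
    show "A.span (?h ` S) = carrier ?A"
    proof
      show "A.span (?h ` S) \<subseteq> carrier ?A" by (rule A.span_is_subset2) (auto simp: carr)
      show "carrier ?A \<subseteq> A.span (?h ` S)"
      proof
        fix x assume "x \<in> carrier ?A"
        then obtain p where p: "x = ?c p" by (auto simp: carr)
        obtain W c where W: "finite W" "W \<subseteq> S" "p - (\<Sum>w\<in>W. pm_scale (c w) (e w)) \<in> I" using gen by blast
        have injW: "inj_on ?h W" using inj W(2) by (rule inj_on_subset)
        define a where "a y = c (the_inv_into W ?h y)" for y
        have "a (?h w) = c w" if "w \<in> W" for w
          using the_inv_into_f_f[OF injW that] by (simp add: a_def)
        then have "A.lincomb a (?h ` W) = ?c (\<Sum>w\<in>W. pm_scale (c w) (e w))"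
          using lincomb[OF W(1,2), of a] by simp
        also have "\<dots> = x" unfolding p by (rule eq_iff[THEN iffD2, OF W(3), symmetric])
        finally have "x = A.lincomb a (?h ` W)" by (rule sym)
        then show "x \<in> A.span (?h ` S)"
          unfolding A.span_def using W(1,2)
          by (intro CollectI exI[of _ a] exI[of _ "?h ` W"] conjI) auto
      qed
    qed
  qed
qed

theorem proposition2p4:
  fixes d :: "'x::wellorder \<Rightarrow> nat"
    and I :: "('x list \<Rightarrow>\<^sub>0 'k::field) set"
  assumes deg_pos: "\<And>x. d x > 0"
    and ideal: "ideal I class_ring"
    and comult: "\<exists>\<Delta>. comultiplication \<Delta> \<and> triangular d \<Delta> \<and>
      \<Delta> ` I \<subseteq> tensor_space UNIV I + tensor_space I UNIV"
  shows "(\<forall>v. lyndon v \<and> reducible d I v \<longrightarrow>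
      bracket v \<in> hom_part (word_deg d) (irred_alg_lt d I v) (word_deg d v)
        + lower_part (word_deg d) (irred_alg d I) (word_deg d v) + I) \<and>
    (\<forall>u\<in>irred_lyndon d I. \<forall>v\<in>irred_lyndon d I. lex_less v u \<longrightarrow>
      bracket u * bracket v - bracket v * bracket u
        \<in> hom_part (word_deg d) (irred_alg_le d I (u @ v)) (word_deg d (u @ v))
          + lower_part (word_deg d) (irred_alg d I) (word_deg d (u @ v)) + I) \<and>
    (CHAR('k) = 0 \<and> I \<noteq> UNIV \<longrightarrow>
      inj_on (\<lambda>w. I +>\<^bsub>class_ring\<^esub> bracket w) (nondecreasing_products d I) \<and>
      vectorspace.basis class_ring (quotient_algebra I)
        ((\<lambda>w. I +>\<^bsub>class_ring\<^esub> bracket w) ` nondecreasing_products d I) \<and>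
      nondecreasing_products d I = {w. \<not> reducible d I w})"
proof -
  obtain \<Delta> where \<Delta>: "comultiplication \<Delta>" "triangular d \<Delta>"
    "\<Delta> ` I \<subseteq> tensor_space UNIV I + tensor_space I UNIV"
    using comult by blast
  interpret triangular_quotient d \<Delta> I
    using deg_pos ideal \<Delta>
    by (simp add: triangular_quotient_def triangular_comultiplication_def triangular_quotient_axioms_def)
  show ?thesis
  proof (intro conjI allI ballI impI)
    show "bracket v \<in> hom_part (word_deg d) (irred_alg_lt d I v) (word_deg d v)
        + lower_part (word_deg d) (irred_alg d I) (word_deg d v) + I" if "lyndon v \<and> reducible d I v" for v
      using reducible_lyndon_relation that by blast
    show "bracket u * bracket v - bracket v * bracket u
        \<in> hom_part (word_deg d) (irred_alg_le d I (u @ v)) (word_deg d (u @ v))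
          + lower_part (word_deg d) (irred_alg d I) (word_deg d (u @ v)) + I"
      if "u \<in> irred_lyndon d I" "v \<in> irred_lyndon d I" "lex_less v u" for u v
      using commutator_relation that by blast
    assume *: "CHAR('k) = 0 \<and> I \<noteq> UNIV"
    show eq: "nondecreasing_products d I = {w. \<not> reducible d I w}"
    proof safe
      fix w assume "w \<in> nondecreasing_products d I" "reducible d I w"
      then show False using nondecreasing_products_irreducible * by blast
    next
      fix w assume "\<not> reducible d I w"
      then show "w \<in> nondecreasing_products d I"
        by (rule irreducible_nondecreasing) (auto simp: nondecreasing_products_def)
    qed
    show "inj_on (\<lambda>w. I +>\<^bsub>class_ring\<^esub> bracket w) (nondecreasing_products d I)"
      "vectorspace.basis class_ring (quotient_algebra I)
        ((\<lambda>w. I +>\<^bsub>class_ring\<^esub> bracket w) ` nondecreasing_products d I)"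
      unfolding eq
      by (rule quotient_basis[of I "{w. \<not> reducible d I w}" bracket, OF ideal irreducible_bracket_generate],
          erule (3) irreducible_bracket_independent)+
  qed
qed

end
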